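(* Let $f(z)=z+\sum_{n=2}^{\infty}a_nz^n\in\mathcal{C}_3$ and let $p\ge1$. Then $$|z|+\sum_{n=2}^{\infty}|a_nz^n|+\sum_{n=2}^{\infty}|a_n|^{p}|z|^{np}\le d(f(0),\partial f(\mathbb{D}))$$ for $|z|\le R_p$, where $R_p\in(0,1/2)$ is the root of the equation $$\frac{(3-r)r}{3(1-r)}+\sum_{n=2}^{\infty}\frac{r^n}{3n^2}+\sum_{n=2}^{\infty}\left(\frac23+\frac{1}{3n^2}\right)^p r^{np}-\frac{1}{36}\left(12+\pi^2\right)=0.$$ The result is sharp, i.e. for each $p\ge1$ the number $R_p$ cannot be replaced by any larger number such that the inequality still holds for all $f\in\mathcal{C}_3$.
   Context: $\mathbb{D}=\{z\in\mathbb{C}:|z|<1\}$; $d$ is the Euclidean distance and $\partial f(\mathbb{D})$ is the boundary of $f(\mathbb{D})$. A convex function is a univalent analytic function on $\mathbb{D}$ whose image is a convex domain. The class $\mathcal{C}_3$ consists of the analytic functions $f(z)=z+\sum_{n=2}^\infty a_nz^n$ on $\mathbb{D}$ for which there exists a convex function $g(z)=b_1z+\cdots$ with $\operatorname{Re}(b_1)>0$ such that $\operatorname{Re}\left(\frac{\bigl(z(zf'(z))'\bigr)'}{(zg'(z))'}\right)>0$ for all $z\in\mathbb{D}$. Here $p$ is a real number. *)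

theory Defs
  imports "HOL-Complex_Analysis.Complex_Analysis"
begin

definition convex_function :: "(complex \<Rightarrow> complex) \<Rightarrow> bool" where
  "convex_function g \<longleftrightarrow>
     g holomorphic_on ball 0 1 \<and> inj_on g (ball 0 1) \<and> convex (g ` ball 0 1)"

(* A quotient with zero denominator is 0 in HOL and so does not have positive real part:
   the condition below forces (z g'(z))' to be nonzero on the disc. *)
definition class_C3 :: "(complex \<Rightarrow> complex) set" where
  "class_C3 = {f. f holomorphic_on ball 0 1 \<and> f 0 = 0 \<and> deriv f 0 = 1 \<and>
     (\<exists>g. convex_function g \<and> g 0 = 0 \<and> Re (deriv g 0) > 0 \<and>
        (\<forall>z\<in>ball 0 1.
           Re (deriv (\<lambda>w. w * deriv (\<lambda>v. v * deriv f v) w) z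
               / deriv (\<lambda>w. w * deriv g w) z) > 0))}"

definition taylor_coeff :: "(complex \<Rightarrow> complex) \<Rightarrow> nat \<Rightarrow> complex" where
  "taylor_coeff f n = fps_nth (fps_expansion f 0) n"

(* Sums over n \<ge> 2 are written with the index shifted to n + 2. Real powers are powr;
   note 0 powr x = 0, which is the right value for the positive exponents p and n p. *)

definition bohr_sum :: "real \<Rightarrow> (complex \<Rightarrow> complex) \<Rightarrow> complex \<Rightarrow> real" where
  "bohr_sum p f z = norm z
     + (\<Sum>n. norm (taylor_coeff f (n + 2) * z ^ (n + 2)))
     + (\<Sum>n. norm (taylor_coeff f (n + 2)) powr p * norm z powr (real (n + 2) * p))"

definition radius_fun :: "real \<Rightarrow> real \<Rightarrow> real" where
  "radius_fun p r = (3 - r) * r / (3 * (1 - r))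
     + (\<Sum>n. r ^ (n + 2) / (3 * real (n + 2) ^ 2))
     + (\<Sum>n. (2 / 3 + 1 / (3 * real (n + 2) ^ 2)) powr p * r powr (real (n + 2) * p))
     - 1 / 36 * (12 + pi ^ 2)"

end

theory Submission
  imports Defs
begin

text \<open>
  Normalise the convex function to \<open>g'(0) = 1\<close> and put \<open>G = z g'\<close>, \<open>\<phi> = z f'\<close>, \<open>N = z \<phi>'\<close>, so that
  \<open>N' = p G'\<close> with \<open>p(0) = 1\<close> and \<open>Re (cnj e * p) > 0\<close> for a unimodular \<open>e\<close>; write \<open>a = Re e\<close>.
  Caratheodory's coefficient bounds for \<open>p\<close> and for \<open>1 + z g''/g'\<close> give
  \<open>|a_n| \<le> 2/3 + 1/(3 n^2)\<close>, and the root of the radius equation is where the resulting majorant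
  reaches \<open>(12 + pi^2)/36\<close>. It remains to bound the distance to the boundary from below by this number.

  Since \<open>G\<close> is starlike, \<open>N\<close> can be integrated along the preimages under \<open>G\<close> of rays, on which
  \<open>dG\<close> has constant argument; the functions \<open>\<phi>\<close> and \<open>f\<close> are close-to-convex, hence univalent,
  and a lower bound for the derivative of a univalent function can be integrated along the preimages of rays
  under the function itself. For \<open>e = 1\<close> this gives the sharp bounds
  \<open>|N| \<ge> r(3 + r^2)/(3(1 + r)^3)\<close> and, after two more integrations, \<open>|f| \<ge> -f_0(-r)\<close> for the extremal \<open>f_0\<close>.
  For \<open>e \<noteq> 1\<close> the bound for \<open>N\<close> fails near the unit circle, where only its \<open>a\<close>-fold survives, but for
  \<open>r^2 \<le> 1/2\<close> there is a gain proportional to \<open>1 - a\<close>. The correction \<open>(1 - a)(r^2/3 - 2 r^5)\<close>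
  is valid on both ranges, and it becomes \<open>(1 - a)/300 \<ge> 0\<close> after the two integrations up to \<open>r = 1\<close>.
\<close>

section \<open>Functions with positive real part\<close>

text \<open>Of \<open>g'(0)\<close> only the sign of the real part is known, so \<open>e\<close>
  cannot be normalised away, and two imperfect estimates of \<open>N\<close> remain. Bounding
  \<open>Re (cnj e * p)\<close> works on the whole disc but loses the factor \<open>a\<close>;
  bounding \<open>Re p\<close> loses nothing at 0, but that bound is certain to be nonnegative only
  for r^2 at most 1/2. The distance must not depend on \<open>e\<close>, so a gain at small radii
  has to pay for the loss at large ones. It can, because each of the two later integrations is
  against dr/r and divides the coefficient of r^n by n, which favours low powers.

  Univalence climbs a chain of quotients with positive real part: N/G equals \<phi>'/g', which makes
  \<phi> close-to-convex with respect to \<open>g\<close>; \<phi>/g equals f'/k' with z k' = g,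
  which makes \<open>f\<close> close-to-convex with respect to \<open>k\<close>. Here
  \<open>k\<close> is convex because \<open>g\<close>, being convex, is starlike. Each quotient
  inherits its sign from the quotient of the derivatives by integration along preimages of
  rays.\<close>

lemma Re_pos_if_Re_nonneg:
  assumes f: "f holomorphic_on ball 0 1"
    and nonneg: "\<And>z. z \<in> ball 0 1 \<Longrightarrow> Re (f z) \<ge> 0"
    and "Re (f 0) > 0" and z: "z \<in> ball 0 1"
  shows "Re (f z) > 0"
proof (rule ccontr)
  assume "\<not> Re (f z) > 0"
  with nonneg[OF z] have z0: "Re (f z) = 0" by simp
  have nc: "\<not> f constant_on ball 0 1"
    using z z0 assms(3) unfolding constant_on_def by force
  have "open (f ` ball 0 1)"
    using open_mapping_thm[OF f open_ball connected_ball open_ball _ nc] by auto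
  then obtain e where e: "e > 0" "ball (f z) e \<subseteq> f ` ball 0 1"
    using z by (meson imageI open_contains_ball)
  have "f z - of_real (e/2) \<in> ball (f z) e"
    using e(1) by (simp add: dist_norm)
  with e(2) obtain w where "w \<in> ball 0 1" "f w = f z - of_real (e/2)"
    by (metis (no_types, lifting) image_iff subsetD)
  then show False
    using nonneg[of w] z0 e(1) by simp
qed

lemma Re_inverse_pos: "Re z > 0 \<Longrightarrow> Re (inverse z) > 0"
  by (auto intro!: divide_pos_pos add_pos_nonneg)

text \<open>Schwarz lemma after the Moebius map that takes the half-plane
  \<open>Re (cnj e * w) > 0\<close> to the unit disc and \<open>p 0 = 1\<close> to 0; its pole
  \<open>- e^2\<close> is the mirror image of 1 in the boundary line.\<close>

lemma Caratheodory_disc: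
  assumes p: "p holomorphic_on ball 0 1" and p0: "p 0 = 1"
    and pos: "\<And>z. z \<in> ball 0 1 \<Longrightarrow> Re (cnj e * p z) > 0" and e: "norm e = 1"
    and z: "z \<in> ball 0 1"
  shows "norm (p z - 1) \<le> norm z * norm (p z + e\<^sup>2)"
proof -
  have ae: "Re e > 0" using pos[of 0] p0 by simp
  have ee: "e * cnj e = 1" using e by (simp add: complex_norm_square[symmetric])
  have lt: "norm (p w - 1) < norm (p w + e\<^sup>2)" if "w \<in> ball 0 1" for w
  proof -
    define u where "u = cnj e * p w"
    have u: "Re u > 0" using pos that by (simp add: u_def)
    have "norm (u - cnj e) < norm (u + e)"
    proof (rule power2_less_imp_less)
      have "(norm (u + e))\<^sup>2 - (norm (u - cnj e))\<^sup>2 = 4 * Re u * Re e"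
        unfolding cmod_power2 by (simp add: power2_eq_square algebra_simps)
      also have "\<dots> > 0" using u ae by simp
      finally show "(norm (u - cnj e))\<^sup>2 < (norm (u + e))\<^sup>2" by simp
    qed simp
    moreover have "u - cnj e = cnj e * (p w - 1)" "u + e = cnj e * (p w + e\<^sup>2)"
      using ee by (simp_all add: u_def algebra_simps power2_eq_square)
    ultimately show ?thesis using e by (simp add: norm_mult)
  qed
  define om where "om = (\<lambda>w. (p w - 1) / (p w + e\<^sup>2))"
  have nz: "p w + e\<^sup>2 \<noteq> 0" if "w \<in> ball 0 1" for w using lt[OF that] by force
  have "om holomorphic_on ball 0 1"
    unfolding om_def using nz by (intro holomorphic_intros p) auto
  moreover have "om 0 = 0" by (simp add: om_def p0)
  moreover have "norm (om w) < 1" if "norm w < 1" for w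
    using lt[of w] that nz[of w] by (simp add: om_def norm_divide)
  ultimately have "norm (om z) \<le> norm z"
    using Schwarz_Lemma(1)[of om z] z by simp
  then show ?thesis
    using nz[OF z] by (simp add: om_def norm_divide divide_le_eq)
qed

text \<open>Squaring the previous inequality confines \<open>p z\<close> to a disc with centre 1 + 2
  a r^2 e / (1 - r^2) and radius 2 a r / (1 - r^2), where \<open>a = Re e\<close>; the bound is the
  extent of this disc in direction \<open>d\<close>. For \<open>d = cnj e\<close> it becomes a (1 -
  r) / (1 + r), which is always positive; for \<open>d = 1\<close> it can be negative.\<close>

lemma Caratheodory_Re_bound:
  assumes p: "p holomorphic_on ball 0 1" and p0: "p 0 = 1"
    and pos: "\<And>z. z \<in> ball 0 1 \<Longrightarrow> Re (cnj e * p z) > 0" and e: "norm e = 1"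
    and z: "z \<in> ball 0 1" and d: "norm d = 1"
  shows "Re d + (2 * Re e * Re (d * e) * (norm z)\<^sup>2 - 2 * Re e * norm z) / (1 - (norm z)\<^sup>2)
    \<le> Re (d * p z)"
proof -
  define y where "y = p z - 1"
  define r where "r = norm z"
  define a where "a = Re e"
  have r: "0 \<le> r" "r < 1" using z by (auto simp: r_def)
  have ae: "a > 0" using pos[of 0] p0 by (simp add: a_def)
  have r2: "1 - r\<^sup>2 > 0" using r by (simp add: power_less_one_iff abs_square_less_1)
  have ee: "e * cnj e = 1" using e by (simp add: complex_norm_square[symmetric])
  have e2: "1 + e\<^sup>2 = 2 * a * e"
  proof -
    have "1 + e\<^sup>2 = e * (cnj e + e)" using ee by (simp add: algebra_simps power2_eq_square)
    also have "cnj e + e = 2 * a" by (simp add: a_def complex_eq_iff)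
    finally show ?thesis by simp
  qed
  have "norm y \<le> r * norm (y + (1 + e\<^sup>2))"
    using Caratheodory_disc[OF p p0 pos e z] by (simp add: y_def r_def algebra_simps)
  then have "norm y \<le> r * norm (y + 2 * a * e)" by (simp add: e2)
  then have "(norm y)\<^sup>2 \<le> (r * norm (y + 2 * a * e))\<^sup>2"
    by (intro power_mono) auto
  then have ineq: "(norm y)\<^sup>2 \<le> r\<^sup>2 * ((norm y)\<^sup>2 + 4 * a\<^sup>2 + 4 * a * Re (y * cnj e))"
  proof -
    have "(norm (y + 2 * a * e))\<^sup>2 = (norm y)\<^sup>2 + 4 * a\<^sup>2 * (norm e)\<^sup>2 + 4 * a * Re (y * cnj e)"
      unfolding cmod_power2 by (simp add: power2_eq_square algebra_simps)
    then show ?thesis using \<open>(norm y)\<^sup>2 \<le> (r * norm (y + 2 * a * e))\<^sup>2\<close> e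
      by (simp add: power_mult_distrib)
  qed
  define c where "c = of_real (2 * a * r\<^sup>2) * e"
  have "(norm (of_real (1 - r\<^sup>2) * y - c))\<^sup>2
      = (1 - r\<^sup>2)\<^sup>2 * (norm y)\<^sup>2 + 4 * a\<^sup>2 * r^4 * (norm e)\<^sup>2 - (1 - r\<^sup>2) * (4 * a * r\<^sup>2) * Re (y * cnj e)"
    unfolding cmod_power2 c_def by (simp add: power2_eq_square algebra_simps eval_nat_numeral)
  also have "\<dots> = (1 - r\<^sup>2) * ((norm y)\<^sup>2 - r\<^sup>2 * ((norm y)\<^sup>2 + 4 * a\<^sup>2 + 4 * a * Re (y * cnj e)))
       + (2 * a * r)\<^sup>2"
    using e by (simp add: power2_eq_square algebra_simps eval_nat_numeral)
  also have "\<dots> \<le> (2 * a * r)\<^sup>2"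
    using ineq r2 by (simp add: mult_nonneg_nonpos)
  finally have nb: "norm (of_real (1 - r\<^sup>2) * y - c) \<le> 2 * a * r"
    using r ae by (simp add: power2_le_iff_abs_le)
  have "- Re (d * (of_real (1 - r\<^sup>2) * y - c)) \<le> 2 * a * r"
    using abs_Re_le_cmod[of "d * (of_real (1 - r\<^sup>2) * y - c)"] nb d by (simp add: norm_mult)
  then have "2 * a * r\<^sup>2 * Re (d * e) - 2 * a * r \<le> (1 - r\<^sup>2) * Re (d * y)"
    by (simp add: c_def algebra_simps)
  then have "(2 * a * r\<^sup>2 * Re (d * e) - 2 * a * r) / (1 - r\<^sup>2) \<le> Re (d * y)"
    using r2 by (simp add: divide_le_eq mult.commute)
  then show ?thesis by (simp add: y_def r_def a_def algebra_simps)
qed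

lemma has_real_derivative_norm_curve:
  fixes c :: "real \<Rightarrow> complex"
  assumes c: "(c has_vector_derivative c') (at s within A)" and "c s \<noteq> 0"
  shows "((\<lambda>s. norm (c s)) has_real_derivative Re (cnj (c s) * c') / norm (c s)) (at s within A)"
proof -
  have 1: "((\<lambda>s. Re (c s)) has_real_derivative Re c') (at s within A)"
    "((\<lambda>s. Im (c s)) has_real_derivative Im c') (at s within A)"
    using c by (auto simp: has_vector_derivative_complex_iff)
  have "(Re (c s))\<^sup>2 + (Im (c s))\<^sup>2 > 0"
    using assms(2) by (simp add: complex_eq_iff sum_power2_gt_zero_iff)
  then show ?thesis
    unfolding cmod_def
    by (auto intro!: derivative_eq_intros 1 c simp: divide_simps)
qed

text \<open>On a circle of radius \<open>r\<close> the conjugate of z^n is r^(2n) / z^n, so the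
  conjugate of \<open>u\<close> contributes nothing to the Cauchy integral of the n-th coefficient.
  The coefficient is therefore the mean of 2 Re u / z^n, which nonnegativity bounds by 2 Re (u 0) /
  r^n; then \<open>r\<close> tends to 1.\<close>

lemma Re_nonneg_coeff_bound:
  fixes u :: "complex \<Rightarrow> complex"
  assumes u: "u holomorphic_on ball 0 1"
    and nonneg: "\<And>z. z \<in> ball 0 1 \<Longrightarrow> Re (u z) \<ge> 0" and n: "n > 0"
  shows "norm (fps_nth (fps_expansion u 0) n) \<le> 2 * Re (u 0)"
proof -
  have main: "norm (fps_nth (fps_expansion u 0) n) * r ^ n \<le> 2 * Re (u 0)" if r: "0 < r" "r < 1" for r
  proof -
    define \<gamma> where "\<gamma> = circlepath 0 r"
    have \<gamma>: "\<gamma> t = r * exp (2 * pi * \<i> * t)" for t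
      by (simp add: \<gamma>_def circlepath)
    have n\<gamma>: "norm (\<gamma> t) = r" for t using r by (simp add: \<gamma> norm_mult)
    have \<gamma>nz: "\<gamma> t \<noteq> 0" for t using n\<gamma>[of t] r by auto
    have cauchy: "((\<lambda>t. f (\<gamma> t) / \<gamma> t ^ k) has_integral (deriv ^^ k) f 0 / fact k) {0..1}"
      if f: "f holomorphic_on ball 0 1" for f k
    proof -
      have "((\<lambda>w. f w / (w - 0) ^ Suc k) has_contour_integral
             ((2 * pi * \<i>) / fact k * (deriv ^^ k) f 0)) (circlepath 0 r)"
        using r by (intro Cauchy_has_contour_integral_higher_derivative_circlepath
            holomorphic_on_imp_continuous_on holomorphic_on_subset[OF f]) auto
      then have "((\<lambda>t. f (\<gamma> t) / \<gamma> t ^ Suc k * (2 * pi * \<i> * \<gamma> t)) has_integral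
             ((2 * pi * \<i>) / fact k * (deriv ^^ k) f 0)) {0..1}"
        unfolding has_contour_integral_def \<gamma>_def[symmetric]
      proof (rule has_integral_eq[rotated])
        fix t :: real assume "t \<in> {0..1}"
        then have "vector_derivative \<gamma> (at t within {0..1}) = 2 * pi * \<i> * \<gamma> t"
          unfolding \<gamma>_def by (subst vector_derivative_circlepath01) (auto simp: circlepath)
        then show "f (\<gamma> t) / (\<gamma> t - 0) ^ Suc k * vector_derivative \<gamma> (at t within {0..1})
            = f (\<gamma> t) / \<gamma> t ^ Suc k * (2 * pi * \<i> * \<gamma> t)" by simp
      qed
      then have "((\<lambda>t. f (\<gamma> t) / \<gamma> t ^ Suc k * (2 * pi * \<i> * \<gamma> t) / (2 * pi * \<i>)) has_integral
             ((2 * pi * \<i>) / fact k * (deriv ^^ k) f 0) / (2 * pi * \<i>)) {0..1}"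
        by (rule has_integral_divide)
      then show ?thesis using \<gamma>nz by (simp add: field_simps)
    qed
    have 1: "((\<lambda>t. u (\<gamma> t) / \<gamma> t ^ n) has_integral (fps_nth (fps_expansion u 0) n)) {0..1}"
      using cauchy[OF u, of n] by (simp add: fps_expansion_def)
    have "(\<lambda>z. u z * z ^ n) holomorphic_on ball 0 1" by (intro holomorphic_intros u)
    from cauchy[OF this, of 0] have "((\<lambda>t. u (\<gamma> t) * \<gamma> t ^ n) has_integral 0) {0..1}"
      using n by (simp add: zero_power)
    then have "((\<lambda>t. cnj (u (\<gamma> t) * \<gamma> t ^ n)) has_integral cnj 0) {0..1}"
      unfolding has_integral_cnj[unfolded o_def, where f = "\<lambda>t. u (\<gamma> t) * \<gamma> t ^ n"] .
    then have "((\<lambda>t. cnj (u (\<gamma> t) * \<gamma> t ^ n) / of_real (r ^ (2 * n))) has_integral cnj 0 / of_real (r ^ (2 * n))) {0..1}"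
      by (rule has_integral_divide)
    moreover have "cnj (u (\<gamma> t) * \<gamma> t ^ n) / of_real (r ^ (2 * n)) = cnj (u (\<gamma> t)) / \<gamma> t ^ n" for t
    proof -
      have "cnj (\<gamma> t) * \<gamma> t = of_real (r\<^sup>2)"
        using n\<gamma>[of t] complex_norm_square[of "\<gamma> t"] by (simp add: mult.commute)
      then have "cnj (\<gamma> t) ^ n * \<gamma> t ^ n = of_real (r ^ (2 * n))"
        by (simp add: power_mult_distrib[symmetric] power_mult)
      then show ?thesis using \<gamma>nz[of t] r by (simp add: field_simps)
    qed
    ultimately have 2: "((\<lambda>t. cnj (u (\<gamma> t)) / \<gamma> t ^ n) has_integral 0) {0..1}" by simp
    have 3: "((\<lambda>t. of_real (2 * Re (u (\<gamma> t))) / \<gamma> t ^ n) has_integral (fps_nth (fps_expansion u 0) n)) {0..1}"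
      using has_integral_add[OF 1 2] by (simp add: add_divide_distrib[symmetric] complex_add_cnj)
    from cauchy[OF u, of 0] have "((\<lambda>t. u (\<gamma> t)) has_integral u 0) {0..1}" by simp
    then have "((\<lambda>t. Re (u (\<gamma> t))) has_integral Re (u 0)) {0..1}"
      by (rule has_integral_Re)
    then have 4: "((\<lambda>t. 2 * Re (u (\<gamma> t)) / r ^ n) has_integral 2 * Re (u 0) / r ^ n) {0..1}"
      by (intro has_integral_divide has_integral_mult_right)
    have "norm (fps_nth (fps_expansion u 0) n) \<le> 2 * Re (u 0) / r ^ n"
    proof (rule integral_norm_bound_integral[OF has_integral_integrable[OF 3] has_integral_integrable[OF 4],
          unfolded integral_unique[OF 3] integral_unique[OF 4]])
      fix t :: real
      have "Re (u (\<gamma> t)) \<ge> 0" using nonneg[of "\<gamma> t"] n\<gamma>[of t] r by simp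
      then show "norm (complex_of_real (2 * Re (u (\<gamma> t))) / \<gamma> t ^ n) \<le> 2 * Re (u (\<gamma> t)) / r ^ n"
        by (simp add: norm_divide norm_power n\<gamma> norm_mult)
    qed
    then show ?thesis using r by (simp add: field_simps)
  qed
  have "((\<lambda>r::real. norm (fps_nth (fps_expansion u 0) n) * r ^ n) \<longlongrightarrow>
      norm (fps_nth (fps_expansion u 0) n) * 1 ^ n) (at_left 1)"
    by (intro tendsto_intros)
  moreover have "\<forall>\<^sub>F r in at_left (1::real). norm (fps_nth (fps_expansion u 0) n) * r ^ n \<le> 2 * Re (u 0)"
    using eventually_at_left_real[of 0 1] by (auto elim!: eventually_mono intro: main)
  ultimately show ?thesis
    using tendsto_upperbound[of _ _ "at_left (1::real)"] by fastforce
qed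

section \<open>Integration along preimages of rays\<close>

text \<open>No curve is integrated: a minimum at a nonzero point of \<open>|G| Re (N/G) - S(|z|) + \<delta> |G|\<close> over a disc
  is excluded by a small step in the direction in which \<open>G\<close> moves radially towards 0; starlikeness
  makes this step stay in the disc.\<close>

lemma starlike_ray_bound:
  fixes G N p :: "complex \<Rightarrow> complex" and S S' :: "real \<Rightarrow> real"
  assumes G: "G holomorphic_on ball 0 1" and N: "N holomorphic_on ball 0 1"
    and G0: "G 0 = 0" and N0: "N 0 = 0"
    and Gnz: "\<And>w. w \<in> ball 0 1 \<Longrightarrow> w \<noteq> 0 \<Longrightarrow> G w \<noteq> 0"
    and star: "\<And>w. w \<in> ball 0 1 \<Longrightarrow> w \<noteq> 0 \<Longrightarrow> Re (w * deriv G w / G w) > 0"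
    and dN: "\<And>w. w \<in> ball 0 1 \<Longrightarrow> w \<noteq> 0 \<Longrightarrow> deriv N w = p w * deriv G w"
    and p: "\<And>w. w \<in> ball 0 1 \<Longrightarrow> w \<noteq> 0 \<Longrightarrow> norm w \<le> R \<Longrightarrow> 0 \<le> Re (p w)"
    and S'_le: "\<And>w. w \<in> ball 0 1 \<Longrightarrow> w \<noteq> 0 \<Longrightarrow> norm w \<le> R \<Longrightarrow>
                  S' (norm w) \<le> Re (p w) * norm (deriv G w)"
    and S: "\<And>r. 0 \<le> r \<Longrightarrow> r < 1 \<Longrightarrow> (S has_real_derivative S' r) (at r)" and S0: "S 0 = 0"
    and z: "z \<in> ball 0 1" "norm z \<le> R"
  shows "S (norm z) \<le> norm (G z) * Re (N z / G z)"
proof (rule field_le_epsilon)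
  fix \<epsilon> :: real assume "\<epsilon> > 0"
  \<comment> \<open>The term with \<delta> decreases strictly along the step below, so that weak
    estimates for the other terms are enough; at \<open>z\<close> it costs at most
    \<epsilon>.\<close>
  define \<delta> where "\<delta> = \<epsilon> / (norm (G z) + 1)"
  have \<delta>: "\<delta> > 0" "\<delta> * norm (G z) \<le> \<epsilon>"
    using \<open>\<epsilon> > 0\<close> by (auto simp: \<delta>_def field_simps add_pos_nonneg)
  define V where "V = (\<lambda>w. norm (G w) * Re (N w / G w))"
  define E where "E = (\<lambda>w. V w - S (norm w) + \<delta> * norm (G w))"
  \<comment> \<open>Where \<open>G\<close> vanishes the quotient is 0 by convention. This bound
    makes \<open>V\<close> continuous at 0, since \<open>N\<close> vanishes there.\<close>
  have V_le: "\<bar>V w\<bar> \<le> norm (N w)" for w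
  proof (cases "G w = 0")
    case False
    have "\<bar>V w\<bar> \<le> norm (G w) * norm (N w / G w)"
      unfolding V_def abs_mult by (intro mult_mono abs_Re_le_cmod) auto
    then show ?thesis using False by (simp add: norm_divide)
  qed (simp add: V_def)
  have contG: "isCont G w" and contN: "isCont N w" if "w \<in> ball 0 1" for w
    using holomorphic_on_imp_continuous_on[OF G] holomorphic_on_imp_continuous_on[OF N] that
    by (simp_all add: continuous_on_eq_continuous_at)
  have "isCont E w" if w: "w \<in> ball 0 1" for w
  proof -
    have "isCont V w"
    proof (cases "w = 0")
      case True
      have "(N \<longlongrightarrow> 0) (at 0)"
        using contN[OF w] True N0 by (simp add: isCont_def)
      then have "(V \<longlongrightarrow> 0) (at 0)"
        by (rule tendsto_0_le[where K = 1]) (use V_le in auto)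
      then show ?thesis using True by (simp add: isCont_def V_def G0)
    next
      case False
      then show ?thesis unfolding V_def
        using contG contN w Gnz[OF w False] by (intro continuous_intros) auto
    qed
    moreover have "isCont (\<lambda>w. S (norm w)) w"
      using DERIV_isCont[OF S[of "norm w"]] w
      by (intro isCont_o2[OF isCont_norm[OF continuous_ident]]) auto
    ultimately show ?thesis unfolding E_def
      using contG w by (intro continuous_intros) auto
  qed
  then have "continuous_on (cball 0 (norm z)) E"
    using z by (intro continuous_at_imp_continuous_on) auto
  then obtain z1 where z1: "z1 \<in> cball 0 (norm z)"
    and min: "\<And>w. w \<in> cball 0 (norm z) \<Longrightarrow> E z1 \<le> E w"
    using continuous_attains_inf[of "cball 0 (norm z)" E] by auto
  have "z1 = 0"
  proof (rule ccontr)
    assume nz: "z1 \<noteq> 0"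
    have z1b: "z1 \<in> ball 0 1" "norm z1 \<le> R" using z z1 by auto
    have Gz1: "G z1 \<noteq> 0" by (rule Gnz[OF z1b(1) nz])
    have pos: "Re (z1 * deriv G z1 / G z1) > 0" by (rule star[OF z1b(1) nz])
    then have G'z1: "deriv G z1 \<noteq> 0" by auto
    \<comment> \<open>Moving along \<open>- \<xi>\<close> changes \<open>G\<close> at the rate
      \<open>- G z1\<close>, straight towards 0. The modulus of the moving point shrinks at the rate
      \<kappa>, whose positivity is starlikeness.\<close>
    define \<xi> where "\<xi> = G z1 / deriv G z1"
    define \<kappa> where "\<kappa> = Re (cnj z1 * \<xi>) / norm z1"
    have "cnj z1 * \<xi> = of_real ((norm z1)\<^sup>2) * inverse (z1 * deriv G z1 / G z1)"
      unfolding complex_norm_square using nz Gz1 G'z1 by (simp add: \<xi>_def field_simps)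
    then have "Re (cnj z1 * \<xi>) = (norm z1)\<^sup>2 * Re (inverse (z1 * deriv G z1 / G z1))"
      by (simp only: times_complex.sel Re_complex_of_real Im_complex_of_real mult_zero_left diff_zero)
    also have "\<dots> > 0"
      using Re_inverse_pos[OF pos] nz by (intro mult_pos_pos) auto
    finally have \<kappa>: "\<kappa> > 0" using nz by (simp add: \<kappa>_def)
    have \<kappa>_le: "\<kappa> \<le> norm \<xi>"
      using complex_Re_le_cmod[of "cnj z1 * \<xi>"] nz by (simp add: \<kappa>_def norm_mult field_simps)
    define c where "c = (\<lambda>s::real. z1 - of_real s * \<xi>)"
    have c0: "c 0 = z1" by (simp add: c_def)
    have c: "(c has_vector_derivative (- \<xi>)) (at 0)"
      unfolding c_def by (auto intro!: derivative_eq_intros simp: has_vector_derivative_def scaleR_conv_of_real)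
    have dG: "(G has_field_derivative deriv G z1) (at z1)"
      and dNz: "(N has_field_derivative deriv N z1) (at z1)"
      using G N z1b by (auto intro!: holomorphic_derivI)
    have Gc: "((\<lambda>s. G (c s)) has_vector_derivative (- G z1)) (at 0)"
      using field_vector_diff_chain_at[OF c, of G "deriv G z1"] dG G'z1 by (simp add: c0 o_def \<xi>_def)
    have "((\<lambda>w. N w / G w) has_field_derivative (deriv N z1 * G z1 - N z1 * deriv G z1) / (G z1 * G z1)) (at z1)"
      by (rule DERIV_divide[OF dNz dG Gz1])
    then have "((\<lambda>s. N (c s) / G (c s)) has_vector_derivative
        (- \<xi>) * ((deriv N z1 * G z1 - N z1 * deriv G z1) / (G z1 * G z1))) (at 0)"
      using field_vector_diff_chain_at[OF c, of "\<lambda>w. N w / G w"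
          "(deriv N z1 * G z1 - N z1 * deriv G z1) / (G z1 * G z1)"] by (simp add: c0 o_def)
    also have "(- \<xi>) * ((deriv N z1 * G z1 - N z1 * deriv G z1) / (G z1 * G z1)) = N z1 / G z1 - p z1"
      using Gz1 G'z1 dN[OF z1b(1) nz] by (simp add: \<xi>_def field_simps)
    finally have Q: "((\<lambda>s. Re (N (c s) / G (c s))) has_real_derivative Re (N z1 / G z1 - p z1)) (at 0)"
      by (auto simp: has_vector_derivative_complex_iff)
    have nG: "((\<lambda>s. norm (G (c s))) has_real_derivative - norm (G z1)) (at 0)"
    proof -
      have "Re (cnj (G z1) * - G z1) / norm (G z1) = - norm (G z1)"
      proof -
        have "Re (cnj (G z1) * - G z1) = - (norm (G z1))\<^sup>2"
          unfolding cmod_power2 by (simp add: power2_eq_square)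
        then show ?thesis using Gz1 by (simp add: power2_eq_square)
      qed
      then show ?thesis
        using has_real_derivative_norm_curve[OF Gc] Gz1 by (simp add: c0)
    qed
    have nc: "((\<lambda>s. norm (c s)) has_real_derivative - \<kappa>) (at 0)"
      using has_real_derivative_norm_curve[OF c] nz by (simp add: c0 \<kappa>_def diff_divide_distrib add_divide_distrib)
    have dS: "(S has_real_derivative S' (norm z1)) (at (norm (c 0)))"
      using S[of "norm z1"] z1b by (simp add: c0)
    \<comment> \<open>The contributions of \<open>N z1 / G z1\<close> from the two factors of
      \<open>V\<close> cancel, leaving only \<open>- norm (G z1) * Re (p z1)\<close>.\<close>
    from DERIV_add[OF DERIV_diff[OF DERIV_mult[OF nG Q] DERIV_chain2[OF dS nc]] DERIV_cmult[OF nG, of \<delta>]]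
    have D: "((\<lambda>s. E (c s)) has_real_derivative
        S' (norm z1) * \<kappa> - norm (G z1) * Re (p z1) - \<delta> * norm (G z1)) (at 0)"
      by (simp add: E_def V_def c0 algebra_simps)
    have "S' (norm z1) * \<kappa> \<le> Re (p z1) * norm (deriv G z1) * \<kappa>"
      using S'_le[OF z1b(1) nz z1b(2)] \<kappa> by (intro mult_right_mono) auto
    also have "\<dots> \<le> Re (p z1) * norm (deriv G z1) * norm \<xi>"
      using p[OF z1b(1) nz z1b(2)] \<kappa>_le by (intro mult_left_mono) auto
    also have "\<dots> = norm (G z1) * Re (p z1)"
      using G'z1 by (simp add: \<xi>_def norm_divide)
    finally have "S' (norm z1) * \<kappa> - norm (G z1) * Re (p z1) - \<delta> * norm (G z1) < 0"
      using \<delta> Gz1 by (smt (verit) mult_pos_pos zero_less_norm_iff)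
    from DERIV_neg_dec_right[OF D this]
    obtain d1 where d1: "d1 > 0" "\<And>h. h > 0 \<Longrightarrow> h < d1 \<Longrightarrow> E (c h) < E (c 0)" by auto
    from DERIV_neg_dec_right[OF nc] \<kappa>
    obtain d2 where d2: "d2 > 0" "\<And>h. h > 0 \<Longrightarrow> h < d2 \<Longrightarrow> norm (c h) < norm (c 0)" by auto
    define h where "h = min d1 d2 / 2"
    have h: "h > 0" "h < d1" "h < d2" using d1 d2 by (auto simp: h_def)
    have "c h \<in> cball 0 (norm z)" using d2(2)[of h] h z1 c0 by auto
    from min[OF this] d1(2)[of h] h c0 show False by simp
  qed
  then have "E z1 = 0" by (simp add: E_def V_def G0 S0)
  with min[of z] have "0 \<le> E z" by simp
  with \<delta> show "S (norm z) \<le> norm (G z) * Re (N z / G z) + \<epsilon>"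
    by (simp add: E_def V_def)
qed

text \<open>The same argument with \<open>(1 + \<delta>)|h| - W(|z|)\<close>. At a minimum \<open>z1\<close>, univalence puts the preimage of the
  segment from 0 to \<open>h z1\<close> inside the disc of radius \<open>|z1|\<close>, so the modulus increases along it.\<close>

lemma univalent_growth:
  fixes h :: "complex \<Rightarrow> complex" and W W' :: "real \<Rightarrow> real"
  assumes h: "h holomorphic_on ball 0 1" and inj: "inj_on h (ball 0 1)" and h0: "h 0 = 0"
    and W: "\<And>r. 0 \<le> r \<Longrightarrow> r < 1 \<Longrightarrow> (W has_real_derivative W' r) (at r)" and W0: "W 0 = 0"
    and W'_le: "\<And>w. w \<in> ball 0 1 \<Longrightarrow> W' (norm w) \<le> norm (deriv h w)"
    and z: "z \<in> ball 0 1"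
  shows "W (norm z) \<le> norm (h z)"
proof (rule field_le_epsilon)
  fix \<epsilon> :: real assume "\<epsilon> > 0"
  define \<delta> where "\<delta> = \<epsilon> / (norm (h z) + 1)"
  have \<delta>: "\<delta> > 0" "\<delta> * norm (h z) \<le> \<epsilon>"
    using \<open>\<epsilon> > 0\<close> by (auto simp: \<delta>_def field_simps add_pos_nonneg)
  define E where "E = (\<lambda>w. (1 + \<delta>) * norm (h w) - W (norm w))"
  have conth: "continuous_on (ball 0 1) h" using h by (rule holomorphic_on_imp_continuous_on)
  have "isCont E w" if w: "w \<in> ball 0 1" for w
  proof -
    have "isCont (\<lambda>w. W (norm w)) w"
      using DERIV_isCont[OF W[of "norm w"]] w
      by (intro isCont_o2[OF isCont_norm[OF continuous_ident]]) auto
    moreover have "isCont h w"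
      using conth w by (simp add: continuous_on_eq_continuous_at)
    ultimately show ?thesis unfolding E_def by (intro continuous_intros)
  qed
  then have "continuous_on (cball 0 (norm z)) E"
    using z by (intro continuous_at_imp_continuous_on) auto
  then obtain z1 where z1: "z1 \<in> cball 0 (norm z)"
    and min: "\<And>w. w \<in> cball 0 (norm z) \<Longrightarrow> E z1 \<le> E w"
    using continuous_attains_inf[of "cball 0 (norm z)" E] by auto
  have "z1 = 0"
  proof (rule ccontr)
    assume nz: "z1 \<noteq> 0"
    define r where "r = norm z1"
    have z1b: "z1 \<in> ball 0 1" using z z1 by auto
    have r: "0 < r" "r < 1" using nz z1b by (auto simp: r_def)
    define m where "m = norm (h z1)"
    have "h z1 \<noteq> h 0" using inj nz z1b by (auto dest: inj_onD)
    then have m: "m > 0" by (simp add: m_def h0)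
    \<comment> \<open>On the circle through \<open>z1\<close> the term \<open>W\<close> is constant,
      so minimality of \<open>E\<close> is minimality of the modulus of \<open>h\<close>.\<close>
    have m_le: "m \<le> norm (h w)" if "norm w = r" for w
    proof -
      have "E z1 \<le> E w" using min[of w] z1 that by (simp add: r_def)
      then show ?thesis using that \<delta> by (simp add: E_def r_def m_def)
    qed
    \<comment> \<open>A frontier point of the image of the smaller disc comes from its bounding
      circle and has modulus at least \<open>m\<close>, so the connected ball of radius
      \<open>m\<close> cannot leave that image.\<close>
    have sub: "ball 0 m \<subseteq> h ` ball 0 r"
    proof (rule ccontr)
      assume "\<not> ?thesis"
      then have "frontier (h ` ball 0 r) \<inter> ball 0 m \<noteq> {}"
      proof -
        have "0 \<in> ball 0 m \<inter> h ` ball 0 r" using m r h0 by (auto intro!: image_eqI[of _ _ 0])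
        with \<open>\<not> ball 0 m \<subseteq> h ` ball 0 r\<close> show ?thesis
          using connected_Int_frontier[of "ball 0 m" "h ` ball 0 r"] by blast
      qed
      then obtain y where y: "y \<in> frontier (h ` ball 0 r)" "norm y < m" by auto
      have "open (h ` ball 0 r)"
        using r by (intro open_mapping_thm3 holomorphic_on_subset[OF h] inj_on_subset[OF inj]) auto
      moreover have "closure (h ` ball 0 r) \<subseteq> h ` cball 0 r"
        using r by (intro closure_minimal compact_imp_closed compact_continuous_image
            continuous_on_subset[OF conth]) auto
      ultimately have "y \<in> h ` cball 0 r" "y \<notin> h ` ball 0 r"
        using y(1) unfolding frontier_def by (auto simp: interior_open)
      then obtain w where "w \<in> cball 0 r" "y = h w" "w \<notin> ball 0 r" by blast
      then show False using m_le[of w] y by auto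
    qed
    obtain H where H: "H holomorphic_on (h ` ball 0 1)"
      "\<And>w. w \<in> ball 0 1 \<Longrightarrow> deriv h w * deriv H (h w) = 1"
      "\<And>w. w \<in> ball 0 1 \<Longrightarrow> H (h w) = w"
      using holomorphic_has_inverse[OF h open_ball inj] by metis
    have op: "open (h ` ball 0 1)" by (rule open_mapping_thm3[OF h open_ball inj])
    define c where "c = (\<lambda>t::real. H (of_real t * h z1))"
    have c1: "c 1 = z1" using H(3)[OF z1b] by (simp add: c_def)
    have cin: "c t \<in> ball 0 r \<and> h (c t) = of_real t * h z1" if "0 < t" "t < 1" for t
    proof -
      have "of_real t * h z1 \<in> ball 0 m" using that m by (simp add: norm_mult m_def)
      then obtain w where "w \<in> ball 0 r" "of_real t * h z1 = h w" using sub by auto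
      then show ?thesis using H(3)[of w] r by (simp add: c_def)
    qed
    define \<xi> where "\<xi> = h z1 * deriv H (h z1)"
    have \<xi>: "norm (deriv h z1) * norm \<xi> = m"
      using H(2)[OF z1b] unfolding \<xi>_def m_def norm_mult
      by (metis mult.left_commute mult.right_neutral norm_mult norm_one)
    have "(H has_field_derivative deriv H (h z1)) (at (of_real 1 * h z1))"
      using H(1) op z1b by (auto intro!: holomorphic_derivI)
    moreover have "((\<lambda>t::real. of_real t * h z1) has_vector_derivative h z1) (at 1)"
      by (auto intro!: derivative_eq_intros simp: has_vector_derivative_def scaleR_conv_of_real)
    ultimately have c: "(c has_vector_derivative \<xi>) (at 1)"
      using field_vector_diff_chain_at[of "\<lambda>t::real. of_real t * h z1" "h z1" 1 H "deriv H (h z1)"]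
      by (simp add: c_def o_def \<xi>_def)
    define \<kappa> where "\<kappa> = Re (cnj z1 * \<xi>) / r"
    have nc: "((\<lambda>t. norm (c t)) has_real_derivative \<kappa>) (at 1)"
      using has_real_derivative_norm_curve[OF c] nz by (simp add: c1 \<kappa>_def r_def)
    \<comment> \<open>For \<open>t < 1\<close> the curve lies in the open disc of radius
      \<open>r\<close> and it ends on the circle, so its modulus cannot be decreasing at the end.
      The sign is needed to multiply the bound on \<open>W'\<close> by \<kappa>.\<close>
    have \<kappa>: "\<kappa> \<ge> 0"
    proof (rule ccontr)
      assume "\<not> \<kappa> \<ge> 0"
      then obtain d where d: "d > 0" "\<And>s. s > 0 \<Longrightarrow> s < d \<Longrightarrow> norm (c 1) < norm (c (1 - s))"
        using DERIV_neg_dec_left[OF nc] by auto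
      define s where "s = min d 1 / 2"
      have s: "s > 0" "s < d" "s < 1" using d by (auto simp: s_def)
      then show False using d(2)[of s] cin[of "1 - s"] c1 by (auto simp: r_def)
    qed
    have \<kappa>_le: "\<kappa> \<le> norm \<xi>"
      using complex_Re_le_cmod[of "cnj z1 * \<xi>"] nz by (simp add: \<kappa>_def norm_mult field_simps r_def)
    \<comment> \<open>This is \<open>E\<close> along the curve, because \<open>h (c t)\<close> has
      modulus \<open>t * m\<close>. A positive derivative at \<open>t = 1\<close> makes
      \<open>E\<close> smaller just before the end, against minimality at \<open>z1\<close>.\<close>
    define e where "e = (\<lambda>t::real. (1 + \<delta>) * (t * m) - W (norm (c t)))"
    have "(W has_real_derivative W' r) (at (norm (c 1)))"
      using W[of r] r by (simp add: c1 r_def)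
    then have De: "(e has_real_derivative (1 + \<delta>) * m - W' r * \<kappa>) (at 1)"
      unfolding e_def using DERIV_chain2[OF _ nc]
      by (auto intro!: derivative_eq_intros)
    have "W' r * \<kappa> \<le> norm (deriv h z1) * \<kappa>"
      using W'_le[OF z1b] \<kappa> by (intro mult_right_mono) (auto simp: r_def)
    also have "\<dots> \<le> norm (deriv h z1) * norm \<xi>"
      using \<kappa>_le by (intro mult_left_mono) auto
    finally have "W' r * \<kappa> \<le> m" using \<xi> by simp
    moreover have "\<delta> * m > 0" using \<delta> m by simp
    ultimately have "(1 + \<delta>) * m - W' r * \<kappa> > 0" by (simp add: algebra_simps)
    from DERIV_pos_inc_left[OF De this]
    obtain d where d: "d > 0" "\<And>s. s > 0 \<Longrightarrow> s < d \<Longrightarrow> e (1 - s) < e 1" by blast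
    define s where "s = min d 1 / 2"
    have s: "s > 0" "s < d" "s < 1" using d by (auto simp: s_def)
    have hc: "h (c (1 - s)) = of_real (1 - s) * h z1" using cin[of "1 - s"] s by simp
    have "norm (h (c (1 - s))) = (1 - s) * m"
      unfolding hc norm_mult norm_of_real m_def using s by simp
    then have "E (c (1 - s)) = e (1 - s)" by (simp add: E_def e_def)
    also have "\<dots> < e 1" using d s by blast
    also have "e 1 = E z1" by (simp add: e_def E_def c1 m_def)
    finally have "E (c (1 - s)) < E z1" .
    moreover have "c (1 - s) \<in> cball 0 (norm z)"
      using cin[of "1 - s"] s z1 by (auto simp: r_def)
    ultimately show False using min by force
  qed
  then have "E z1 = 0" by (simp add: E_def h0 W0)
  with min[of z] have "0 \<le> E z" by simp
  with \<delta> show "W (norm z) \<le> norm (h z) + \<epsilon>"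
    by (simp add: E_def algebra_simps)
qed

section \<open>Convex and close-to-convex functions\<close>

text \<open>For real \<open>t\<close> the map \<open>z \<mapsto> g^{-1}((g(z e^{it}) + g(z e^{-it}))/2)\<close> is a self-map of the disc fixing 0, so by
  Schwarz its value at \<open>z\<close> has modulus at most \<open>|z|\<close>, with equality at \<open>t = 0\<close>; the second derivative in
  \<open>t\<close> at 0 then has a sign.\<close>

lemma convex_function_imp_Re_pos:
  fixes g :: "complex \<Rightarrow> complex"
  assumes g: "g holomorphic_on ball 0 1" and inj: "inj_on g (ball 0 1)"
    and conv: "convex (g ` ball 0 1)" and z: "z \<in> ball 0 1"
  shows "Re (1 + z * deriv (deriv g) z / deriv g z) > 0"
proof -
  have g'nz: "deriv g w \<noteq> 0" if "w \<in> ball 0 1" for w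
    using holomorphic_injective_imp_regular[OF g open_ball inj that] .
  have g': "deriv g holomorphic_on ball 0 1" by (intro holomorphic_deriv g) auto
  have g'': "deriv (deriv g) holomorphic_on ball 0 1" by (intro holomorphic_deriv g') auto
  have dg: "(g has_field_derivative deriv g w) (at w)" if "norm w < 1" for w
    using that by (intro holomorphic_derivI[OF g]) auto
  have dg': "(deriv g has_field_derivative deriv (deriv g) w) (at w)" if "norm w < 1" for w
    using that by (intro holomorphic_derivI[OF g']) auto
  obtain H where H: "H holomorphic_on (g ` ball 0 1)"
    "\<And>w. w \<in> ball 0 1 \<Longrightarrow> deriv g w * deriv H (g w) = 1"
    "\<And>w. w \<in> ball 0 1 \<Longrightarrow> H (g w) = w"
    using holomorphic_has_inverse[OF g open_ball inj] by metis
  have op: "open (g ` ball 0 1)" by (rule open_mapping_thm3[OF g open_ball inj])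
  have H': "deriv H holomorphic_on g ` ball 0 1" by (intro holomorphic_deriv H op)
  have H_in: "norm (H y) < 1" if "y \<in> g ` ball 0 1" for y using that H(3) by auto
  define C where "C = (\<lambda>w t::real. (g (w * cis t) + g (w * cis (- t))) / 2)"
  have C_in: "C w t \<in> g ` ball 0 1" if "norm w < 1" for w t
  proof -
    have "g (w * cis t) \<in> g ` ball 0 1" "g (w * cis (- t)) \<in> g ` ball 0 1"
      using that by (auto simp: norm_mult)
    from convexD_alt[OF conv this, of "1/2"] show ?thesis
      by (simp add: C_def scaleR_conv_of_real add_divide_distrib)
  qed
  have le: "norm (H (C w t)) \<le> norm w" if w: "norm w < 1" for w t
  proof -
    have "(\<lambda>w. H (C w t)) holomorphic_on ball 0 1"
    proof (rule holomorphic_on_compose_gen[where g = H and f = "\<lambda>w. C w t", unfolded o_def])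
      have "(\<lambda>w. g (w * cis s)) holomorphic_on ball 0 1" for s
        by (rule holomorphic_on_compose_gen[where g = g and f = "\<lambda>w. w * cis s" and t = "ball 0 1", unfolded o_def])
           (auto simp: norm_mult intro!: holomorphic_intros g)
      then show "(\<lambda>w. C w t) holomorphic_on ball 0 1"
        unfolding C_def by (intro holomorphic_intros) auto
    qed (use H(1) C_in in auto)
    moreover have "H (C 0 t) = 0" using H(3)[of 0] by (simp add: C_def)
    moreover have "norm (H (C w t)) < 1" if "norm w < 1" for w using H_in C_in[OF that] by simp
    ultimately show ?thesis using Schwarz_Lemma(1)[of "\<lambda>w. H (C w t)" w] w by simp
  qed
  have nonneg: "Re (1 + z * deriv (deriv g) z / deriv g z) \<ge> 0" if z: "z \<in> ball 0 1" for z
  proof (cases "z = 0")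
    case False
    define D where "D = (\<lambda>t::real. (\<i> * (z * cis t) * deriv g (z * cis t)
        - \<i> * (z * cis (- t)) * deriv g (z * cis (- t))) / 2)"
    have nz: "norm (z * cis t) < 1" for t using z by (simp add: norm_mult)
    have vcis: "((\<lambda>t. z * cis (c * t)) has_vector_derivative of_real c * (\<i> * (z * cis (c * t)))) (at t)" for c t :: real
    proof -
      have "((\<lambda>t. z * exp (\<i> * (of_real c * t))) has_field_derivative z * (exp (\<i> * (of_real c * of_real t)) * (\<i> * of_real c))) (at (of_real t))"
        by (auto intro!: derivative_eq_intros)
      from has_vector_derivative_real_field[OF this] show ?thesis
        by (simp add: cis_conv_exp mult_ac)
    qed
    have dC: "(C z has_vector_derivative D t) (at t)" for t
    proof -
      have "((\<lambda>t. g (z * cis (c * t))) has_vector_derivative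
          of_real c * (\<i> * (z * cis (c * t))) * deriv g (z * cis (c * t))) (at t)" for c t :: real
        using field_vector_diff_chain_at[OF vcis dg[OF nz]] by (simp add: o_def)
      from has_vector_derivative_mult_left[OF has_vector_derivative_add[OF this[of 1 t] this[of "-1" t]], of "1/2"]
      show ?thesis by (simp add: C_def[abs_def] D_def)
    qed
    have dD: "(D has_vector_derivative - (z * deriv g z + z\<^sup>2 * deriv (deriv g) z)) (at 0)"
    proof -
      have *: "((\<lambda>t. \<i> * (z * cis (c * t)) * deriv g (z * cis (c * t))) has_vector_derivative
          of_real c * (\<i> * (z * cis (c * t))) * (\<i> * deriv g (z * cis (c * t)) 
            + \<i> * (z * cis (c * t)) * deriv (deriv g) (z * cis (c * t)))) (at t)" for c t :: real
      proof -
        have "((\<lambda>w. \<i> * w * deriv g w) has_field_derivative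
            \<i> * deriv g w + \<i> * w * deriv (deriv g) w) (at w)" if "norm w < 1" for w
          using dg'[OF that] by (auto intro!: derivative_eq_intros)
        from field_vector_diff_chain_at[OF vcis this[OF nz]] show ?thesis
          by (simp add: o_def)
      qed
      have eq: "\<i> * z * (\<i> * deriv g z + \<i> * z * deriv (deriv g) z) = - (z * deriv g z + z\<^sup>2 * deriv (deriv g) z)"
        by (simp add: algebra_simps power2_eq_square)
      from has_vector_derivative_mult_left[OF has_vector_derivative_diff[OF *[of 1 0] *[of "-1" 0]], of "1/2"]
      show ?thesis by (simp add: D_def[abs_def] eq algebra_simps diff_divide_distrib power2_eq_square)
    qed
    \<comment> \<open>Schwarz gives \<open>e t \<le> norm z * norm z = e 0\<close>, a maximum at 0.
      There the first derivative vanishes because \<open>D 0 = 0\<close>, which also removes the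
      second derivative of \<open>H\<close> from the second derivative of \<open>e\<close>; what is
      left cannot be positive.\<close>
    define e where "e = (\<lambda>t. Re (cnj z * H (C z t)))"
    define e' where "e' = (\<lambda>t. Re (cnj z * (D t * deriv H (C z t))))"
    have de: "(e has_real_derivative e' t) (at t)" for t
    proof -
      have "(H has_field_derivative deriv H (C z t)) (at (C z t))"
        using C_in[of z t] z by (intro holomorphic_derivI[OF H(1) op]) auto
      from field_vector_diff_chain_at[OF dC this]
      have "((\<lambda>t. cnj z * H (C z t)) has_vector_derivative cnj z * (D t * deriv H (C z t))) (at t)"
        by (intro has_vector_derivative_mult_right[of _ _ _ "cnj z"]) (simp add: o_def)
      then show ?thesis
        unfolding e_def e'_def by (auto simp: has_vector_derivative_complex_iff)
    qed
    have C0: "C z 0 = g z" by (simp add: C_def)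
    have D0: "D 0 = 0" by (simp add: D_def)
    define k where "k = - (z * deriv g z + z\<^sup>2 * deriv (deriv g) z) * deriv H (g z)"
    have de': "(e' has_real_derivative Re (cnj z * k)) (at 0)"
    proof -
      have "(deriv H has_field_derivative deriv (deriv H) (C z 0)) (at (C z 0))"
        using C_in[of z 0] z by (intro holomorphic_derivI[OF H' op]) auto
      from field_vector_diff_chain_at[OF dC this]
      have 1: "((\<lambda>t. deriv H (C z t)) has_vector_derivative D 0 * deriv (deriv H) (C z 0)) (at 0)"
        by (simp add: o_def)
      have "((\<lambda>t. cnj z * (D t * deriv H (C z t))) has_vector_derivative cnj z * k) (at 0)"
        using has_vector_derivative_mult[OF dD 1]
        by (intro has_vector_derivative_mult_right[of _ _ _ "cnj z"]) (simp add: D0 C0 k_def)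
      then show ?thesis unfolding e'_def by (auto simp: has_vector_derivative_complex_iff)
    qed
    have "Re (cnj z * k) \<le> 0"
    proof (rule ccontr)
      assume "\<not> ?thesis"
      then obtain d where d: "d > 0" "\<And>h. 0 < h \<Longrightarrow> h < d \<Longrightarrow> e' 0 < e' h"
        using DERIV_pos_inc_right[OF de'] by auto
      have "e' 0 = 0" by (simp add: e'_def D0)
      have "e 0 < e (d/2)"
      proof (rule DERIV_pos_imp_increasing_open[of 0 "d/2" e])
        show "\<exists>y. (e has_real_derivative y) (at x) \<and> 0 < y" if "0 < x" "x < d/2" for x
          using de[of x] d that \<open>e' 0 = 0\<close> by (intro exI[of _ "e' x"]) force
        show "continuous_on {0..d/2} e"
          using de by (meson DERIV_isCont continuous_at_imp_continuous_on)
      qed (use d in auto)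
      also have "e (d/2) \<le> norm (cnj z) * norm (H (C z (d/2)))"
        unfolding e_def by (metis complex_Re_le_cmod norm_mult)
      also have "\<dots> \<le> norm z * norm z" using le[of z "d/2"] z by (simp add: mult_left_mono)
      also have "\<dots> = e 0"
        using H(3)[OF z] cmod_power2[of z] unfolding e_def C0
        by (simp add: power2_eq_square)
      finally show False by simp
    qed
    also have "cnj z * k = - of_real ((norm z)\<^sup>2) * (1 + z * deriv (deriv g) z / deriv g z)"
    proof -
      have "deriv H (g z) = 1 / deriv g z" using H(2)[OF z] g'nz[OF z] by (simp add: field_simps)
      then show ?thesis using g'nz[OF z] unfolding k_def complex_norm_square
        by (simp add: field_simps power2_eq_square)
    qed
    finally have "- ((norm z)\<^sup>2 * Re (1 + z * deriv (deriv g) z / deriv g z)) \<le> 0"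
      by (simp only: times_complex.sel Re_complex_of_real Im_complex_of_real mult_zero_left diff_zero
          uminus_complex.sel minus_mult_left minus_zero)
    then show ?thesis using False by (simp add: zero_le_mult_iff)
  qed simp
  show ?thesis
  proof (rule Re_pos_if_Re_nonneg[OF _ nonneg _ z])
    show "(\<lambda>z. 1 + z * deriv (deriv g) z / deriv g z) holomorphic_on ball 0 1"
      using g'nz by (intro holomorphic_intros g' g'') auto
  qed auto
qed

text \<open>The argument of \<open>K\<close> increases by \<open>2 pi\<close> along the circle through \<open>z1\<close>, so starting from \<open>z1\<close> the left-hand
  side first increases and then decreases back to 0.\<close>

lemma supporting_half_plane:
  fixes k K :: "complex \<Rightarrow> complex"
  assumes k: "k holomorphic_on ball 0 1"
    and K: "\<And>z. z \<in> ball 0 1 \<Longrightarrow> K z = z * deriv k z"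
    and k'nz: "\<And>z. z \<in> ball 0 1 \<Longrightarrow> deriv k z \<noteq> 0"
    and star: "\<And>z. z \<in> ball 0 1 \<Longrightarrow> Re (1 + z * deriv (deriv k) z / deriv k z) > 0"
    and z1: "z1 \<in> ball 0 1" and le: "norm z2 \<le> norm z1" and ne: "z2 \<noteq> z1"
  shows "Re ((k z1 - k z2) * cnj (K z1)) > 0"
proof -
  define r where "r = norm z1"
  have r: "0 < r" "r < 1" using z1 le ne by (auto simp: r_def)
  have k': "deriv k holomorphic_on ball 0 1" by (intro holomorphic_deriv k) auto
  have dk: "(k has_field_derivative deriv k w) (at w)" if "norm w < 1" for w
    using that by (intro holomorphic_derivI[OF k]) auto
  have K1: "K z1 \<noteq> 0" using K[OF z1] k'nz[OF z1] r by (auto simp: r_def)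
  obtain L where L: "L holomorphic_on ball 0 1" "\<And>w. w \<in> ball 0 1 \<Longrightarrow> exp (L w) = deriv k w"
    using holomorphic_logarithm_exists[of "ball 0 1" "deriv k" 0] k' k'nz by auto
  have dL: "(L has_field_derivative deriv (deriv k) w / deriv k w) (at w)" if w: "norm w < 1" for w
  proof -
    have 1: "(L has_field_derivative deriv L w) (at w)"
      using w by (intro holomorphic_derivI[OF L(1)]) auto
    then have "((\<lambda>w. exp (L w)) has_field_derivative exp (L w) * deriv L w) (at w)"
      by (auto intro!: derivative_eq_intros)
    then have "(deriv k has_field_derivative exp (L w) * deriv L w) (at w)"
      by (rule has_field_derivative_transform_within_open[of _ _ _ "ball 0 1"]) (use w L in auto)
    then have "deriv (deriv k) w = deriv k w * deriv L w"
      using L(2)[of w] w by (simp add: DERIV_imp_deriv)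
    then show ?thesis using 1 k'nz[of w] w by simp
  qed
  define Z where "Z = (\<lambda>t::real. of_real r * cis t)"
  have Zb: "norm (Z t) < 1" and nZ: "norm (Z t) = r" for t using r by (auto simp: Z_def norm_mult)
  have dZ: "(Z has_vector_derivative \<i> * Z t) (at t)" for t
  proof -
    have "((\<lambda>t. of_real r * exp (\<i> * t)) has_field_derivative of_real r * (exp (\<i> * of_real t) * \<i>)) (at (of_real t))"
      by (auto intro!: derivative_eq_intros)
    from has_vector_derivative_real_field[OF this] show ?thesis
      by (simp add: Z_def[abs_def] cis_conv_exp mult_ac)
  qed
  \<comment> \<open>A continuous argument of \<open>K\<close> along the circle: \<open>t\<close>
    comes from the factor z, the rest from the logarithm \<open>L\<close> of the derivative of
    \<open>k\<close>. Its derivative is the real part in \<open>star\<close>, so it is strictly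
    increasing.\<close>
  define A where "A = (\<lambda>t. t + Im (L (Z t)))"
  define A' where "A' = (\<lambda>t. Re (1 + Z t * deriv (deriv k) (Z t) / deriv k (Z t)))"
  have dA: "(A has_real_derivative A' t) (at t)" for t
  proof -
    have "((\<lambda>t. L (Z t)) has_vector_derivative \<i> * Z t * (deriv (deriv k) (Z t) / deriv k (Z t))) (at t)"
      using field_vector_diff_chain_at[OF dZ dL[OF Zb]] by (simp add: o_def)
    then have "((\<lambda>t. Im (L (Z t))) has_real_derivative Im (\<i> * Z t * (deriv (deriv k) (Z t) / deriv k (Z t)))) (at t)"
      by (auto simp: has_vector_derivative_complex_iff)
    moreover have "1 + Im (\<i> * Z t * q) = Re (1 + Z t * q)" for q
      by (simp add: mult.assoc)
    ultimately show ?thesis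
      unfolding A_def A'_def times_divide_eq_right[symmetric] using DERIV_add[OF DERIV_ident] by metis
  qed
  have A'_pos: "A' t > 0" for t unfolding A'_def using Zb star by simp
  have A_mono: "A s < A t" if "s < t" for s t
    using DERIV_pos_imp_increasing[OF that] dA A'_pos by metis
  have KZ: "K (Z t) = of_real (norm (K (Z t))) * cis (A t)" for t
  proof -
    have "K (Z t) = of_real r * cis t * exp (L (Z t))"
      using K[of "Z t"] L(2)[of "Z t"] Zb[of t] by (simp add: Z_def)
    also have "\<dots> = of_real (r * exp (Re (L (Z t)))) * cis (A t)"
      by (simp add: A_def exp_eq_polar cis_mult[symmetric] exp_of_real)
    finally have *: "K (Z t) = of_real (r * exp (Re (L (Z t)))) * cis (A t)" .
    show ?thesis by (subst (2) *) (use r in \<open>simp add: norm_mult *\<close>)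
  qed
  have KZ_pos: "norm (K (Z t)) > 0" for t
    using K[of "Z t"] k'nz[of "Z t"] Zb[of t] nZ[of t] r by auto
  have Z_per: "Z (t + 2 * pi) = Z t" for t by (simp add: Z_def cis_mult[symmetric])
  define v where "v = (\<lambda>w. Re ((k z1 - k w) * cnj (K z1)))"
  have sphere: "v w > 0" if w: "norm w = r" "w \<noteq> z1" for w
  proof -
    define t1 where "t1 = Arg z1"
    have Z1: "Z t1 = z1" unfolding Z_def t1_def r_def using r
      by (metis complex_norm_eq_1_exp rcis_cmod_Arg rcis_def)
    \<comment> \<open>Lifts the argument of \<open>w\<close> into the single turn that starts at
      \<open>t1\<close>.\<close>
    define t0 where "t0 = (if Arg w > t1 then Arg w else Arg w + 2 * pi)"
    have Zw: "Z (Arg w) = w" unfolding Z_def w(1)[symmetric]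
      by (metis rcis_cmod_Arg rcis_def)
    have Z0: "Z t0 = w" using Zw Z_per by (simp add: t0_def)
    have "Arg w \<noteq> t1" using Z1 Zw w by auto
    then have t0: "t1 < t0" "t0 < t1 + 2 * pi"
      using Arg_bounded[of w] Arg_bounded[of z1] by (auto simp: t0_def t1_def)
    define vt where "vt = (\<lambda>t. v (Z t))"
    define c where "c = norm (K z1)"
    have c: "c > 0" using K1 by (simp add: c_def)
    have dv: "(vt has_real_derivative c * norm (K (Z t)) * sin (A t - A t1)) (at t)" for t
    proof -
      have "((\<lambda>t. k (Z t)) has_vector_derivative \<i> * Z t * deriv k (Z t)) (at t)"
        using field_vector_diff_chain_at[OF dZ dk[OF Zb]] by (simp add: o_def)
      then have "((\<lambda>t. k (Z t)) has_vector_derivative \<i> * K (Z t)) (at t)"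
        using K[of "Z t"] Zb[of t] by (simp add: mult.assoc)
      from has_vector_derivative_mult_left[OF has_vector_derivative_diff[OF has_vector_derivative_const this], of "k z1" "cnj (K z1)"]
      have "(vt has_real_derivative Re ((0 - \<i> * K (Z t)) * cnj (K z1))) (at t)"
        unfolding vt_def v_def has_vector_derivative_complex_iff by simp
      moreover have "Re ((0 - \<i> * K (Z t)) * cnj (K z1)) = c * norm (K (Z t)) * sin (A t - A t1)"
      proof -
        have "K z1 = of_real c * cis (A t1)" using KZ[of t1] by (simp add: Z1 c_def)
        then have "K (Z t) * cnj (K z1) = of_real (norm (K (Z t)) * c) * cis (A t - A t1)"
          by (subst KZ) (simp add: cis_cnj cis_mult)
        then have "Im (K (Z t) * cnj (K z1)) = norm (K (Z t)) * c * sin (A t - A t1)"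
          by (simp only: times_complex.sel Re_complex_of_real Im_complex_of_real cis.sel)
        then show ?thesis by (simp add: algebra_simps)
      qed
      ultimately show ?thesis by simp
    qed
    have cont: "continuous_on S vt" for S
      using dv by (meson DERIV_isCont continuous_at_imp_continuous_on)
    have A2: "A (t1 + 2 * pi) = A t1 + 2 * pi" by (simp add: A_def Z_per)
    have v1: "vt t1 = 0" "vt (t1 + 2 * pi) = 0" by (simp_all add: vt_def v_def Z_per Z1)
    show "v w > 0"
    \<comment> \<open>The function \<open>vt\<close> is 0 at both ends of the turn and its slope has
      the sign of \<open>sin (A t - A t1)\<close>. If the argument has advanced by at most pi,
      \<open>vt\<close> has only risen since the start; otherwise it only falls from
      \<open>t0\<close> to the end.\<close>
    proof (cases "A t0 - A t1 \<le> pi")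
      case True
      have "vt t1 < vt t0"
      proof (rule DERIV_pos_imp_increasing_open[OF t0(1) _ cont])
        fix x assume x: "t1 < x" "x < t0"
        have "sin (A x - A t1) > 0"
          using A_mono[OF x(1)] A_mono[OF x(2)] True by (intro sin_gt_zero) auto
        with dv[of x] c KZ_pos[of x]
        show "\<exists>y. (vt has_real_derivative y) (at x) \<and> 0 < y" by (blast intro: mult_pos_pos)
      qed
      then show ?thesis using v1 by (simp add: vt_def Z0)
    next
      case False
      have "vt t0 > vt (t1 + 2 * pi)"
      proof (rule DERIV_neg_imp_decreasing_open[OF t0(2) _ cont])
        fix x assume x: "t0 < x" "x < t1 + 2 * pi"
        have "sin (A x - A t1 - pi) > 0"
          using A_mono[OF x(1)] A_mono[OF x(2)] False A2 by (intro sin_gt_zero) auto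
        then have "sin (A x - A t1) < 0" by (simp add: sin_diff)
        with dv[of x] c KZ_pos[of x]
        show "\<exists>y. (vt has_real_derivative y) (at x) \<and> y < 0" by (blast intro: mult_pos_pos mult_pos_neg)
      qed
      then show ?thesis using v1 by (simp add: vt_def Z0)
    qed
  qed
  show ?thesis
  proof (cases "norm z2 = r")
    case True
    then show ?thesis using sphere[of z2] ne by (simp add: v_def)
  next
    case False
    then have z2: "z2 \<in> ball 0 r" using le by (simp add: r_def)
    \<comment> \<open>For a point inside the circle the weak sign follows from the circle by the
      maximum principle, and the open mapping theorem makes it strict.\<close>
    define F where "F = (\<lambda>w. (k w - k z1) * cnj (K z1))"
    have F: "F holomorphic_on ball 0 1" unfolding F_def by (intro holomorphic_intros k)
    have Fle: "Re (F w) \<le> 0" if "w \<in> ball 0 r" for w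
    proof (rule maximum_real_frontier[of F "ball 0 r"])
      show "F holomorphic_on interior (ball 0 r)"
        using r by (auto intro!: holomorphic_on_subset[OF F])
      show "continuous_on (closure (ball 0 r)) F"
        using r by (auto intro!: holomorphic_on_imp_continuous_on holomorphic_on_subset[OF F])
      show "Re (F z) \<le> 0" if "z \<in> frontier (ball 0 r)" for z
      proof (cases "z = z1")
        case False
        then show ?thesis using sphere[of z] that r by (simp add: v_def F_def algebra_simps)
      qed (simp add: F_def)
    qed (use that in auto)
    have nc: "\<not> F constant_on ball 0 r"
    proof
      assume "F constant_on ball 0 r"
      then obtain c where c: "\<And>w. w \<in> ball 0 r \<Longrightarrow> F w = c" by (auto simp: constant_on_def)
      have "(F has_field_derivative 0) (at 0)"
        by (rule has_field_derivative_transform_within_open[of "\<lambda>_. c" _ _ "ball 0 r"])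
           (use c r in auto)
      moreover have "(F has_field_derivative deriv k 0 * cnj (K z1)) (at 0)"
        unfolding F_def using dk[of 0] by (auto intro!: derivative_eq_intros)
      ultimately show False using K1 k'nz[of 0] DERIV_unique by fastforce
    qed
    have "Re (F z2) \<noteq> 0"
    proof
      assume F2: "Re (F z2) = 0"
      have "open (F ` ball 0 r)"
        using r by (intro open_mapping_thm[OF holomorphic_on_subset[OF F] open_ball connected_ball open_ball _ nc]) auto
      then obtain e where e: "e > 0" "ball (F z2) e \<subseteq> F ` ball 0 r"
        using z2 by (meson imageI open_contains_ball)
      have "F z2 + of_real (e/2) \<in> ball (F z2) e" using e(1) by (simp add: dist_norm)
      with e(2) obtain w where "w \<in> ball 0 r" "F w = F z2 + of_real (e/2)"
        by (metis (no_types, lifting) image_iff subsetD)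
      then show False using Fle[of w] F2 e(1) by simp
    qed
    with Fle[OF z2] show ?thesis by (simp add: F_def algebra_simps)
  qed
qed

lemma inj_on_if_supporting_half_plane:
  fixes k K :: "complex \<Rightarrow> complex"
  assumes "\<And>z1 z2. z1 \<in> ball 0 1 \<Longrightarrow> norm z2 \<le> norm z1 \<Longrightarrow> z2 \<noteq> z1 \<Longrightarrow>
             Re ((k z1 - k z2) * cnj (K z1)) > 0"
  shows "inj_on k (ball 0 1)"
proof (rule inj_onI)
  fix a b :: complex assume ab: "a \<in> ball 0 1" "b \<in> ball 0 1" "k a = k b"
  show "a = b"
  proof (rule ccontr)
    assume "a \<noteq> b"
    then show False using assms[of a b] assms[of b a] ab by (cases "norm a \<le> norm b") auto
  qed
qed

text \<open>Every frontier point of the image is \<open>k z\<close> with \<open>norm z = r\<close>,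
  and \<open>supp\<close> puts the whole image strictly on one side of a line through it. A segment
  leaving the image would contain such a point, but that point cannot be a convex combination of two
  points strictly on one side.\<close>

lemma convex_image_if_supporting_half_plane:
  fixes k K :: "complex \<Rightarrow> complex"
  assumes k: "k holomorphic_on ball 0 1" and r: "0 < r" "r < 1"
    and supp: "\<And>z1 z2. z1 \<in> ball 0 1 \<Longrightarrow> norm z2 \<le> norm z1 \<Longrightarrow> z2 \<noteq> z1 \<Longrightarrow>
             Re ((k z1 - k z2) * cnj (K z1)) > 0"
  shows "convex (k ` ball 0 r)"
proof (rule convexI, rule ccontr)
  fix x y and u v :: real
  assume xy: "x \<in> k ` ball 0 r" "y \<in> k ` ball 0 r" and uv: "0 \<le> u" "0 \<le> v" "u + v = 1"
    and out: "u *\<^sub>R x + v *\<^sub>R y \<notin> k ` ball 0 r"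
  have inj: "inj_on k (ball 0 1)" by (rule inj_on_if_supporting_half_plane[of k K, OF supp])
  have "u *\<^sub>R x + v *\<^sub>R y \<in> closed_segment x y"
    using uv by (auto simp: closed_segment_def intro!: exI[of _ v])
  then have "closed_segment x y \<inter> frontier (k ` ball 0 r) \<noteq> {}"
    using xy out by (intro connected_Int_frontier) auto
  then obtain w where w: "w \<in> closed_segment x y" "w \<in> frontier (k ` ball 0 r)" by auto
  have "open (k ` ball 0 r)"
    using r by (intro open_mapping_thm3 holomorphic_on_subset[OF k] inj_on_subset[OF inj]) auto
  moreover have "closure (k ` ball 0 r) \<subseteq> k ` cball 0 r"
    using r by (intro closure_minimal compact_imp_closed compact_continuous_image
        holomorphic_on_imp_continuous_on holomorphic_on_subset[OF k]) auto
  ultimately have "w \<in> k ` cball 0 r" "w \<notin> k ` ball 0 r"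
    using w(2) unfolding frontier_def by (auto simp: interior_open)
  then obtain z where z: "norm z = r" "w = k z" by force
  obtain a b where ab: "a \<in> ball 0 r" "b \<in> ball 0 r" "x = k a" "y = k b" using xy by auto
  have "Re ((w - x) * cnj (K z)) > 0" "Re ((w - y) * cnj (K z)) > 0"
    using supp[of z a] supp[of z b] z ab r by auto
  moreover obtain t where t: "0 \<le> t" "t \<le> 1" "w = (1 - t) *\<^sub>R x + t *\<^sub>R y"
    using w(1) by (auto simp: closed_segment_def)
  ultimately have "(1 - t) * Re ((w - x) * cnj (K z)) + t * Re ((w - y) * cnj (K z)) > 0"
    by (smt (verit) mult_nonneg_nonneg mult_pos_pos)
  also have "(1 - t) * Re ((w - x) * cnj (K z)) + t * Re ((w - y) * cnj (K z))
    = Re ((w - ((1 - t) *\<^sub>R x + t *\<^sub>R y)) * cnj (K z))"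
    by (simp add: algebra_simps)
  also have "\<dots> = 0" using t(3) by simp
  finally show False by simp
qed

text \<open>The criterion of Noshiro and Warschawski in the coordinate \<open>k z\<close>. Along the
  segment joining two points of the convex image, \<open>h\<close> composed with the inverse of
  \<open>k\<close>, multiplied by \<open>c\<close> and divided by the direction \<open>d\<close>,
  has strictly increasing real part. A general \<open>S\<close> allows use on smaller discs as
  well.\<close>

lemma inj_on_if_Re_deriv_ratio_pos:
  fixes h k :: "complex \<Rightarrow> complex"
  assumes S: "open S" and k: "k holomorphic_on S" "inj_on k S" "convex (k ` S)"
    and h: "h holomorphic_on S"
    and pos: "\<And>z. z \<in> S \<Longrightarrow> Re (c * (deriv h z / deriv k z)) > 0"
  shows "inj_on h S"
proof (rule inj_onI, rule ccontr)
  fix a b assume ab: "a \<in> S" "b \<in> S" "h a = h b" "a \<noteq> b"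
  obtain H where H: "H holomorphic_on (k ` S)"
    "\<And>w. w \<in> S \<Longrightarrow> deriv k w * deriv H (k w) = 1" "\<And>w. w \<in> S \<Longrightarrow> H (k w) = w"
    using holomorphic_has_inverse[OF k(1) S k(2)] by metis
  have op: "open (k ` S)" by (rule open_mapping_thm3[OF k(1) S k(2)])
  define d where "d = k b - k a"
  have d: "d \<noteq> 0" using ab k(2) by (auto simp: d_def dest: inj_onD)
  define l where "l = (\<lambda>s::real. k a + of_real s * d)"
  have l_in: "l s \<in> k ` S" if "0 \<le> s" "s \<le> 1" for s
    using convexD_alt[OF k(3), of "k a" "k b" s] ab that
    by (simp add: l_def d_def scaleR_conv_of_real algebra_simps)
  define q where "q = (\<lambda>s. Re (c / d * h (H (l s))))"
  have dq: "\<exists>y. (q has_real_derivative y) (at s) \<and> 0 < y" if s: "0 \<le> s" "s \<le> 1" for s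
  proof -
    obtain w where w: "w \<in> S" "l s = k w" using l_in[OF s] by auto
    have Hl: "H (l s) = w" using H(3) w by simp
    have "(l has_vector_derivative d) (at s)"
      unfolding l_def by (auto intro!: derivative_eq_intros simp: has_vector_derivative_def scaleR_conv_of_real)
    from field_vector_diff_chain_at[OF this, of H "deriv H (k w)"]
    have "((\<lambda>s. H (l s)) has_vector_derivative d * deriv H (k w)) (at s)"
      using holomorphic_derivI[OF H(1) op, of "k w"] w by (simp add: o_def)
    from field_vector_diff_chain_at[OF this, of h "deriv h w"]
    have "((\<lambda>s. h (H (l s))) has_vector_derivative d * deriv H (k w) * deriv h w) (at s)"
      using holomorphic_derivI[OF h S, of w] w H(3)[OF w(1)] by (simp add: o_def Hl)
    from has_vector_derivative_mult_right[OF this, of "c / d"]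
    have "(q has_real_derivative Re (c / d * (d * deriv H (k w) * deriv h w))) (at s)"
      unfolding q_def has_vector_derivative_complex_iff by blast
    moreover have "c / d * (d * deriv H (k w) * deriv h w) = c * (deriv h w / deriv k w)"
    proof -
      have "deriv k w \<noteq> 0" using H(2)[OF w(1)] by auto
      moreover from this have "deriv H (k w) = 1 / deriv k w"
        using H(2)[OF w(1)] by (simp add: nonzero_eq_divide_eq mult.commute)
      ultimately show ?thesis using d by simp
    qed
    ultimately show ?thesis using pos[OF w(1)] by metis
  qed
  have "q 0 < q 1" using DERIV_pos_imp_increasing[of 0 1 q] dq by auto
  moreover have "q 0 = q 1" using H(3) ab by (simp add: q_def l_def d_def)
  ultimately show False by simp
qed

text \<open>The expression in \<open>pos\<close> is a Caratheodory function, so its real part is at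
  least (1 - r) / (1 + r). Hence the radial derivative of the logarithm of |g'| is at least -2 / (1
  + t), and integration gives the first bound; multiplying the two bounds gives the second.\<close>

lemma convex_function_deriv_lower_bound:
  fixes g :: "complex \<Rightarrow> complex"
  assumes g: "g holomorphic_on ball 0 1" and g0: "deriv g 0 = 1"
    and g'nz: "\<And>z. z \<in> ball 0 1 \<Longrightarrow> deriv g z \<noteq> 0"
    and pos: "\<And>z. z \<in> ball 0 1 \<Longrightarrow> Re (1 + z * deriv (deriv g) z / deriv g z) > 0"
    and z: "z \<in> ball 0 1"
  shows "1 / (1 + norm z)\<^sup>2 \<le> norm (deriv g z)"
    and "(1 - norm z) / (1 + norm z) ^ 3 \<le> norm (deriv g z + z * deriv (deriv g) z)"
proof -
  define P where "P = (\<lambda>z. 1 + z * deriv (deriv g) z / deriv g z)"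
  have g': "deriv g holomorphic_on ball 0 1" by (intro holomorphic_deriv g) auto
  have g'': "deriv (deriv g) holomorphic_on ball 0 1" by (intro holomorphic_deriv g') auto
  have P: "P holomorphic_on ball 0 1"
    unfolding P_def using g'nz by (intro holomorphic_intros g' g'') auto
  have P_ge: "(1 - norm w) / (1 + norm w) \<le> Re (P w)" if w: "w \<in> ball 0 1" for w
  proof -
    have "1 + (2 * (norm w)\<^sup>2 - 2 * norm w) / (1 - (norm w)\<^sup>2) \<le> Re (P w)"
      using Caratheodory_Re_bound[OF P _ _ _ w, of 1 1] pos by (simp add: P_def)
    moreover have "1 + (2 * (norm w)\<^sup>2 - 2 * norm w) / (1 - (norm w)\<^sup>2) = (1 - norm w) / (1 + norm w)"
    proof -
      have "1 - (norm w)\<^sup>2 \<noteq> 0" "1 + norm w \<noteq> 0"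
        using w norm_ge_zero[of w] by (auto simp: power2_eq_1_iff add_eq_0_iff simp del: norm_ge_zero)
      then show ?thesis
        by (simp add: divide_simps) (simp add: algebra_simps power2_eq_square)
    qed
    ultimately show ?thesis by simp
  qed
  have 1: "1 / (1 + norm z)\<^sup>2 \<le> norm (deriv g z)"
  proof (cases "z = 0")
    case False
    define e where "e = z / of_real (norm z)"
    have e: "norm e = 1" "of_real (norm z) * e = z"
      using False by (auto simp: e_def norm_divide)
    define v where "v = (\<lambda>t. ln (norm (deriv g (of_real t * e))) + 2 * ln (1 + t))"
    have in_ball: "of_real t * e \<in> ball 0 1" if "0 \<le> t" "t \<le> norm z" for t
      using that z e by (simp add: norm_mult)
    have dv: "(v has_real_derivative Re (e * deriv (deriv g) (of_real t * e) / deriv g (of_real t * e)) + 2 / (1 + t)) (at t)"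
      if t: "0 \<le> t" "t \<le> norm z" for t
    proof -
      define w where "w = of_real t * e"
      have w: "w \<in> ball 0 1" using in_ball[OF t] by (simp add: w_def)
      have "((\<lambda>t::real. of_real t * e) has_vector_derivative e) (at t)"
        by (auto intro!: derivative_eq_intros simp: has_vector_derivative_def scaleR_conv_of_real)
      from field_vector_diff_chain_at[OF this, of "deriv g" "deriv (deriv g) w"]
      have "((\<lambda>t::real. deriv g (of_real t * e)) has_vector_derivative e * deriv (deriv g) w) (at t)"
        using holomorphic_derivI[OF g' open_ball w] by (simp add: o_def w_def)
      from has_real_derivative_norm_curve[OF this]
      have n: "((\<lambda>t. norm (deriv g (of_real t * e))) has_real_derivative
          Re (cnj (deriv g w) * (e * deriv (deriv g) w)) / norm (deriv g w)) (at t)"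
        using g'nz[OF w] by (simp add: w_def)
      have "norm (deriv g (of_real t * e)) > 0" using g'nz[OF w] by (simp add: w_def)
      from DERIV_chain2[OF DERIV_ln_divide[OF this] n]
      have a: "((\<lambda>t. ln (norm (deriv g (of_real t * e)))) has_real_derivative
          1 / norm (deriv g w) * (Re (cnj (deriv g w) * (e * deriv (deriv g) w)) / norm (deriv g w))) (at t)"
        by (simp only: w_def)
      have b: "((\<lambda>t. ln (1 + t)) has_real_derivative 1 / (1 + t)) (at t)"
        using t by (auto intro!: derivative_eq_intros)
      have "(v has_real_derivative 1 / norm (deriv g w) * (Re (cnj (deriv g w) * (e * deriv (deriv g) w)) / norm (deriv g w))
          + 2 * (1 / (1 + t))) (at t)"
        unfolding v_def by (rule DERIV_add[OF a DERIV_cmult[OF b]])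
      moreover have "1 / norm (deriv g w) * (Re (cnj (deriv g w) * (e * deriv (deriv g) w)) / norm (deriv g w))
         = Re (e * deriv (deriv g) w / deriv g w)"
        unfolding complex_div_cnj[of _ "deriv g w"]
        by (simp add: Re_divide_of_real power2_eq_square mult_ac flip: of_real_power of_real_mult)
      ultimately show ?thesis by (simp add: w_def)
    qed
    have "v 0 \<le> v (norm z)"
    proof (rule DERIV_nonneg_imp_increasing_open[of 0 "norm z" v])
      fix t assume t: "0 < t" "t < norm z"
      define w where "w = of_real t * e"
      have w: "w \<in> ball 0 1" "norm w = t" using in_ball[of t] t e by (auto simp: w_def norm_mult)
      have "(1 - t) / (1 + t) \<le> Re (P w)" using P_ge[OF w(1)] w(2) by simp
      also have "Re (P w) = 1 + t * Re (e * deriv (deriv g) w / deriv g w)"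
      proof -
        have "P w = 1 + of_real t * (e * deriv (deriv g) w / deriv g w)"
          by (simp add: P_def w_def)
        then show ?thesis by (simp only: plus_complex.sel times_complex.sel one_complex.sel
              Re_complex_of_real Im_complex_of_real mult_zero_left diff_zero)
      qed
      finally have "0 \<le> t * (Re (e * deriv (deriv g) w / deriv g w) + 2 / (1 + t))"
        using t by (simp add: field_simps)
      then have "0 \<le> Re (e * deriv (deriv g) w / deriv g w) + 2 / (1 + t)"
        using t by (simp add: zero_le_mult_iff)
      then show "\<exists>y. (v has_real_derivative y) (at t) \<and> 0 \<le> y" using dv[of t] t by (auto simp: w_def)
    next
      show "continuous_on {0..norm z} v"
        using dv by (meson DERIV_isCont atLeastAtMost_iff continuous_at_imp_continuous_on)
    qed auto
    moreover have "1 + norm z \<noteq> 0" using norm_ge_zero[of z] by linarith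
    ultimately have "ln (1 / (1 + norm z)\<^sup>2) \<le> ln (norm (deriv g z))"
      by (simp add: v_def g0 e ln_div ln_realpow add_pos_nonneg)
    moreover have "1 / (1 + norm z)\<^sup>2 > 0"
      using norm_ge_zero[of z] by (intro divide_pos_pos zero_less_power) linarith+
    ultimately show ?thesis using g'nz[OF z] ln_le_cancel_iff zero_less_norm_iff by blast
  qed (simp add: g0)
  then show "1 / (1 + norm z)\<^sup>2 \<le> norm (deriv g z)" .
  have "(1 - norm z) / (1 + norm z) \<le> norm (P z)"
    using P_ge[OF z] complex_Re_le_cmod order_trans by blast
  from mult_mono[OF this 1] z
  have "(1 - norm z) / (1 + norm z) * (1 / (1 + norm z)\<^sup>2) \<le> norm (P z) * norm (deriv g z)" by simp
  also have "norm (P z) * norm (deriv g z) = norm (deriv g z + z * deriv (deriv g) z)"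
  proof -
    have "P z * deriv g z = deriv g z + z * deriv (deriv g) z"
      using g'nz[OF z] by (simp add: P_def distrib_right)
    then show ?thesis by (metis norm_mult)
  qed
  finally show "(1 - norm z) / (1 + norm z) ^ 3 \<le> norm (deriv g z + z * deriv (deriv g) z)"
    by (simp add: power2_eq_square power3_eq_cube mult.assoc)
qed

section \<open>Dilogarithm and real inequalities\<close>

lemma continuous_on_suminf_M_test:
  fixes f :: "nat \<Rightarrow> 'a::topological_space \<Rightarrow> 'b::banach"
  assumes "\<And>n. continuous_on A (f n)" "\<And>n x. x \<in> A \<Longrightarrow> norm (f n x) \<le> M n" "summable M"
  shows "continuous_on A (\<lambda>x. \<Sum>n. f n x)"
proof (rule uniform_limit_theorem[OF _ Weierstrass_m_test[OF assms(2,3)]])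
  show "\<forall>\<^sub>F n in sequentially. continuous_on A (\<lambda>x. \<Sum>i<n. f i x)"
    by (intro always_eventually allI continuous_intros assms(1))
qed auto

text \<open>The dilogarithm. The term at index 0 vanishes because division by zero is 0, so the
  series starts in effect at 1. The type is polymorphic since growth needs real arguments and the
  extremal function complex ones.\<close>

definition dilog :: "'a::{real_normed_field,banach} \<Rightarrow> 'a" where
  "dilog z = (\<Sum>n. 1 / of_nat n ^ 2 * z ^ n)"

text \<open>The termwise derivative, which is - log (1 - z) / z; as a power series it also has the
  right value 1 at 0.\<close>

definition dilog' :: "'a::{real_normed_field,banach} \<Rightarrow> 'a" where
  "dilog' z = (\<Sum>n. diffs (\<lambda>n. 1 / of_nat n ^ 2) n * z ^ n)"

lemma norm_dilog_coeff_le: "norm (1 / of_nat n ^ 2 :: 'a::real_normed_field) \<le> 1"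
  by (cases n) (auto simp: norm_divide norm_power divide_simps power_le_one_iff one_le_power simp del: of_nat_Suc)

lemma summable_dilog:
  fixes z :: "'a::{real_normed_field,banach}"
  assumes "norm z < 1"
  shows "summable (\<lambda>n. 1 / of_nat n ^ 2 * z ^ n)"
proof (rule summable_comparison_test')
  show "summable (\<lambda>n. norm z ^ n)" using assms by (intro summable_geometric) auto
  show "norm (1 / of_nat n ^ 2 * z ^ n) \<le> norm z ^ n" if "n \<ge> 0" for n
    unfolding norm_mult norm_power[of z]
    using mult_right_mono[OF norm_dilog_coeff_le[where ?'a = 'a, of n], of "norm z ^ n"] by simp
qed

lemma has_field_derivative_dilog:
  fixes z :: "'a::{real_normed_field,banach}"
  assumes "norm z < 1"
  shows "(dilog has_field_derivative dilog' z) (at z)"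
  unfolding dilog_def[abs_def] dilog'_def
  by (rule termdiffs_strong'[OF summable_dilog assms])

lemma dilog_0: "dilog 0 = 0"
  unfolding dilog_def powser_zero by simp

lemma times_dilog':
  fixes z :: "'a::{real_normed_field,banach}"
  assumes z: "norm z < 1" and s: "(\<lambda>n. z ^ n / of_nat n) sums l"
  shows "z * dilog' z = l"
proof -
  have 1: "summable (\<lambda>n. diffs (\<lambda>n. 1 / of_nat n ^ 2 :: 'a) n * z ^ n)"
    by (rule termdiff_converges[OF z summable_dilog])
  have "(\<lambda>n. z ^ Suc n / of_nat (Suc n)) sums l"
    using s by (subst sums_Suc_iff) simp
  moreover have "z * (diffs (\<lambda>n. 1 / of_nat n ^ 2) n * z ^ n) = z ^ Suc n / of_nat (Suc n)" for n
    by (simp add: diffs_def power2_eq_square field_simps del: of_nat_Suc)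
  ultimately have "(\<lambda>n. z * (diffs (\<lambda>n. 1 / of_nat n ^ 2) n * z ^ n)) sums l" by simp
  then show ?thesis
    unfolding dilog'_def using suminf_mult[OF 1, of z] by (simp add: sums_iff)
qed

lemma times_dilog'_complex: "norm z < 1 \<Longrightarrow> z * dilog' z = - Ln (1 - z)" for z :: complex
  using Ln_series'[of "- z"] sums_minus[of "\<lambda>n. - (z ^ n / of_nat n)" "Ln (1 - z)"]
  by (intro times_dilog') auto

lemma times_dilog'_real: "\<bar>x\<bar> < 1 \<Longrightarrow> x * dilog' x = - ln (1 - x)" for x :: real
  using ln_series'[of "- x"] sums_minus[of "\<lambda>n. - (x ^ n / of_nat n)" "ln (1 - x)"]
  by (intro times_dilog') auto

lemma dilog'_0: "dilog' 0 = 1"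
proof -
  have "dilog' (0::'a) = (\<Sum>n. diffs (\<lambda>n. 1 / of_nat n ^ 2) n * 0 ^ n)" by (simp add: dilog'_def)
  also have "\<dots> = diffs (\<lambda>n. 1 / of_nat n ^ 2) 0" by (rule powser_zero)
  also have "\<dots> = 1" by (simp add: diffs_def)
  finally show ?thesis .
qed

lemma continuous_on_dilog: "continuous_on {-1..1::real} dilog"
  unfolding dilog_def[abs_def]
proof (rule continuous_on_suminf_M_test)
  show "summable (\<lambda>n. 1 / real n ^ 2)" 
    using inverse_power_summable[of 2, where ?'a = real] by (simp add: inverse_eq_divide)
  show "norm (1 / real n ^ 2 * x ^ n) \<le> 1 / real n ^ 2" if "x \<in> {-1..1}" for n and x :: real
  proof -
    have "\<bar>x\<bar> ^ n \<le> 1" using that by (intro power_le_one) auto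
    then show ?thesis by (simp add: abs_mult power_abs divide_right_mono)
  qed
qed (intro continuous_intros)

text \<open>The even-indexed terms make up a quarter of pi^2 / 6, and the alternating series is
  twice these minus the whole.\<close>

lemma dilog_minus_1: "dilog (-1::real) = - (pi\<^sup>2 / 12)"
proof -
  have a: "(\<lambda>n. 1 / real n ^ 2) sums (pi\<^sup>2 / 6)"
    using inverse_squares_sums by (subst sums_Suc_iff[symmetric, where f = "\<lambda>n. 1 / real n ^ 2" and s = "pi\<^sup>2 / 6", simplified]) simp
  have "(\<lambda>n. 1 / real n ^ 2 / 2) sums (pi\<^sup>2 / 6 / 2)" by (rule sums_divide[OF a])
  moreover have "1 / real n ^ 2 / 2 = 2 * (1 / real (2 * n) ^ 2)" for n by simp
  ultimately have "(\<lambda>n. 2 * (1 / real (2 * n) ^ 2)) sums (pi\<^sup>2 / 12)"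
    by (simp add: mult.commute)
  then have "(\<lambda>n. if even n then 2 * (1 / real n ^ 2) else 0) sums (pi\<^sup>2 / 12)"
  proof (subst sums_mono_reindex[of "\<lambda>n. 2 * n", symmetric])
    show "(if even n then 2 * (1 / real n ^ 2) else 0) = 0" if "n \<notin> range (\<lambda>n. 2 * n)" for n
      using that by (auto elim!: evenE)
  qed (auto simp: strict_mono_def)
  from sums_diff[OF this a] have "(\<lambda>n. (if even n then 2 * (1 / real n ^ 2) else 0) - 1 / real n ^ 2) sums (- (pi\<^sup>2 / 12))"
    by simp
  moreover have "(if even n then 2 * (1 / real n ^ 2) else 0) - 1 / real n ^ 2 = 1 / real n ^ 2 * (-1) ^ n" for n
    by auto
  ultimately have "(\<lambda>n. 1 / real n ^ 2 * (-1) ^ n) sums (- (pi\<^sup>2 / 12))" by simp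
  then show ?thesis by (simp add: dilog_def sums_iff)
qed

text \<open>The derivative is the product of (1 - r) / (1 + r), the bound for a Caratheodory
  function, and (1 - r) / (1 + r)^3, the bound for |G'|.\<close>

lemma DERIV_sharp_growth:
  assumes "0 \<le> r"
  shows "((\<lambda>r::real. r * (3 + r\<^sup>2) / (3 * (1 + r) ^ 3)) has_real_derivative (1 - r)\<^sup>2 / (1 + r) ^ 4) (at r)"
proof -
  have "1 + r \<noteq> 0" using assms by simp
  have "((3 + r\<^sup>2 + r * (2 * r)) * (3 * (1 + r) ^ 3) - r * (3 + r\<^sup>2) * (9 * (1 + r)\<^sup>2)) / (3 * (1 + r) ^ 3)\<^sup>2
     = (1 - r)\<^sup>2 / (1 + r) ^ 4"
    using \<open>1 + r \<noteq> 0\<close> by (simp add: divide_simps) algebra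
  moreover have "((\<lambda>r::real. r * (3 + r\<^sup>2) / (3 * (1 + r) ^ 3)) has_real_derivative
     ((3 + r\<^sup>2 + r * (2 * r)) * (3 * (1 + r) ^ 3) - r * (3 + r\<^sup>2) * (9 * (1 + r)\<^sup>2)) / (3 * (1 + r) ^ 3)\<^sup>2) (at r)"
    using \<open>1 + r \<noteq> 0\<close> by (auto intro!: derivative_eq_intros simp: power2_eq_square)
  ultimately show ?thesis by simp
qed

text \<open>The primitive of the lower bound for \<open>Re p\<close> (not \<open>Re (cnj e * p)\<close>) times the one for \<open>|G'|\<close>.\<close>

definition tilted_growth :: "real \<Rightarrow> real \<Rightarrow> real" where
  "tilted_growth a r = (a\<^sup>2 * (r * (3 + 3 * r + 2 * r\<^sup>2)) + 3 * (1 - a\<^sup>2) * (r * (1 + r)) - a * (r\<^sup>2 * (3 + r)))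
      / (3 * (1 + r) ^ 3)"

lemma DERIV_tilted_growth:
  assumes "0 \<le> r"
  shows "(tilted_growth a has_real_derivative (1 - r\<^sup>2 + 2 * a\<^sup>2 * r\<^sup>2 - 2 * a * r) / (1 + r) ^ 4) (at r)"
proof -
  have "1 + r \<noteq> 0" using assms by simp
  define n where "n = a\<^sup>2 * (r * (3 + 3 * r + 2 * r\<^sup>2)) + 3 * (1 - a\<^sup>2) * (r * (1 + r)) - a * (r\<^sup>2 * (3 + r))"
  define n' where "n' = a\<^sup>2 * (3 + 6 * r + 6 * r\<^sup>2) + 3 * (1 - a\<^sup>2) * (1 + 2 * r) - a * (6 * r + 3 * r\<^sup>2)"
  have "(n' * (3 * (1 + r) ^ 3) - n * (9 * (1 + r)\<^sup>2)) / (3 * (1 + r) ^ 3)\<^sup>2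
     = (1 - r\<^sup>2 + 2 * a\<^sup>2 * r\<^sup>2 - 2 * a * r) / (1 + r) ^ 4"
    using \<open>1 + r \<noteq> 0\<close> unfolding n_def n'_def by (simp add: divide_simps) algebra
  moreover have "(tilted_growth a has_real_derivative
     (n' * (3 * (1 + r) ^ 3) - n * (9 * (1 + r)\<^sup>2)) / (3 * (1 + r) ^ 3)\<^sup>2) (at r)"
    unfolding tilted_growth_def using \<open>1 + r \<noteq> 0\<close>
    by (auto intro!: derivative_eq_intros simp: n_def n'_def power2_eq_square algebra_simps)
  ultimately show ?thesis by simp
qed

text \<open>The difference of the two growth functions has the factor 1 - a. In the cofactor 1 + a
  may be replaced by 2, and what is left is the inequality \<open>poly\<close> in \<open>r\<close>
  alone.\<close>

lemma tilted_growth_ge: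
  fixes a r :: real
  assumes r: "0 \<le> r" and a: "0 < a" "a \<le> 1"
  shows "r * (3 + r\<^sup>2) / (3 * (1 + r) ^ 3) + (1 - a) * (r\<^sup>2 / 3 - 2 * r ^ 5) \<le> tilted_growth a r"
proof -
  have p: "(1 + r) ^ 3 > 0" using r by simp
  have poly: "(1 / 3 - 2 * r ^ 3) * (1 + r) ^ 3 \<le> 1 - r"
  proof -
    \<comment> \<open>lower bounds touching the powers at \<open>r = 3/8\<close>, close to the minimum of the difference\<close>
    have "r ^ 3 - (27/64 * r - 27/256) = (r - 3/8)\<^sup>2 * (r + 3/4)"
      by (simp add: eval_nat_numeral field_simps)
    also have "\<dots> \<ge> 0" using r by simp
    finally have 3: "27/64 * r - 27/256 \<le> r ^ 3" by simp
    have "r ^ 4 - (9/32 * r\<^sup>2 - 81/4096) = (r\<^sup>2 - 9/64)\<^sup>2"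
      by (simp add: eval_nat_numeral field_simps)
    also have "\<dots> \<ge> 0" by simp
    finally have 4: "9/32 * r\<^sup>2 - 81/4096 \<le> r ^ 4" by simp
    have "r ^ 5 - (405/4096 * r - 243/8192) = (r - 3/8)\<^sup>2 * (r ^ 3 + 3/4 * r\<^sup>2 + 27/64 * r + 27/128)"
      by (simp add: eval_nat_numeral field_simps)
    also have "\<dots> \<ge> 0" using r by simp
    finally have 5: "405/4096 * r - 243/8192 \<le> r ^ 5" by simp
    have 6: "0 \<le> r ^ 6" using r by simp
    \<comment> \<open>After the bounds \<open>3\<close>, \<open>4\<close>, \<open>5\<close> are
      inserted a quadratic in \<open>r\<close> remains, and 64/125 is close to its minimum
      point.\<close>
    have "(r - 64/125)\<^sup>2 = r\<^sup>2 - 128/125 * r + 4096/15625"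
      by (simp add: power2_eq_square field_simps)
    then have 2: "0 \<le> r\<^sup>2 - 128/125 * r + 4096/15625" by (metis zero_le_power2)
    have "(1 / 3 - 2 * r ^ 3) * (1 + r) ^ 3
        = 1 / 3 + r + r\<^sup>2 - 5 / 3 * r ^ 3 - 6 * r ^ 4 - 6 * r ^ 5 - 2 * r ^ 6"
      by (simp add: eval_nat_numeral algebra_simps)
    then show ?thesis using 2 3 4 5 6 r by linarith
  qed
  have "tilted_growth a r - r * (3 + r\<^sup>2) / (3 * (1 + r) ^ 3)
    = (1 - a) * (r\<^sup>2 * (3 + r) - 2 * (1 + a) * r ^ 3) / (3 * (1 + r) ^ 3)"
    unfolding tilted_growth_def diff_divide_distrib[symmetric]
    by (rule arg_cong[where f = "\<lambda>x. x / _"]) algebra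
  also have "\<dots> \<ge> (1 - a) * (3 * r\<^sup>2 * (1 - r)) / (3 * (1 + r) ^ 3)"
  proof (intro divide_right_mono mult_left_mono)
    have "2 * (1 + a) * r ^ 3 \<le> 4 * r ^ 3" using a r by (intro mult_right_mono) auto
    then show "3 * r\<^sup>2 * (1 - r) \<le> r\<^sup>2 * (3 + r) - 2 * (1 + a) * r ^ 3"
      by (simp add: algebra_simps power2_eq_square power3_eq_cube)
  qed (use a r in auto)
  also have "(1 - a) * (3 * r\<^sup>2 * (1 - r)) / (3 * (1 + r) ^ 3) = (1 - a) * (r\<^sup>2 * ((1 - r) / (1 + r) ^ 3))"
    by simp
  also have "\<dots> \<ge> (1 - a) * (r\<^sup>2 * (1 / 3 - 2 * r ^ 3))"
    using poly p a r by (intro mult_left_mono) (auto simp: pos_le_divide_eq)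
  finally show ?thesis by (simp add: algebra_simps eval_nat_numeral)
qed

text \<open>Everything has the factor (1 - a) r. Dividing by it leaves t + r/3 - 2 r^4, with
  \<open>t\<close> as in the proof, and this is nonpositive once r^2 is at least 1/2: there the term
  in r^4 outweighs the others.\<close>

lemma scaled_growth_ge:
  fixes a r :: real
  assumes r: "0 \<le> r" "r < 1" "1/2 \<le> r\<^sup>2" and a: "0 < a" "a \<le> 1"
  shows "r * (3 + r\<^sup>2) / (3 * (1 + r) ^ 3) + (1 - a) * (r\<^sup>2 / 3 - 2 * r ^ 5)
    \<le> a * (r * (3 + r\<^sup>2) / (3 * (1 + r) ^ 3))"
proof -
  have r7: "r \<ge> 7/10"
  proof (rule ccontr)
    assume "\<not> ?thesis"
    then have "r\<^sup>2 \<le> (7/10)\<^sup>2" using r by (intro power_mono) auto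
    then show False using r(3) by (simp add: power2_eq_square)
  qed
  have "(17/10)^3 \<le> (1 + r) ^ 3" using r7 by (intro power_mono) auto
  then have "(3 + r\<^sup>2) / (3 * (1 + r) ^ 3) \<le> (3 + r\<^sup>2) / (3 * (17/10) ^ 3)"
    using r by (intro divide_left_mono mult_left_mono mult_pos_pos) auto
  also have "\<dots> = 1000/14739 * (3 + r\<^sup>2)" by (simp add: power3_eq_cube)
  finally have 1: "(3 + r\<^sup>2) / (3 * (1 + r) ^ 3) \<le> 1000/14739 * (3 + r\<^sup>2)" .
  \<comment> \<open>Both squares bound by functions linear in r^2, \<open>r\<close> from above and
    r^4 from below, touching at or near r^2 = 1/2. The claim thus becomes linear in r^2.\<close>
  have "(r - 7/10)\<^sup>2 = r\<^sup>2 - 7/5 * r + 49/100" "(r\<^sup>2 - 1/2)\<^sup>2 = r ^ 4 - r\<^sup>2 + 1/4"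
    by (simp_all add: eval_nat_numeral algebra_simps)
  then have "0 \<le> r\<^sup>2 - 7/5 * r + 49/100" "0 \<le> r ^ 4 - r\<^sup>2 + 1/4" by (metis zero_le_power2)+
  moreover define t where "t = (3 + r\<^sup>2) / (3 * (1 + r) ^ 3)"
  ultimately have "t + (r / 3 - 2 * r ^ 4) \<le> 0"
    using r(3) 1 unfolding t_def[symmetric] by argo
  then have "r * (t + (r / 3 - 2 * r ^ 4)) \<le> 0"
    using r by (simp add: mult_nonneg_nonpos)
  then have "(1 - a) * (r * (t + (r / 3 - 2 * r ^ 4))) \<le> 0"
    using a by (simp add: mult_nonneg_nonpos)
  moreover have "r * (3 + r\<^sup>2) / (3 * (1 + r) ^ 3) = r * t" by (simp add: t_def)
  ultimately show ?thesis by (simp add: algebra_simps eval_nat_numeral)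
qed

section \<open>The class \<open>C_3\<close>\<close>

lemma deriv_times_id:
  fixes q :: "complex \<Rightarrow> complex"
  assumes "q holomorphic_on ball 0 1" "z \<in> ball 0 1"
  shows "deriv (\<lambda>w. w * q w) z = q z + z * deriv q z"
  using holomorphic_derivI[OF assms(1) open_ball assms(2)]
  by (auto intro!: DERIV_imp_deriv derivative_eq_intros)

text \<open>In the convolution the term with \<open>fps_nth p 0 = 1\<close> is split off and every
  other coefficient of \<open>p\<close> costs a factor 2. This serves both the recursion for
  \<open>g\<close> and the estimate for \<open>f\<close>.\<close>

lemma norm_fps_mult_diff_le:
  fixes p d :: "complex fps"
  assumes "fps_nth p 0 = 1" and "\<And>i. i > 0 \<Longrightarrow> norm (fps_nth p i) \<le> 2"
  shows "norm (fps_nth (p * d) m - fps_nth d m) \<le> 2 * (\<Sum>j<m. norm (fps_nth d j))"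
proof -
  have "fps_nth (p * d) m = (\<Sum>j\<le>m. fps_nth d j * fps_nth p (m - j))"
    by (subst mult.commute) (simp add: fps_mult_nth atLeast0AtMost)
  also have "\<dots> = (\<Sum>j<m. fps_nth d j * fps_nth p (m - j)) + fps_nth d m"
    using assms(1) by (simp flip: lessThan_Suc_atMost)
  finally have "norm (fps_nth (p * d) m - fps_nth d m) = norm (\<Sum>j<m. fps_nth d j * fps_nth p (m - j))"
    by simp
  also have "\<dots> \<le> (\<Sum>j<m. norm (fps_nth d j) * 2)"
    by (intro sum_norm_le) (auto simp: norm_mult intro!: mult_left_mono assms)
  finally show ?thesis by (simp add: sum_distrib_left mult.commute)
qed

lemma has_fps_expansion_deriv_times_id:
  fixes q :: "complex \<Rightarrow> complex"
  assumes "q holomorphic_on ball 0 1"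
  shows "(\<lambda>z. deriv (\<lambda>w. w * q w) z) has_fps_expansion fps_deriv (fps_X * fps_expansion q 0)"
  using assms by (intro fps_expansion_intros has_fps_expansion_fps_expansion[of "ball 0 1"]) auto

lemma has_fps_expansion_cong_ball:
  fixes f g :: "complex \<Rightarrow> complex"
  assumes "f has_fps_expansion F" "\<And>z. z \<in> ball 0 1 \<Longrightarrow> f z = g z"
  shows "g has_fps_expansion F"
proof -
  have "eventually (\<lambda>z. f z = g z) (nhds 0)"
    using assms(2) by (intro eventually_nhds_in_open[THEN eventually_mono, of "ball 0 1"]) auto
  then show ?thesis using assms(1) has_fps_expansion_cong by blast
qed

lemma Caratheodory_coeff_bound:
  assumes p: "p holomorphic_on ball 0 1" and p0: "p 0 = 1"
    and pos: "\<And>z. z \<in> ball 0 1 \<Longrightarrow> Re (cnj e * p z) > 0" and e: "norm e = 1" and i: "i > 0"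
  shows "norm (fps_nth (fps_expansion p 0) i) \<le> 2"
proof -
  have "(\<lambda>z. cnj e * p z) has_fps_expansion fps_const (cnj e) * fps_expansion p 0"
    using p by (intro fps_expansion_intros has_fps_expansion_fps_expansion[of "ball 0 1"]) auto
  then have "fps_expansion (\<lambda>z. cnj e * p z) 0 = fps_const (cnj e) * fps_expansion p 0"
    by (rule fps_expansion_eqI)
  moreover have "norm (fps_nth (fps_expansion (\<lambda>z. cnj e * p z) 0) i) \<le> 2 * Re (cnj e * p 0)"
    using pos i by (intro Re_nonneg_coeff_bound holomorphic_intros p) (auto intro: less_imp_le)
  ultimately have "norm (fps_nth (fps_expansion p 0) i) \<le> 2 * Re e"
    using e p0 by (simp add: norm_mult)
  also have "\<dots> \<le> 2" using complex_Re_le_cmod[of e] e by simp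
  finally show ?thesis .
qed

text \<open>Comparing coefficients in (z g')' = P g', where \<open>P\<close> is a Caratheodory
  function, bounds m times the m-th coefficient of g' by twice the sum of the moduli of the earlier
  ones. By induction that coefficient has modulus at most m + 1, the factor produced by
  differentiation.\<close>

lemma convex_function_coeff_bound:
  fixes g :: "complex \<Rightarrow> complex"
  assumes g: "g holomorphic_on ball 0 1" and g0: "deriv g 0 = 1"
    and g'nz: "\<And>z. z \<in> ball 0 1 \<Longrightarrow> deriv g z \<noteq> 0"
    and pos: "\<And>z. z \<in> ball 0 1 \<Longrightarrow> Re (1 + z * deriv (deriv g) z / deriv g z) > 0"
  shows "norm (fps_nth (fps_expansion g 0) (Suc n)) \<le> 1"
proof -
  define P where "P = (\<lambda>z. 1 + z * deriv (deriv g) z / deriv g z)"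
  have g': "deriv g holomorphic_on ball 0 1" by (intro holomorphic_deriv g) auto
  have g'': "deriv (deriv g) holomorphic_on ball 0 1" by (intro holomorphic_deriv g') auto
  have P: "P holomorphic_on ball 0 1"
    unfolding P_def using g'nz by (intro holomorphic_intros g' g'') auto
  define C where "C = fps_expansion (deriv g) 0"
  define Q where "Q = fps_expansion P 0"
  have Q: "fps_nth Q 0 = 1" "\<And>i. i > 0 \<Longrightarrow> norm (fps_nth Q i) \<le> 2"
    using Caratheodory_coeff_bound[OF P, of 1] pos by (auto simp: Q_def P_def fps_expansion_def)
  have "(\<lambda>z. P z * deriv g z) has_fps_expansion Q * C"
    unfolding Q_def C_def using P g'
    by (intro fps_expansion_intros has_fps_expansion_fps_expansion[of "ball 0 1"]) auto
  then have "(\<lambda>z. deriv (\<lambda>w. w * deriv g w) z) has_fps_expansion Q * C"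
    by (rule has_fps_expansion_cong_ball)
       (use g'nz in \<open>auto simp: deriv_times_id[OF g'] P_def field_simps\<close>)
  then have eq: "fps_deriv (fps_X * C) = Q * C"
    using fps_expansion_unique_complex has_fps_expansion_deriv_times_id[OF g'] unfolding C_def by blast
  have rec: "m * norm (fps_nth C m) \<le> 2 * (\<Sum>j<m. norm (fps_nth C j))" for m
  proof -
    have "fps_nth (Q * C) m - fps_nth C m = of_nat m * fps_nth C m"
      unfolding eq[symmetric] by (simp add: algebra_simps)
    then show ?thesis using norm_fps_mult_diff_le[OF Q, of C m] by (simp add: norm_mult)
  qed
  have C_le: "norm (fps_nth C m) \<le> m + 1" for m
  proof (induction m rule: less_induct)
    case (less m)
    show ?case
    proof (cases "m = 0")
      case True
      then show ?thesis by (simp add: C_def fps_expansion_def g0)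
    next
      case False
      have "m * norm (fps_nth C m) \<le> 2 * (\<Sum>j<m. real j + 1)"
        using rec[of m] sum_mono[of "{..<m}" "\<lambda>j. norm (fps_nth C j)" "\<lambda>j. real j + 1"] less
        by fastforce
      also have "2 * (\<Sum>j<m. real j + 1) = real m * real (m + 1)"
        by (induction m) (auto simp: algebra_simps)
      finally show ?thesis
        using False mult_le_cancel_left_pos[of "real m" "norm (fps_nth C m)" "real (m + 1)"] by auto
    qed
  qed
  have "fps_nth C n = of_nat (Suc n) * fps_nth (fps_expansion g 0) (Suc n)"
    using of_nat_neq_0[of n, where ?'a = complex]
    by (simp add: C_def fps_expansion_def funpow_Suc_right del: funpow.simps of_nat_Suc)
  then have "real (Suc n) * norm (fps_nth (fps_expansion g 0) (Suc n)) \<le> n + 1"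
    using C_le[of n] by (simp add: norm_mult del: of_nat_Suc)
  then show ?thesis by (simp add: mult_le_cancel_left1 del: of_nat_Suc) 
qed

text \<open>Dividing the convex function by its derivative \<open>b\<close> at 0 multiplies the
  quotient by \<open>b\<close>. This makes its value at 0 equal to 1 but turns the right half-plane
  by the argument of \<open>b\<close>, hence \<open>e = b / norm b\<close>.\<close>

lemma class_C3_normalized:
  assumes "f \<in> class_C3"
  obtains g p e where "g holomorphic_on ball 0 1" "inj_on g (ball 0 1)" "convex (g ` ball 0 1)"
    "g 0 = 0" "deriv g 0 = 1" "p holomorphic_on ball 0 1" "p 0 = 1" "norm e = 1"
    "\<And>z. z \<in> ball 0 1 \<Longrightarrow> Re (cnj e * p z) > 0"
    "\<And>z. z \<in> ball 0 1 \<Longrightarrow> deriv (\<lambda>w. w * deriv (\<lambda>v. v * deriv f v) w) z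
       = p z * deriv (\<lambda>w. w * deriv g w) z"
proof -
  have f: "f holomorphic_on ball 0 1" "f 0 = 0" "deriv f 0 = 1"
    using assms by (auto simp: class_C3_def)
  obtain g0 where "convex_function g0" and g00: "g0 0 = 0" and b: "Re (deriv g0 0) > 0"
    and pos: "\<And>z. z \<in> ball 0 1 \<Longrightarrow> Re (deriv (\<lambda>w. w * deriv (\<lambda>v. v * deriv f v) w) z
               / deriv (\<lambda>w. w * deriv g0 w) z) > 0"
    using assms unfolding class_C3_def by blast
  then have g0: "g0 holomorphic_on ball 0 1" "inj_on g0 (ball 0 1)" "convex (g0 ` ball 0 1)"
    by (auto simp: convex_function_def)
  define b where "b = deriv g0 0"
  have bnz: "b \<noteq> 0" using \<open>Re (deriv g0 0) > 0\<close> by (auto simp: b_def)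
  define g where "g = (\<lambda>z. g0 z / b)"
  define A where "A = (\<lambda>z. deriv (\<lambda>w. w * deriv (\<lambda>v. v * deriv f v) w) z)"
  define D where "D = (\<lambda>z. deriv (\<lambda>w. w * deriv g0 w) z)"
  define p where "p = (\<lambda>z. b * (A z / D z))"
  define e where "e = b / of_real (norm b)"
  have f': "deriv f holomorphic_on ball 0 1" by (intro holomorphic_deriv f) auto
  have phi: "(\<lambda>v. v * deriv f v) holomorphic_on ball 0 1" by (intro holomorphic_intros f')
  have phi': "deriv (\<lambda>v. v * deriv f v) holomorphic_on ball 0 1" by (intro holomorphic_deriv phi) auto
  have A: "A holomorphic_on ball 0 1" unfolding A_def
    by (intro holomorphic_deriv holomorphic_intros phi') auto
  have g0': "deriv g0 holomorphic_on ball 0 1" by (intro holomorphic_deriv g0) auto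
  have D: "D holomorphic_on ball 0 1" unfolding D_def
    by (intro holomorphic_deriv holomorphic_intros g0') auto
  have Dnz: "D z \<noteq> 0" if "z \<in> ball 0 1" for z using pos[OF that] by (auto simp: D_def)
  have g': "deriv g z = deriv g0 z / b" if "z \<in> ball 0 1" for z
    using holomorphic_derivI[OF g0(1) open_ball that] bnz unfolding g_def
    by (auto intro!: DERIV_imp_deriv derivative_eq_intros)
  have Dg: "deriv (\<lambda>w. w * deriv g w) z = D z / b" if z: "z \<in> ball 0 1" for z
  proof -
    have "((\<lambda>w. w * deriv g0 w / b) has_field_derivative D z / b) (at z)"
      unfolding D_def
      by (intro DERIV_cdivide holomorphic_derivI[OF _ open_ball z] holomorphic_intros g0')
    then have "((\<lambda>w. w * deriv g w) has_field_derivative D z / b) (at z)"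
      by (rule has_field_derivative_transform_within_open[of _ _ _ "ball 0 1"]) (use z g' in auto)
    then show ?thesis by (rule DERIV_imp_deriv)
  qed
  show ?thesis
  proof (rule that[of g p e])
    show "g holomorphic_on ball 0 1" unfolding g_def using bnz by (intro holomorphic_intros g0) auto
    show "inj_on g (ball 0 1)" using g0(2) bnz by (auto simp: g_def inj_on_def)
    have "g ` ball 0 1 = (\<lambda>x. inverse b * x) ` (g0 ` ball 0 1)"
      by (auto simp: g_def image_image divide_inverse mult.commute)
    then show "convex (g ` ball 0 1)"
      using g0(3) by (simp add: convex_linear_image linear_times)
    show "g 0 = 0" by (simp add: g_def g00)
    show "deriv g 0 = 1" using g'[of 0] bnz by (simp add: b_def)
    show "p holomorphic_on ball 0 1" unfolding p_def using Dnz by (intro holomorphic_intros A D) auto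
    show "p 0 = 1"
      using bnz deriv_times_id[OF phi', of 0] deriv_times_id[OF f', of 0] deriv_times_id[OF g0', of 0] f
      by (simp add: p_def A_def D_def b_def)
    show "norm e = 1" using bnz by (simp add: e_def norm_divide)
    show "Re (cnj e * p z) > 0" if "z \<in> ball 0 1" for z
    proof -
      have "cnj e * b = of_real (norm b)"
        using bnz complex_norm_square[of b] by (simp add: e_def field_simps power2_eq_square)
      then have "cnj e * p z = of_real (norm b) * (A z / D z)"
        by (simp add: p_def mult.assoc[symmetric] del: times_divide_eq_right)
      then have "Re (cnj e * p z) = norm b * Re (A z / D z)"
        by (simp only: times_complex.sel Re_complex_of_real Im_complex_of_real mult_zero_left diff_zero)
      then show ?thesis using pos[OF that] bnz by (simp add: A_def D_def)
    qed
    show "deriv (\<lambda>w. w * deriv (\<lambda>v. v * deriv f v) w) z = p z * deriv (\<lambda>w. w * deriv g w) z"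
      if "z \<in> ball 0 1" for z
      using Dg[OF that] Dnz[OF that] bnz by (simp add: p_def A_def)
  qed
qed

lemma holomorphic_quotient_by_id:
  assumes g: "g holomorphic_on ball 0 1" and "g 0 = 0"
  shows "(\<lambda>z. if z = 0 then deriv g 0 else g z / z) holomorphic_on ball 0 1"
  by (rule pole_theorem_open_0[OF g open_ball, where a = 0]) (auto simp: assms)

lemma Re_pos_if_Re_nonneg_punctured:
  fixes R :: "complex \<Rightarrow> complex"
  assumes R: "R holomorphic_on ball 0 1" and nonneg: "\<And>z. z \<in> ball 0 1 \<Longrightarrow> z \<noteq> 0 \<Longrightarrow> Re (R z) \<ge> 0"
    and "Re (R 0) > 0" and "z \<in> ball 0 1"
  shows "Re (R z) > 0"
proof (rule Re_pos_if_Re_nonneg[OF R _ assms(3,4)])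
  show "0 \<le> Re (R w)" if "w \<in> ball 0 1" for w
    using nonneg[OF that] assms(3) by (cases "w = 0") auto
qed

text \<open>The number \<open>a\<close> is the cosine of the tilt of the half-plane. Its range is
  all that is exported, since the term carrying it is nonnegative at radius 1 for every such
  \<open>a\<close>. Univalence is exported too, because the estimates at the boundary use
  it.\<close>

lemma class_C3_growth:
  assumes "f \<in> class_C3"
  obtains a where "0 < a" "a \<le> 1" "inj_on f (ball 0 1)"
    "\<And>z. z \<in> ball 0 1 \<Longrightarrow> 2 / 3 * (norm z / (1 + norm z)) - dilog (- norm z) / 3
       + (1 - a) * (norm z ^ 2 / 12 - 2 * norm z ^ 5 / 25) \<le> norm (f z)"
proof -
  have f: "f holomorphic_on ball 0 1" "f 0 = 0" "deriv f 0 = 1"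
    using assms by (auto simp: class_C3_def)
  obtain g p e where g: "g holomorphic_on ball 0 1" "inj_on g (ball 0 1)" "convex (g ` ball 0 1)"
      "g 0 = 0" "deriv g 0 = 1"
    and p: "p holomorphic_on ball 0 1" "p 0 = 1" and e: "norm e = 1"
    and pos: "\<And>z. z \<in> ball 0 1 \<Longrightarrow> Re (cnj e * p z) > 0"
    and eq: "\<And>z. z \<in> ball 0 1 \<Longrightarrow> deriv (\<lambda>w. w * deriv (\<lambda>v. v * deriv f v) w) z
       = p z * deriv (\<lambda>w. w * deriv g w) z"
    by (rule class_C3_normalized[OF assms]) (rule that; assumption)
  define a where "a = Re e"
  have a: "0 < a" "a \<le> 1" using pos[of 0] p complex_Re_le_cmod[of e] e by (auto simp: a_def)
  have ee: "cnj e * e = 1" using e complex_norm_square[of e] by (simp add: mult.commute)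
  have f': "deriv f holomorphic_on ball 0 1" by (intro holomorphic_deriv f) auto
  define \<phi> where "\<phi> = (\<lambda>v. v * deriv f v)"
  have \<phi>: "\<phi> holomorphic_on ball 0 1" unfolding \<phi>_def by (intro holomorphic_intros f')
  have \<phi>': "deriv \<phi> holomorphic_on ball 0 1" by (intro holomorphic_deriv \<phi>) auto
  have \<phi>'0: "deriv \<phi> 0 = 1" using deriv_times_id[OF f', of 0] f by (simp add: \<phi>_def)
  define N where "N = (\<lambda>z. z * deriv \<phi> z)"
  have N: "N holomorphic_on ball 0 1" unfolding N_def by (intro holomorphic_intros \<phi>')
  have g': "deriv g holomorphic_on ball 0 1" by (intro holomorphic_deriv g) auto
  define G where "G = (\<lambda>z. z * deriv g z)"
  have G: "G holomorphic_on ball 0 1" unfolding G_def by (intro holomorphic_intros g')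
  have G0: "G 0 = 0" and N0: "N 0 = 0" by (simp_all add: G_def N_def)
  have g'nz: "deriv g z \<noteq> 0" if "z \<in> ball 0 1" for z
    using holomorphic_injective_imp_regular[OF g(1) open_ball g(2) that] .
  have Gnz: "G z \<noteq> 0" if "z \<in> ball 0 1" "z \<noteq> 0" for z using g'nz that by (simp add: G_def)
  have gnz: "g z \<noteq> 0" if "z \<in> ball 0 1" "z \<noteq> 0" for z
    using inj_onD[OF g(2), of z 0] that g(4) by auto
  have dG: "deriv G z = deriv g z + z * deriv (deriv g) z" if "z \<in> ball 0 1" for z
    using deriv_times_id[OF g' that] by (simp add: G_def)
  have Ppos: "Re (1 + z * deriv (deriv g) z / deriv g z) > 0" if "z \<in> ball 0 1" for z
    using convex_function_imp_Re_pos[OF g(1-3) that] .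
  have starG: "Re (z * deriv G z / G z) > 0" if "z \<in> ball 0 1" "z \<noteq> 0" for z
  proof -
    have "z * deriv G z / G z = 1 + z * deriv (deriv g) z / deriv g z"
      using that g'nz[OF that(1)] by (simp add: G_def dG[unfolded G_def] field_simps)
    then show ?thesis using Ppos[OF that(1)] by simp
  qed
  have dN: "deriv N z = p z * deriv G z" if "z \<in> ball 0 1" for z
    using eq[OF that] by (simp add: N_def \<phi>_def G_def)
  have G'_ge: "(1 - norm z) / (1 + norm z) ^ 3 \<le> norm (deriv G z)" if "z \<in> ball 0 1" for z
    using convex_function_deriv_lower_bound(2)[OF g(1,5) g'nz Ppos that] by (simp add: dG[OF that])
  define Nl where "Nl = (\<lambda>r::real. r * (3 + r\<^sup>2) / (3 * (1 + r) ^ 3))"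
  \<comment> \<open>The direction \<open>cnj e\<close> keeps the real part positive up to the
    circle. Besides the estimate at large radii, this supplies the sign of N/G that makes \<phi>
    close-to-convex.\<close>
  have late: "a * Nl (norm z) \<le> norm (G z) * Re (cnj e * N z / G z)" if z: "z \<in> ball 0 1" for z
  proof (rule starlike_ray_bound[where p = "\<lambda>z. cnj e * p z" and R = 1 and S = "\<lambda>r. a * Nl r"
        and S' = "\<lambda>r. a * ((1 - r)\<^sup>2 / (1 + r) ^ 4)" and N = "\<lambda>z. cnj e * N z"])
    fix w :: complex assume w: "w \<in> ball 0 1"
    define r where "r = norm w"
    have r: "0 \<le> r" "r < 1" using w by (auto simp: r_def)
    have nz: "1 - r\<^sup>2 \<noteq> 0" "1 + r \<noteq> 0" using r by (auto simp: power2_eq_1_iff)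
    show "deriv (\<lambda>z. cnj e * N z) w = cnj e * p w * deriv G w"
      using dN[OF w] holomorphic_on_imp_differentiable_at[OF N open_ball w] by (simp add: mult.assoc)
    show "0 \<le> Re (cnj e * p w)" using pos[OF w] by simp
    have "a + (2 * a * r\<^sup>2 - 2 * a * r) / (1 - r\<^sup>2) \<le> Re (cnj e * p w)"
      using Caratheodory_Re_bound[OF p pos e w, of "cnj e"] e ee by (simp add: r_def a_def)
    also have "a + (2 * a * r\<^sup>2 - 2 * a * r) / (1 - r\<^sup>2) = a * ((1 - r) / (1 + r))"
      using nz by (simp add: divide_simps) (simp add: algebra_simps power2_eq_square)
    finally have "a * ((1 - r) / (1 + r)) * ((1 - r) / (1 + r) ^ 3) \<le> Re (cnj e * p w) * norm (deriv G w)"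
      using G'_ge[OF w] r a pos[OF w] by (intro mult_mono) (auto simp: r_def)
    also have "a * ((1 - r) / (1 + r)) * ((1 - r) / (1 + r) ^ 3) = a * ((1 - r)\<^sup>2 / (1 + r) ^ 4)"
      by (simp add: power2_eq_square eval_nat_numeral mult.assoc)
    finally show "a * ((1 - norm w)\<^sup>2 / (1 + norm w) ^ 4) \<le> Re (cnj e * p w) * norm (deriv G w)"
      by (simp add: r_def)
  next
    show "((\<lambda>r. a * Nl r) has_real_derivative a * ((1 - r)\<^sup>2 / (1 + r) ^ 4)) (at r)" if "0 \<le> r" for r
      unfolding Nl_def by (intro DERIV_cmult DERIV_sharp_growth that)
  qed (use z Gnz starG in \<open>auto simp: G_def N_def Nl_def intro!: holomorphic_intros N G[unfolded G_def] N[unfolded N_def]\<close>)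
  have Re_le: "norm (G z) * Re (c * N z / G z) \<le> norm (N z)" if "norm c = 1" for c z
  proof (cases "G z = 0")
    case False
    have "norm (G z) * Re (c * N z / G z) \<le> norm (G z) * norm (c * N z / G z)"
      by (intro mult_left_mono complex_Re_le_cmod) auto
    then show ?thesis using False that by (simp add: norm_mult norm_divide)
  qed simp
  have N_ge: "Nl (norm z) + (1 - a) * (norm z ^ 2 / 3 - 2 * norm z ^ 5) \<le> norm (N z)" if z: "z \<in> ball 0 1" for z
  proof (cases "(norm z)\<^sup>2 \<le> 1/2")
    case True
    then have zR: "norm z \<le> sqrt (1/2)" by (rule real_le_rsqrt)
    have "tilted_growth a (norm z) \<le> norm (G z) * Re (N z / G z)"
    proof (rule starlike_ray_bound[where p = p and R = "sqrt (1/2)" and S = "tilted_growth a"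
        and S' = "\<lambda>r. (1 - r\<^sup>2 + 2 * a\<^sup>2 * r\<^sup>2 - 2 * a * r) / (1 + r) ^ 4"])
      fix w :: complex assume w: "w \<in> ball 0 1" "norm w \<le> sqrt (1/2)"
      define r where "r = norm w"
      have r: "0 \<le> r" "r < 1" using w by (auto simp: r_def)
      have r2: "r\<^sup>2 \<le> 1/2"
        using power_mono[OF w(2), of 2] by (simp add: r_def)
      have nz: "1 - r\<^sup>2 > 0" using r2 by simp
      have "1 + (2 * a * a * r\<^sup>2 - 2 * a * r) / (1 - r\<^sup>2) \<le> Re (p w)"
        using Caratheodory_Re_bound[OF p pos e w(1), of 1] by (simp add: r_def a_def)
      also have "1 + (2 * a * a * r\<^sup>2 - 2 * a * r) / (1 - r\<^sup>2) = (1 - r\<^sup>2 + 2 * a\<^sup>2 * r\<^sup>2 - 2 * a * r) / (1 - r\<^sup>2)"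
        using nz by (simp add: field_simps power2_eq_square)
      finally have Rp: "(1 - r\<^sup>2 + 2 * a\<^sup>2 * r\<^sup>2 - 2 * a * r) / (1 - r\<^sup>2) \<le> Re (p w)" .
      \<comment> \<open>Completing the square in \<open>a * r\<close> shows the origin of the
        threshold: the least value of this numerator over all \<open>a * r\<close> is 1/2 -
        r^2.\<close>
      have "(1 - r\<^sup>2 + 2 * a\<^sup>2 * r\<^sup>2 - 2 * a * r) = (1 - 2 * a * r)\<^sup>2 / 2 + (1/2 - r\<^sup>2)"
        by (simp add: power2_eq_square field_simps)
      moreover have "0 \<le> (1 - 2 * a * r)\<^sup>2" by simp
      ultimately have n0: "0 \<le> 1 - r\<^sup>2 + 2 * a\<^sup>2 * r\<^sup>2 - 2 * a * r" using r2 by linarith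
      then have q0: "0 \<le> (1 - r\<^sup>2 + 2 * a\<^sup>2 * r\<^sup>2 - 2 * a * r) / (1 - r\<^sup>2)" using nz by simp
      then show "0 \<le> Re (p w)" using Rp by simp
      have "(1 - r\<^sup>2 + 2 * a\<^sup>2 * r\<^sup>2 - 2 * a * r) / (1 - r\<^sup>2) * ((1 - r) / (1 + r) ^ 3) \<le> Re (p w) * norm (deriv G w)"
        using G'_ge[OF w(1)] r Rp q0 by (intro mult_mono) (auto simp: r_def)
      also have "(1 - r\<^sup>2 + 2 * a\<^sup>2 * r\<^sup>2 - 2 * a * r) / (1 - r\<^sup>2) * ((1 - r) / (1 + r) ^ 3)
        = (1 - r\<^sup>2 + 2 * a\<^sup>2 * r\<^sup>2 - 2 * a * r) / (1 + r) ^ 4"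
      proof -
        have "1 - r\<^sup>2 = (1 - r) * (1 + r)" by (simp add: power2_eq_square algebra_simps)
        then have "(1 - r) / (1 - r\<^sup>2) = 1 / (1 + r)" using r by simp
        then have "X / (1 - r\<^sup>2) * ((1 - r) / Y) = X / ((1 + r) * Y)" for X Y :: real
          by (metis (no_types, opaque_lifting) divide_divide_eq_left mult.commute mult.right_neutral
              times_divide_eq_left times_divide_eq_right)
        then show ?thesis by (simp add: eval_nat_numeral)
      qed
      finally show "(1 - (norm w)\<^sup>2 + 2 * a\<^sup>2 * (norm w)\<^sup>2 - 2 * a * norm w) / (1 + norm w) ^ 4
          \<le> Re (p w) * norm (deriv G w)"
        by (simp add: r_def)
    qed (use z zR Gnz starG dN DERIV_tilted_growth in \<open>auto simp: tilted_growth_def G0 N0 intro: N G\<close>)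
    also have "\<dots> \<le> norm (N z)" using Re_le[of 1 z] by simp
    finally show ?thesis using tilted_growth_ge[of "norm z" a] a by (simp add: Nl_def)
  next
    case False
    have "a * Nl (norm z) \<le> norm (N z)"
      using late[OF z] Re_le[of "cnj e" z] e by simp
    then show ?thesis using scaled_growth_ge[of "norm z" a] z False a by (simp add: Nl_def)
  qed
  \<comment> \<open>Off 0 this quotient is \<open>cnj e * N z / G z\<close>, whose real part is
    positive by \<open>late\<close>.\<close>
  have Q_pos: "Re (cnj e * (deriv \<phi> z / deriv g z)) > 0" if z: "z \<in> ball 0 1" for z
  proof (cases "z = 0")
    case False
    have "0 < a * Nl (norm z)" using a False by (simp add: Nl_def add_pos_nonneg)
    then have "0 < norm (G z) * Re (cnj e * N z / G z)" using late[OF z] by linarith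
    then have "0 < Re (cnj e * N z / G z)" by (simp add: zero_less_mult_iff)
    also have "cnj e * N z / G z = cnj e * (deriv \<phi> z / deriv g z)" using False by (simp add: N_def G_def)
    finally show ?thesis .
  qed (use \<phi>'0 g(5) a in \<open>simp add: a_def\<close>)
  have inj\<phi>: "inj_on \<phi> (ball 0 1)"
    by (rule inj_on_if_Re_deriv_ratio_pos[OF open_ball g(1-3) \<phi> Q_pos])
  \<comment> \<open>Since N = z \<phi>', the bound for |\<phi>'| is \<open>N_ge\<close> divided by
    the radius; that is \<open>Wl'\<close>, and \<open>Wl\<close> is its primitive.\<close>
  define Wl where "Wl = (\<lambda>r::real. 2 / 3 * (r / (1 + r)\<^sup>2) + ln (1 + r) / 3 + (1 - a) * (r\<^sup>2 / 6 - 2 * r ^ 5 / 5))"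
  define Wl' where "Wl' = (\<lambda>r::real. (3 + r\<^sup>2) / (3 * (1 + r) ^ 3) + (1 - a) * (r / 3 - 2 * r ^ 4))"
  have \<phi>_ge: "Wl (norm z) \<le> norm (\<phi> z)" if z: "z \<in> ball 0 1" for z
  proof (rule univalent_growth[where W' = Wl', OF \<phi> inj\<phi>])
    fix r :: real assume r: "0 \<le> r" "r < 1"
    have d1: "((\<lambda>r. r / (1 + r)\<^sup>2) has_real_derivative
        ((1 + r)\<^sup>2 - r * (2 * (1 + r))) / ((1 + r)\<^sup>2 * (1 + r)\<^sup>2)) (at r)"
      using r by (auto intro!: derivative_eq_intros)
    have d2: "((\<lambda>r. ln (1 + r)) has_real_derivative 1 / (1 + r)) (at r)"
      using r by (auto intro!: derivative_eq_intros)
    note DERIV_add[OF DERIV_cmult[OF d1, of "2 / 3"] DERIV_cdivide[OF d2, of 3]]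
    also have "2 / 3 * (((1 + r)\<^sup>2 - r * (2 * (1 + r))) / ((1 + r)\<^sup>2 * (1 + r)\<^sup>2)) + 1 / (1 + r) / 3
       = (3 + r\<^sup>2) / (3 * (1 + r) ^ 3)"
    proof -
      have "1 + r \<noteq> 0" using r by simp
      then show ?thesis by (simp add: divide_simps) algebra
    qed
    finally have 1: "((\<lambda>r. 2 / 3 * (r / (1 + r)\<^sup>2) + ln (1 + r) / 3) has_real_derivative
       (3 + r\<^sup>2) / (3 * (1 + r) ^ 3)) (at r)" .
    have "((\<lambda>r. (1 - a) * (r\<^sup>2 / 6 - 2 * r ^ 5 / 5)) has_real_derivative (1 - a) * (r / 3 - 2 * r ^ 4)) (at r)"
      by (auto intro!: derivative_eq_intros simp: field_simps)
    from DERIV_add[OF 1 this] show "(Wl has_real_derivative Wl' r) (at r)"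
      unfolding Wl_def Wl'_def by simp
  next
    fix w :: complex assume w: "w \<in> ball 0 1"
    show "Wl' (norm w) \<le> norm (deriv \<phi> w)"
    proof (cases "w = 0")
      case False
      have "norm w * Wl' (norm w) = Nl (norm w) + (1 - a) * (norm w ^ 2 / 3 - 2 * norm w ^ 5)"
        by (simp add: Wl'_def Nl_def field_simps eval_nat_numeral)
      then have "norm w * Wl' (norm w) \<le> norm w * norm (deriv \<phi> w)"
        using N_ge[OF w] by (simp add: N_def norm_mult)
      then show ?thesis using False by simp
    qed (simp add: Wl'_def \<phi>'0)
  qed (use z in \<open>auto simp: \<phi>_def Wl_def\<close>)
  \<comment> \<open>Alexander's construction: a primitive \<open>k\<close> of g/z satisfies z k' =
    g, so starlikeness of \<open>g\<close> becomes convexity of \<open>k\<close>.\<close>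
  define q where "q = (\<lambda>z. if z = 0 then deriv g 0 else g z / z)"
  have q: "q holomorphic_on ball 0 1"
    unfolding q_def by (rule holomorphic_quotient_by_id[OF g(1,4)])
  have qnz: "q z \<noteq> 0" if "z \<in> ball 0 1" for z using gnz that by (auto simp: q_def g(5))
  have gq: "g z = z * q z" for z using g(4) by (simp add: q_def)
  obtain k where kk: "\<And>z. z \<in> ball 0 1 \<Longrightarrow> (k has_field_derivative q z) (at z within ball 0 1)"
    by (rule holomorphic_convex_primitive'[OF convex_ball open_ball q]) (rule that)
  have dk: "(k has_field_derivative q z) (at z)" if "z \<in> ball 0 1" for z
    using kk[OF that] by (simp only: at_within_open[OF that open_ball])
  have k: "k holomorphic_on ball 0 1"
    unfolding holomorphic_on_open[OF open_ball] using dk by blast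
  have khol': "deriv k holomorphic_on ball 0 1" by (rule holomorphic_deriv[OF k open_ball])
  have k': "deriv k z = q z" if "z \<in> ball 0 1" for z using dk[OF that] by (rule DERIV_imp_deriv)
  have k'': "deriv (deriv k) z = deriv q z" if "z \<in> ball 0 1" for z
    by (rule complex_derivative_transform_within_open[OF khol' q open_ball that k'])
  \<comment> \<open>A convex \<open>g\<close> is starlike: take 0 as the second point in the
    supporting half-plane property.\<close>
  have starg: "Re (z * deriv g z / g z) > 0" if z: "z \<in> ball 0 1" "z \<noteq> 0" for z
  proof -
    have "Re ((g z - g 0) * cnj (G z)) > 0"
      by (rule supporting_half_plane[OF g(1) _ g'nz Ppos z(1)]) (use z in \<open>auto simp: G_def\<close>)
    then have "Re (g z * cnj (G z)) > 0" by (simp add: g(4))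
    moreover have "Re (G z / g z) = Re (g z * cnj (G z)) / (norm (g z))\<^sup>2"
      unfolding complex_div_cnj[of "G z"] by (simp add: Re_divide_of_real algebra_simps flip: of_real_power)
    ultimately have "Re (G z / g z) > 0" using gnz[OF z] by simp
    then show ?thesis by (simp add: G_def)
  qed
  have stark: "Re (1 + z * deriv (deriv k) z / deriv k z) > 0" if z: "z \<in> ball 0 1" for z
  proof (cases "z = 0")
    case False
    have "deriv g z = q z + z * deriv q z"
      using deriv_times_id[OF q z] by (simp add: gq[abs_def, symmetric])
    then have "z * deriv g z / g z = 1 + z * deriv (deriv k) z / deriv k z"
      using False qnz[OF z] k'[OF z] k''[OF z] by (simp add: gq field_simps)
    then show ?thesis using starg[OF z False] by simp
  qed simp
  have supp: "Re ((k z1 - k z2) * cnj (g z1)) > 0"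
    if "z1 \<in> ball 0 1" "norm z2 \<le> norm z1" "z2 \<noteq> z1" for z1 z2
    by (rule supporting_half_plane[OF k _ _ stark that]) (use k' qnz gq in auto)
  have R_pos: "Re (cnj e * (deriv f z / q z)) > 0" if z: "z \<in> ball 0 1" for z
  proof (rule Re_pos_if_Re_nonneg_punctured[OF _ _ _ z])
    show "(\<lambda>z. cnj e * (deriv f z / q z)) holomorphic_on ball 0 1"
      using qnz by (intro holomorphic_intros f' q) auto
    show "0 < Re (cnj e * (deriv f 0 / q 0))" using f a g(5) by (simp add: q_def a_def)
    fix w :: complex assume w: "w \<in> ball 0 1" "w \<noteq> 0"
    \<comment> \<open>With the zero growth function the ray argument transfers only a sign, from
      \<phi>'/g' to \<phi>/g. It gives a weak inequality away from 0, which the minimum principle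
      makes strict.\<close>
    have "0 \<le> norm (g w) * Re (cnj e * \<phi> w / g w)"
    proof (rule starlike_ray_bound[where p = "\<lambda>z. cnj e * (deriv \<phi> z / deriv g z)" and R = 1 and S = "\<lambda>_. 0"
          and S' = "\<lambda>_. 0" and N = "\<lambda>z. cnj e * \<phi> z"])
      fix v :: complex assume v: "v \<in> ball 0 1"
      show "deriv (\<lambda>z. cnj e * \<phi> z) v = cnj e * (deriv \<phi> v / deriv g v) * deriv g v"
        using g'nz[OF v] holomorphic_on_imp_differentiable_at[OF \<phi> open_ball v] by simp
      show "0 \<le> Re (cnj e * (deriv \<phi> v / deriv g v))" using Q_pos[OF v] by simp
      then show "0 \<le> Re (cnj e * (deriv \<phi> v / deriv g v)) * norm (deriv g v)" by simp
    qed (use w g gnz starg in \<open>auto simp: \<phi>_def intro!: holomorphic_intros f'\<close>)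
    then have "0 \<le> Re (cnj e * \<phi> w / g w)" using gnz[OF w] by (simp add: zero_le_mult_iff)
    also have "cnj e * \<phi> w / g w = cnj e * (deriv f w / q w)" using w by (simp add: \<phi>_def gq)
    finally show "0 \<le> Re (cnj e * (deriv f w / q w))" .
  qed
  \<comment> \<open>Convexity of the image under \<open>k\<close> is available for discs of radius
    below 1 only, so univalence of \<open>f\<close> is shown on these first.\<close>
  have injr: "inj_on f (ball 0 r)" if r: "0 < r" "r < 1" for r
  proof (rule inj_on_if_Re_deriv_ratio_pos[where k = k and c = "cnj e"])
    show "inj_on k (ball 0 r)"
      by (rule inj_on_subset[OF inj_on_if_supporting_half_plane[of k g, OF supp]]) (use r in auto)
    show "convex (k ` ball 0 r)"
      by (rule convex_image_if_supporting_half_plane[OF k r supp])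
    show "Re (cnj e * (deriv f z / deriv k z)) > 0" if "z \<in> ball 0 r" for z
      using R_pos[of z] k'[of z] that r by simp
  qed (use r in \<open>auto intro!: holomorphic_on_subset[OF k] holomorphic_on_subset[OF f(1)]\<close>)
  have inj: "inj_on f (ball 0 1)"
  proof (rule inj_onI)
    fix x y :: complex assume xy: "x \<in> ball 0 1" "y \<in> ball 0 1" "f x = f y"
    define r where "r = (1 + max (norm x) (norm y)) / 2"
    have "0 < r" "r < 1" "norm x < r" "norm y < r" using xy by (auto simp: r_def max_def add_pos_nonneg)
    then show "x = y" using injr[of r] xy by (auto dest: inj_onD)
  qed
  \<comment> \<open>Since \<phi> = z f', the bound for |f'| is \<open>Wl\<close> divided by the
    radius. The quotient ln (1 + r) / r is \<open>dilog' (- r)\<close>, which is how the dilogarithm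
    enters.\<close>
  define V where "V = (\<lambda>r::real. 2 / 3 * (r / (1 + r)) - dilog (- r) / 3 + (1 - a) * (r ^ 2 / 12 - 2 * r ^ 5 / 25))"
  define V' where "V' = (\<lambda>r::real. 2 / 3 * (1 / (1 + r)\<^sup>2) + dilog' (- r) / 3 + (1 - a) * (r / 6 - 2 * r ^ 4 / 5))"
  have "V (norm z) \<le> norm (f z)" if z: "z \<in> ball 0 1" for z
  proof (rule univalent_growth[where W' = V', OF f(1) inj f(2)])
    fix r :: real assume r: "0 \<le> r" "r < 1"
    have "((\<lambda>r. r / (1 + r)) has_real_derivative 1 / (1 + r)\<^sup>2) (at r)"
      using r by (auto intro!: derivative_eq_intros simp: power2_eq_square)
    then have "((\<lambda>r. 2 / 3 * (r / (1 + r))) has_real_derivative 2 / 3 * (1 / (1 + r)\<^sup>2)) (at r)"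
      by (rule DERIV_cmult)
    moreover have "((\<lambda>r. - dilog (- r) / 3) has_real_derivative dilog' (- r) / 3) (at r)"
    proof -
      have "(dilog has_real_derivative dilog' (- r)) (at (- r))"
        using r by (intro has_field_derivative_dilog) auto
      moreover have "(uminus has_real_derivative -1) (at r)"
        by (auto intro!: derivative_eq_intros)
      ultimately have "((\<lambda>r. dilog (- r)) has_real_derivative dilog' (- r) * (-1)) (at r)"
        by (rule DERIV_chain2)
      from DERIV_cdivide[OF DERIV_minus[OF this], of 3] show ?thesis by simp
    qed
    moreover have "((\<lambda>r. (1 - a) * (r ^ 2 / 12 - 2 * r ^ 5 / 25)) has_real_derivative (1 - a) * (r / 6 - 2 * r ^ 4 / 5)) (at r)"
      by (auto intro!: derivative_eq_intros simp: field_simps)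
    ultimately show "(V has_real_derivative V' r) (at r)"
      unfolding V_def V'_def diff_conv_add_uminus minus_divide_left by (intro DERIV_add)
  next
    fix w :: complex assume w: "w \<in> ball 0 1"
    show "V' (norm w) \<le> norm (deriv f w)"
    proof (cases "w = 0")
      case False
      have "norm w * dilog' (- norm w) = ln (1 + norm w)"
        using times_dilog'_real[of "- norm w"] w by simp
      then have "norm w * V' (norm w) = Wl (norm w)"
        by (simp add: V'_def Wl_def field_simps eval_nat_numeral)
      then have "norm w * V' (norm w) \<le> norm w * norm (deriv f w)"
        using \<phi>_ge[OF w] by (simp add: \<phi>_def norm_mult)
      then show ?thesis using False by simp
    qed (simp add: V'_def f dilog'_0)
  qed (use z in \<open>auto simp: V_def dilog_0\<close>)
  with a inj show ?thesis by (intro that[of a]) (auto simp: V_def)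
qed

section \<open>Coefficient bounds in the class\<close>

lemma fps_nth_expansion_deriv:
  "fps_nth (fps_expansion (deriv f) 0) n = of_nat (Suc n) * fps_nth (fps_expansion f 0) (Suc n)"
  using of_nat_neq_0[of n, where ?'a = complex]
  by (simp add: fps_expansion_def funpow_Suc_right del: funpow.simps of_nat_Suc)

text \<open>With n = m + 1, the coefficients of (z g')' are at most (j + 1)^2 in modulus, so
  convolution with \<open>p\<close> gives at most 2 (1^2 + ... + (n-1)^2) + n^2 = (2 n^3 + n) / 3.
  On the other side the three differentiations produce n^3 times the coefficient of
  \<open>f\<close>.\<close>

lemma class_C3_coeff_bound:
  assumes "f \<in> class_C3"
  shows "norm (taylor_coeff f (Suc m)) \<le> 2 / 3 + 1 / (3 * real (Suc m) ^ 2)"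
proof (rule class_C3_normalized[OF assms])
  fix g p e
  assume g: "g holomorphic_on ball 0 1" "inj_on g (ball 0 1)" "convex (g ` ball 0 1)"
      "g 0 = 0" "deriv g 0 = 1"
    and p: "p holomorphic_on ball 0 1" "p 0 = 1" and e: "norm e = 1"
    and pos: "\<And>z. z \<in> ball 0 1 \<Longrightarrow> Re (cnj e * p z) > 0"
    and eq: "\<And>z. z \<in> ball 0 1 \<Longrightarrow> deriv (\<lambda>w. w * deriv (\<lambda>v. v * deriv f v) w) z
       = p z * deriv (\<lambda>w. w * deriv g w) z"
  have f: "f holomorphic_on ball 0 1" using assms by (auto simp: class_C3_def)
  have f': "deriv f holomorphic_on ball 0 1" by (intro holomorphic_deriv f) auto
  have g': "deriv g holomorphic_on ball 0 1" by (intro holomorphic_deriv g) auto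
  have \<phi>': "deriv (\<lambda>v. v * deriv f v) holomorphic_on ball 0 1"
    by (intro holomorphic_deriv holomorphic_intros f') auto
  have D': "(\<lambda>z. deriv (\<lambda>w. w * deriv g w) z) holomorphic_on ball 0 1"
    by (intro holomorphic_deriv holomorphic_intros g') auto
  define C where "C = fps_expansion (deriv g) 0"
  define D where "D = fps_deriv (fps_X * C)"
  define E where "E = fps_expansion (deriv f) 0"
  define Q where "Q = fps_expansion p 0"
  have Q: "fps_nth Q 0 = 1" "\<And>i. i > 0 \<Longrightarrow> norm (fps_nth Q i) \<le> 2"
    using Caratheodory_coeff_bound[OF p pos e] p(2) by (auto simp: Q_def fps_expansion_def)
  have \<phi>E: "fps_expansion (deriv (\<lambda>v. v * deriv f v)) 0 = fps_deriv (fps_X * E)"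
    unfolding E_def by (rule fps_expansion_eqI[OF has_fps_expansion_deriv_times_id[OF f']])
  have D: "(\<lambda>z. deriv (\<lambda>w. w * deriv g w) z) has_fps_expansion D"
    unfolding D_def C_def by (rule has_fps_expansion_deriv_times_id[OF g'])
  have "p has_fps_expansion Q"
    unfolding Q_def by (rule has_fps_expansion_fps_expansion[OF open_ball _ p(1)]) auto
  then have "(\<lambda>z. p z * deriv (\<lambda>w. w * deriv g w) z) has_fps_expansion Q * D"
    using D by (rule has_fps_expansion_mult)
  then have 1: "(\<lambda>z. deriv (\<lambda>w. w * deriv (\<lambda>v. v * deriv f v) w) z) has_fps_expansion Q * D"
    by (rule has_fps_expansion_cong_ball) (simp add: eq)
  have "(\<lambda>z. deriv (\<lambda>w. w * deriv (\<lambda>v. v * deriv f v) w) z) has_fps_expansion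
      fps_deriv (fps_X * fps_deriv (fps_X * E))"
    using has_fps_expansion_deriv_times_id[OF \<phi>'] by (simp only: \<phi>E)
  from fps_expansion_unique_complex[OF 1 this]
  have QD: "Q * D = fps_deriv (fps_X * fps_deriv (fps_X * E))" .
  have nth: "fps_nth (fps_deriv (fps_X * A)) j = of_nat (Suc j) * fps_nth A j" for A :: "complex fps" and j
    by (simp add: algebra_simps)
  have C_le: "norm (fps_nth C j) \<le> real (Suc j)" for j
  proof -
    have "norm (fps_nth (fps_expansion g 0) (Suc j)) \<le> 1"
      using g holomorphic_injective_imp_regular[OF g(1) open_ball g(2)]
        convex_function_imp_Re_pos[OF g(1-3)]
      by (intro convex_function_coeff_bound) auto
    then show ?thesis
      using mult_left_mono[of "norm (fps_nth (fps_expansion g 0) (Suc j))" 1 "real (Suc j)"]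
      by (simp add: C_def fps_nth_expansion_deriv norm_mult del: of_nat_Suc)
  qed
  have D_le: "norm (fps_nth D j) \<le> real (Suc j) ^ 2" for j
    using mult_left_mono[OF C_le[of j], of "real (Suc j)"]
    unfolding D_def nth norm_mult norm_of_nat by (simp add: power2_eq_square del: of_nat_Suc)
  have "norm (fps_nth (Q * D) m) \<le> norm (fps_nth (Q * D) m - fps_nth D m) + norm (fps_nth D m)"
    by (metis diff_add_cancel norm_triangle_ineq)
  also have "\<dots> \<le> 2 * (\<Sum>j<m. norm (fps_nth D j)) + norm (fps_nth D m)"
    using norm_fps_mult_diff_le[OF Q, of D m] by simp
  also have "\<dots> \<le> 2 * (\<Sum>j<m. real (Suc j) ^ 2) + real (Suc m) ^ 2"
    by (intro add_mono mult_left_mono sum_mono D_le) auto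
  also have "\<dots> = (2 * real (Suc m) ^ 3 + real (Suc m)) / 3"
    by (induction m) (auto simp: field_simps power2_eq_square power3_eq_cube)
  finally have le: "norm (fps_nth (Q * D) m) \<le> (2 * real (Suc m) ^ 3 + real (Suc m)) / 3" .
  have "fps_nth (Q * D) m = of_nat (Suc m) ^ 3 * taylor_coeff f (Suc m)"
    unfolding QD nth E_def fps_nth_expansion_deriv taylor_coeff_def
    by (simp add: power3_eq_cube mult.assoc del: of_nat_Suc)
  then have "real (Suc m) ^ 3 * norm (taylor_coeff f (Suc m)) \<le> (2 * real (Suc m) ^ 3 + real (Suc m)) / 3"
    using le by (simp add: norm_mult norm_power del: of_nat_Suc)
  also have "\<dots> = real (Suc m) ^ 3 * (2 / 3 + 1 / (3 * real (Suc m) ^ 2))"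
    by (simp add: field_simps power2_eq_square power3_eq_cube del: of_nat_Suc)
  finally show ?thesis
    using mult_le_cancel_left_pos[of "real (Suc m) ^ 3"] by (simp del: of_nat_Suc)
qed

text \<open>In HOL \<open>infdist\<close> from the empty set is 0, so a lower bound for it needs a
  frontier point. Without one the image would be the whole plane and the inverse a bounded entire
  function.\<close>

lemma frontier_image_nonempty:
  assumes f: "f holomorphic_on ball 0 1" and inj: "inj_on f (ball 0 1)"
  shows "frontier (f ` ball 0 1) \<noteq> {}"
proof
  assume "frontier (f ` ball 0 1) = {}"
  then have UN: "f ` ball 0 1 = UNIV"
    unfolding frontier_eq_empty by (auto simp: ball_eq_empty)
  obtain H where H: "H holomorphic_on (f ` ball 0 1)" "\<And>w. w \<in> ball 0 1 \<Longrightarrow> H (f w) = w"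
    by (rule holomorphic_has_inverse[OF f open_ball inj]) (rule that; assumption)
  have "range H \<subseteq> ball 0 1"
  proof
    fix y assume "y \<in> range H"
    then obtain x where "y = H x" by blast
    moreover obtain w where "w \<in> ball 0 1" "x = f w" using UN by (metis UNIV_I imageE)
    ultimately show "y \<in> ball 0 1" using H(2) by simp
  qed
  then have "bounded (range H)" using bounded_subset bounded_ball by blast
  then obtain c where c: "\<And>x. H x = c"
    using Liouville_theorem[of H] H(1) UN by (auto simp: constant_on_def)
  then show False using H(2)[of 0] H(2)[of "1/2"] by simp
qed

text \<open>Points whose images approach the frontier tend to the unit circle, and the growth bound
  extends continuously to radius 1. There its terms are 1/3, pi^2 / 36 and a nonnegative
  remainder.\<close>

lemma class_C3_infdist_ge:
  assumes fC: "f \<in> class_C3"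
  shows "1 / 36 * (12 + pi ^ 2) \<le> infdist (f 0) (frontier (f ` ball 0 1))"
proof (rule class_C3_growth[OF fC])
  fix a :: real assume a: "0 < a" "a \<le> 1" and inj: "inj_on f (ball 0 1)"
    and growth: "\<And>z. z \<in> ball 0 1 \<Longrightarrow> 2 / 3 * (norm z / (1 + norm z)) - dilog (- norm z) / 3
       + (1 - a) * (norm z ^ 2 / 12 - 2 * norm z ^ 5 / 25) \<le> norm (f z)"
  have f: "f holomorphic_on ball 0 1" "f 0 = 0" using fC by (auto simp: class_C3_def)
  define V where "V = (\<lambda>r::real. 2 / 3 * (r / (1 + r)) - dilog (- r) / 3 + (1 - a) * (r ^ 2 / 12 - 2 * r ^ 5 / 25))"
  define D where "D = 1 / 36 * (12 + pi ^ 2)"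
  have V1: "D \<le> V 1" using a by (simp add: V_def D_def dilog_minus_1)
  have contV: "continuous_on {0..1} V"
    unfolding V_def by (intro continuous_intros continuous_on_compose2[OF continuous_on_dilog]) auto
  have op: "open (f ` ball 0 1)" by (rule open_mapping_thm3[OF f(1) open_ball inj])
  have main: "D \<le> dist (f 0) w" if w: "w \<in> frontier (f ` ball 0 1)" for w
  proof (rule field_le_epsilon)
    fix \<epsilon> :: real assume "\<epsilon> > 0"
    define \<epsilon>' where "\<epsilon>' = \<epsilon> / 2"
    have \<epsilon>': "\<epsilon>' > 0" using \<open>\<epsilon> > 0\<close> by (simp add: \<epsilon>'_def)
    obtain \<delta> where \<delta>: "\<delta> > 0" "\<And>r. r \<in> {0..1} \<Longrightarrow> dist r 1 < \<delta> \<Longrightarrow> dist (V r) (V 1) < \<epsilon>'"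
      using contV \<epsilon>' unfolding continuous_on_iff by (metis atLeastAtMost_iff order_refl zero_le_one)
    define s where "s = max 0 (1 - \<delta> / 2)"
    have s: "0 \<le> s" "s < 1" "1 - s < \<delta>" using \<delta>(1) by (auto simp: s_def max_def)
    \<comment> \<open>A frontier point is not in the open image, so it has positive distance from
      this compact part; hence \<open>f z\<close> near it forces \<open>norm z > s\<close>.\<close>
    have "compact (f ` cball 0 s)"
      using s by (intro compact_continuous_image holomorphic_on_imp_continuous_on
          holomorphic_on_subset[OF f(1)]) auto
    moreover have "w \<notin> f ` cball 0 s"
    proof
      assume "w \<in> f ` cball 0 s"
      then have "w \<in> f ` ball 0 1" using s by auto
      then show False using w op by (simp add: frontier_def interior_open)
    qed
    ultimately have "open (- f ` cball 0 s)" "w \<in> - f ` cball 0 s"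
      using compact_imp_closed by auto
    then obtain \<eta> where \<eta>: "\<eta> > 0" "ball w \<eta> \<subseteq> - f ` cball 0 s"
      using open_contains_ball by blast
    have "w \<in> closure (f ` ball 0 1)" using w by (simp add: frontier_def)
    moreover have "min \<eta> \<epsilon>' > 0" using \<eta> \<epsilon>' by simp
    ultimately obtain y where y: "y \<in> f ` ball 0 1" "dist y w < min \<eta> \<epsilon>'"
      unfolding closure_approachable by metis
    then obtain z where z: "z \<in> ball 0 1" "y = f z" by auto
    have "f z \<notin> f ` cball 0 s" using \<eta>(2) y z by (auto simp: dist_commute)
    then have "norm z > s" by auto
    then have "dist (V (norm z)) (V 1) < \<epsilon>'"
      using z s by (intro \<delta>(2)) (auto simp: dist_real_def)
    then have "D - \<epsilon>' < V (norm z)" using V1 by (simp add: dist_real_def)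
    also have "\<dots> \<le> norm (f z)" using growth[OF z(1)] by (simp add: V_def)
    also have "\<dots> \<le> norm w + dist y w"
      using norm_triangle_sub[of "f z" w] z by (simp add: dist_norm)
    finally show "D \<le> dist (f 0) w + \<epsilon>" using y f by (simp add: \<epsilon>'_def)
  qed
  show ?thesis
    using frontier_image_nonempty[OF f(1) inj] main
    unfolding infdist_def D_def[symmetric] by (auto intro: cINF_greatest)
qed

section \<open>The radius equation and the extremal function\<close>

definition coeff_bound :: "nat \<Rightarrow> real" where
  "coeff_bound n = 2 / 3 + 1 / (3 * real n ^ 2)"

lemma coeff_bound_pos: "coeff_bound n > 0"
  by (simp add: coeff_bound_def add_pos_nonneg)

lemma inverse_square_le: "1 / (3 * real (n + 2) ^ 2) \<le> 1 / 3"
proof -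
  have "1 \<le> real (n + 2) ^ 2" by (intro one_le_power) simp
  then have "1 / (3 * real (n + 2) ^ 2) \<le> 1 / (3 * 1)"
    by (intro divide_left_mono mult_left_mono mult_pos_pos) linarith+
  then show ?thesis by simp
qed

lemma coeff_bound_le_1: "coeff_bound (n + 2) \<le> 1"
  unfolding coeff_bound_def using inverse_square_le[of n] by linarith

lemma summable_shifted_geometric: "\<bar>r\<bar> < 1 \<Longrightarrow> summable (\<lambda>n. r ^ (n + 2))" for r :: real
  by (intro summable_ignore_initial_segment[of "\<lambda>n. r ^ n"] summable_geometric) auto

lemma powr_le_power:
  assumes "0 \<le> r" "r \<le> 1" "p \<ge> 1"
  shows "r powr (real (n + 2) * p) \<le> r ^ (n + 2)"
proof (cases "r = 0")
  case False
  then have "r powr (real (n + 2) * p) \<le> r powr real (n + 2)"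
    using assms by (intro powr_mono') (auto simp: mult_le_cancel_left1)
  moreover have "r powr real (n + 2) = r ^ (n + 2)"
    using False assms by (intro powr_realpow) auto
  ultimately show ?thesis by simp
qed simp

lemma powr_coeff_le:
  assumes "0 \<le> c" "c \<le> 1" "0 \<le> r" "r \<le> 1" "p \<ge> 1"
  shows "c powr p * r powr (real (n + 2) * p) \<le> r ^ (n + 2)"
proof -
  have "c powr p \<le> 1" using assms by (intro powr_le1) auto
  then have "c powr p * r powr (real (n + 2) * p) \<le> 1 * r ^ (n + 2)"
    using powr_le_power[of r p n] assms by (intro mult_mono) auto
  then show ?thesis by simp
qed

lemma summable_powr_coeff:
  assumes "\<And>n. 0 \<le> c n" "\<And>n. c n \<le> 1" "0 \<le> r" "r < 1" "p \<ge> 1"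
  shows "summable (\<lambda>n. c n powr p * r powr (real (n + 2) * p))"
proof (rule summable_comparison_test')
  show "summable (\<lambda>n. r ^ (n + 2))" using assms by (intro summable_shifted_geometric) auto
  show "norm (c n powr p * r powr (real (n + 2) * p)) \<le> r ^ (n + 2)" if "n \<ge> 0" for n
    using powr_coeff_le[of "c n" r p n] assms by (simp add: abs_mult)
qed

lemma summable_coeff:
  assumes "\<And>n. 0 \<le> c n" "\<And>n. c n \<le> (1::real)" "0 \<le> r" "r < 1"
  shows "summable (\<lambda>n. c n * r ^ (n + 2))"
proof (rule summable_comparison_test')
  show "summable (\<lambda>n. r ^ (n + 2))" using assms by (intro summable_shifted_geometric) auto
  show "norm (c n * r ^ (n + 2)) \<le> r ^ (n + 2)" if "n \<ge> 0" for n
    using mult_right_mono[of "c n" 1 "r ^ (n + 2)"] assms by (simp add: abs_mult)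
qed

text \<open>The part 2/3 of each coefficient sums to a geometric series, which together with the
  leading \<open>r\<close> is the rational term of the radius equation.\<close>

lemma extremal_bohr_sum:
  assumes r: "0 \<le> r" "r < 1"
  shows "r + (\<Sum>n. coeff_bound (n + 2) * r ^ (n + 2))
       + (\<Sum>n. coeff_bound (n + 2) powr p * r powr (real (n + 2) * p))
     = radius_fun p r + 1 / 36 * (12 + pi ^ 2)"
proof -
  have s: "summable (\<lambda>n. 1 / (3 * real (n + 2) ^ 2) * r ^ (n + 2))"
  proof (rule summable_coeff[OF _ _ r])
    show "1 / (3 * real (n + 2) ^ 2) \<le> 1" for n
      using inverse_square_le[of n] by linarith
  qed auto
  have "(\<lambda>n. r ^ n) sums (1 / (1 - r))" using r by (intro geometric_sums) auto
  from sums_mult[OF this, of "2 / 3 * r\<^sup>2"]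
  have g: "(\<lambda>n. 2 / 3 * r ^ (n + 2)) sums (2 / 3 * r\<^sup>2 / (1 - r))"
    by (simp add: power_add power2_eq_square mult_ac)
  have "(\<Sum>n. coeff_bound (n + 2) * r ^ (n + 2))
      = 2 / 3 * r\<^sup>2 / (1 - r) + (\<Sum>n. 1 / (3 * real (n + 2) ^ 2) * r ^ (n + 2))"
    using suminf_add[OF sums_summable[OF g] s] sums_unique[OF g]
    by (simp add: coeff_bound_def distrib_right)
  moreover have "r + 2 / 3 * r\<^sup>2 / (1 - r) = (3 - r) * r / (3 * (1 - r))"
    using r by (simp add: field_simps power2_eq_square)
  ultimately show ?thesis
    by (simp add: radius_fun_def coeff_bound_def)
qed

lemma radius_fun_strict_mono:
  assumes "0 \<le> r" "r < s" "s < 1" "p \<ge> 1"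
  shows "radius_fun p r < radius_fun p s"
proof -
  have sb: "summable (\<lambda>n. coeff_bound (n + 2) powr p * t powr (real (n + 2) * p))"
    and sc: "summable (\<lambda>n. coeff_bound (n + 2) * t ^ (n + 2))" if "0 \<le> t" "t < 1" for t
    using that coeff_bound_le_1 assms(4) less_imp_le[OF coeff_bound_pos]
    by (intro summable_powr_coeff summable_coeff; simp)+
  have "(\<Sum>n. coeff_bound (n + 2) * r ^ (n + 2)) \<le> (\<Sum>n. coeff_bound (n + 2) * s ^ (n + 2))"
    using assms coeff_bound_pos
    by (intro suminf_le sc mult_left_mono power_mono) (auto intro: less_imp_le)
  moreover have "(\<Sum>n. coeff_bound (n + 2) powr p * r powr (real (n + 2) * p))
      \<le> (\<Sum>n. coeff_bound (n + 2) powr p * s powr (real (n + 2) * p))"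
    using assms by (intro suminf_le sb mult_left_mono powr_mono2) auto
  ultimately show ?thesis
    using extremal_bohr_sum[of r p] extremal_bohr_sum[of s p] assms by simp
qed

lemma continuous_on_radius_fun:
  assumes "p \<ge> 1"
  shows "continuous_on {0..1/2} (radius_fun p)"
proof -
  have s: "summable (\<lambda>n. (1/2::real) ^ (n + 2))" by (intro summable_shifted_geometric) auto
  have "continuous_on {0..1/2} (\<lambda>r. \<Sum>n. r ^ (n + 2) / (3 * real (n + 2) ^ 2))"
  proof (rule continuous_on_suminf_M_test[OF _ _ s])
    show "norm (r ^ (n + 2) / (3 * real (n + 2) ^ 2)) \<le> (1/2) ^ (n + 2)" if "r \<in> {0..1/2}" for r n
    proof -
      have "1 / (3 * real (n + 2) ^ 2) * r ^ (n + 2) \<le> 1 * (1/2) ^ (n + 2)"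
        using order_trans[OF inverse_square_le[of n], of 1] that by (intro mult_mono power_mono) auto
      then show ?thesis using that by simp
    qed
  qed (auto intro!: continuous_intros)
  moreover have "continuous_on {0..1/2} (\<lambda>r. \<Sum>n. coeff_bound (n + 2) powr p * r powr (real (n + 2) * p))"
  proof (rule continuous_on_suminf_M_test[OF _ _ s])
    show "norm (coeff_bound (n + 2) powr p * r powr (real (n + 2) * p)) \<le> (1/2) ^ (n + 2)"
      if "r \<in> {0..1/2}" for r n
    proof -
      have "coeff_bound (n + 2) powr p * r powr (real (n + 2) * p) \<le> r ^ (n + 2)"
        using that assms coeff_bound_pos[of "n + 2"] coeff_bound_le_1[of n] by (intro powr_coeff_le) auto
      also have "\<dots> \<le> (1/2) ^ (n + 2)" using that by (intro power_mono) auto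
      finally show ?thesis by (simp add: abs_mult)
    qed
    show "continuous_on {0..1/2} (\<lambda>r. coeff_bound (n + 2) powr p * r powr (real (n + 2) * p))" for n
      using assms by (intro continuous_on_mult continuous_on_const continuous_on_powr' continuous_on_id) auto
  qed
  ultimately show ?thesis
    unfolding radius_fun_def coeff_bound_def by (intro continuous_intros) auto
qed

lemma radius_fun_root:
  assumes p: "p \<ge> 1"
  shows "\<exists>!r. r \<in> {0<..<1/2} \<and> radius_fun p r = 0"
proof (rule ex_ex1I)
  have 0: "radius_fun p 0 < 0" by (simp add: radius_fun_def add_pos_nonneg)
  \<comment> \<open>At r = 1/2 the rational term alone is 5/6, while pi < 4 keeps the constant below
    28/36 = 7/9.\<close>
  have "pi ^ 2 \<le> 4 ^ 2" using pi_less_4 by (intro power_mono) auto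
  moreover have "0 \<le> (\<Sum>n. (1/2::real) ^ (n + 2) / (3 * real (n + 2) ^ 2))"
  proof (rule suminf_nonneg)
    have "summable (\<lambda>n. 1 / (3 * real (n + 2) ^ 2) * (1/2) ^ (n + 2))"
      using order_trans[OF inverse_square_le, of 1] by (intro summable_coeff) auto
    then show "summable (\<lambda>n. (1/2::real) ^ (n + 2) / (3 * real (n + 2) ^ 2))" by simp
  qed auto
  moreover have "0 \<le> (\<Sum>n. coeff_bound (n + 2) powr p * (1/2) powr (real (n + 2) * p))"
    using p coeff_bound_pos coeff_bound_le_1
    by (intro suminf_nonneg summable_powr_coeff) (auto intro: less_imp_le)
  ultimately have 1: "radius_fun p (1/2) > 0"
    by (simp add: radius_fun_def coeff_bound_def)
  obtain r where r: "0 \<le> r" "r \<le> 1/2" "radius_fun p r = 0"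
    using IVT'[of "radius_fun p" 0 0 "1/2", OF _ _ _ continuous_on_radius_fun[OF p]] 0 1 by auto
  moreover have "r \<noteq> 0" "r \<noteq> 1/2" using r(3) 0 1 by (metis less_irrefl)+
  ultimately show "\<exists>r. r \<in> {0<..<1/2} \<and> radius_fun p r = 0" by (intro exI[of _ r]) auto
next
  fix r s assume *: "r \<in> {0<..<1/2} \<and> radius_fun p r = 0" "s \<in> {0<..<1/2} \<and> radius_fun p s = 0"
  then show "r = s"
    using radius_fun_strict_mono[of r s p] radius_fun_strict_mono[of s r p] p
    by (cases r s rule: linorder_cases) auto
qed

text \<open>Obtained from the half-plane map z / (1 - z) as \<open>g\<close> and (1 + z) / (1 - z)
  as \<open>p\<close>, the functions for which the coefficient estimates are equalities. There is no
  tilt here.\<close>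

definition extremal :: "complex \<Rightarrow> complex" where
  "extremal z = 2 / 3 * (z / (1 - z)) + dilog z / 3"

lemma one_minus_nonzero: "z \<in> ball 0 1 \<Longrightarrow> 1 - z \<noteq> (0::complex)"
  by auto

lemma one_minus_Ln_domain: "z \<in> ball 0 1 \<Longrightarrow> 1 - z \<notin> (\<real>\<^sub>\<le>\<^sub>0 :: complex set)"
  using complex_Re_le_cmod[of z] by (auto simp: complex_nonpos_Reals_iff)

lemma DERIV_extremal:
  assumes z: "z \<in> ball 0 1"
  shows "(extremal has_field_derivative 2 / 3 * (1 / (1 - z)\<^sup>2) + dilog' z / 3) (at z)"
proof -
  have "((\<lambda>z. z / (1 - z)) has_field_derivative 1 / (1 - z)\<^sup>2) (at z)"
    using one_minus_nonzero[OF z] by (auto intro!: derivative_eq_intros simp: power2_eq_square)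
  moreover have "(dilog has_field_derivative dilog' z) (at z)"
    using z by (intro has_field_derivative_dilog) auto
  ultimately show ?thesis
    unfolding extremal_def[abs_def] by (intro DERIV_add DERIV_cmult DERIV_cdivide)
qed

lemma holomorphic_extremal: "extremal holomorphic_on ball 0 1"
  unfolding holomorphic_on_open[OF open_ball] using DERIV_extremal by blast

lemma taylor_coeff_extremal: "taylor_coeff extremal (n + 2) = of_real (coeff_bound (n + 2))"
proof -
  define F where "F = Abs_fps (\<lambda>n. if n = 0 then 0 else complex_of_real (coeff_bound n))"
  have "(\<lambda>n. fps_nth F n * z ^ n) sums extremal z" if z: "z \<in> ball 0 1" for z
  proof -
    have "(\<lambda>n. z * z ^ n) sums (z * (1 / (1 - z)))"
      using z by (intro sums_mult geometric_sums) auto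
    then have "(\<lambda>n. if n = 0 then 0 else z ^ n) sums (z / (1 - z))"
      using sums_Suc[of "\<lambda>n. if n = 0 then 0 else z ^ n"] by fastforce
    moreover have "(\<lambda>n. 1 / of_nat n ^ 2 * z ^ n) sums dilog z"
      unfolding dilog_def using z by (intro summable_sums summable_dilog) auto
    ultimately have "(\<lambda>n. 2 / 3 * (if n = 0 then 0 else z ^ n) + 1 / of_nat n ^ 2 * z ^ n / 3) sums extremal z"
      unfolding extremal_def by (intro sums_add sums_mult sums_divide)
    moreover have "2 / 3 * (if n = 0 then 0 else z ^ n) + 1 / of_nat n ^ 2 * z ^ n / 3 = fps_nth F n * z ^ n" for n
      by (simp add: F_def coeff_bound_def algebra_simps)
    ultimately show ?thesis by simp
  qed
  then have "\<forall>\<^sub>F z in nhds 0. (\<lambda>n. fps_nth F n * z ^ n) sums extremal z"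
    by (intro eventually_nhds_in_open[THEN eventually_mono, of "ball 0 1"]) auto
  then have "extremal has_fps_expansion F" by (rule has_fps_expansionI)
  then show ?thesis by (simp add: taylor_coeff_def fps_expansion_eqI F_def)
qed

lemma bohr_sum_extremal:
  assumes "0 \<le> r" "r < 1"
  shows "bohr_sum p extremal (of_real r) = radius_fun p r + 1 / 36 * (12 + pi ^ 2)"
  using extremal_bohr_sum[OF assms, of p] assms coeff_bound_pos
  unfolding bohr_sum_def taylor_coeff_extremal
  by (simp add: norm_mult norm_power less_imp_le)

lemma Re_less_norm_iff: "norm w < norm (1 + w) \<longleftrightarrow> Re w > - (1 / 2)"
proof -
  have "norm w < norm (1 + w) \<longleftrightarrow> (norm w)\<^sup>2 < (norm (1 + w))\<^sup>2"
    using power_mono_iff[of "norm (1 + w)" "norm w" 2] by (simp add: not_le[symmetric])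
  also have "\<dots> \<longleftrightarrow> Re w > - (1 / 2)"
    unfolding cmod_power2 by (auto simp: power2_eq_square algebra_simps)
  finally show ?thesis .
qed

text \<open>Inverting w = z / (1 - z) gives z = w / (1 + w), so the disc corresponds to the points
  closer to 0 than to -1.\<close>

lemma convex_function_half_plane: "convex_function (\<lambda>z. z / (1 - z))"
proof -
  have "(\<lambda>z. z / (1 - z)) ` ball 0 1 = {w. Re w > - (1 / 2)}"
  proof (intro set_eqI iffI)
    fix w assume "w \<in> (\<lambda>z. z / (1 - z)) ` ball (0::complex) 1"
    then obtain z where z: "z \<in> ball 0 1" "w = z / (1 - z)" by auto
    have "1 + w = 1 / (1 - z)" using one_minus_nonzero[OF z(1)] by (simp add: z(2) field_simps)
    then have "norm w < norm (1 + w)"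
      using z one_minus_nonzero[OF z(1)] by (simp add: norm_divide divide_strict_right_mono)
    then show "w \<in> {w. Re w > - (1 / 2)}" by (simp add: Re_less_norm_iff)
  next
    fix w assume "w \<in> {w. Re w > - (1 / 2)}"
    then have w: "norm w < norm (1 + w)" by (simp add: Re_less_norm_iff)
    then have nz: "1 + w \<noteq> 0" by auto
    have "1 - w / (1 + w) = 1 / (1 + w)" using nz by (simp add: field_simps)
    then have "w = (w / (1 + w)) / (1 - w / (1 + w))" using nz by simp
    moreover have "w / (1 + w) \<in> ball 0 1" using w nz by (simp add: norm_divide)
    ultimately show "w \<in> (\<lambda>z. z / (1 - z)) ` ball 0 1" by blast
  qed
  moreover have "convex {w. Re w > - (1 / 2)}" by (rule convex_halfspace_Re_gt)
  moreover have "inj_on (\<lambda>z. z / (1 - z)) (ball (0::complex) 1)"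
    using one_minus_nonzero by (intro inj_onI) (auto simp: frac_eq_eq algebra_simps)
  moreover have "(\<lambda>z. z / (1 - z)) holomorphic_on ball 0 1"
    using one_minus_nonzero by (intro holomorphic_intros) auto
  ultimately show ?thesis by (simp add: convex_function_def)
qed

lemma deriv_eq_ball:
  assumes "\<And>z. z \<in> ball 0 1 \<Longrightarrow> f z = g z" "(g has_field_derivative d) (at z)" "z \<in> ball 0 1"
  shows "deriv f z = (d :: complex)"
proof (rule DERIV_imp_deriv)
  show "(f has_field_derivative d) (at z)"
    by (rule has_field_derivative_transform_within_open[OF assms(2) open_ball assms(3)])
       (simp add: assms(1))
qed

lemma Re_Cayley_pos: 
  assumes "z \<in> ball 0 1"
  shows "Re ((1 + z) / (1 - z)) > 0"
proof -
  have "(norm z)\<^sup>2 < 1" using assms by (simp add: power_less_one_iff abs_square_less_1)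
  then have "(Re z)\<^sup>2 + (Im z)\<^sup>2 < 1" by (simp only: cmod_power2)
  then have "Re ((1 + z) * cnj (1 - z)) > 0" by (simp add: power2_eq_square algebra_simps)
  moreover have "Re ((1 + z) / (1 - z)) = Re ((1 + z) * cnj (1 - z)) / (norm (1 - z))\<^sup>2"
    unfolding complex_div_cnj[of "1 + z"] by (simp only: Re_divide_of_real flip: of_real_power)
  ultimately show ?thesis using one_minus_nonzero[OF assms] by simp
qed

lemma extremal_in_class_C3: "extremal \<in> class_C3"
proof -
  have d: "deriv extremal z = 2 / 3 * (1 / (1 - z)\<^sup>2) + dilog' z / 3" if "z \<in> ball 0 1" for z
    using DERIV_extremal[OF that] by (rule DERIV_imp_deriv)
  \<comment> \<open>The closed forms of z f' and z (z f')' for the extremal function: the first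
    differentiation turns the dilogarithm into a logarithm, the second leaves a rational
    function.\<close>
  define \<phi> where "\<phi> = (\<lambda>z::complex. 2 / 3 * (z / (1 - z)\<^sup>2) - Ln (1 - z) / 3)"
  define \<psi> where "\<psi> = (\<lambda>z::complex. 2 / 3 * ((z + z\<^sup>2) / (1 - z) ^ 3) + z / (1 - z) / 3)"
  have \<phi>: "z * deriv extremal z = \<phi> z" if z: "z \<in> ball 0 1" for z
    using times_dilog'_complex[of z] z by (simp add: d \<phi>_def algebra_simps)
  have \<psi>: "w * deriv (\<lambda>v. v * deriv extremal v) w = \<psi> w" if w: "w \<in> ball 0 1" for w
  proof -
    note nz = one_minus_nonzero[OF w]
    have d1: "((\<lambda>z. z / (1 - z)\<^sup>2) has_field_derivative (1 + w) / (1 - w) ^ 3) (at w)"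
    proof -
      have "((\<lambda>z. z / (1 - z)\<^sup>2) has_field_derivative
          ((1 - w)\<^sup>2 - w * (- (2 * (1 - w)))) / ((1 - w)\<^sup>2 * (1 - w)\<^sup>2)) (at w)"
        using nz by (auto intro!: derivative_eq_intros)
      also have "((1 - w)\<^sup>2 - w * (- (2 * (1 - w)))) / ((1 - w)\<^sup>2 * (1 - w)\<^sup>2) = (1 + w) / (1 - w) ^ 3"
        using nz by (simp add: divide_simps) algebra
      finally show ?thesis .
    qed
    have d2: "((\<lambda>z. Ln (1 - z)) has_field_derivative - (1 / (1 - w))) (at w)"
      using one_minus_Ln_domain[OF w] by (auto intro!: derivative_eq_intros simp: inverse_eq_divide)
    from DERIV_diff[OF DERIV_cmult[OF d1, of "2 / 3"] DERIV_cdivide[OF d2, of 3]]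
    have "(\<phi> has_field_derivative 2 / 3 * ((1 + w) / (1 - w) ^ 3) - - (1 / (1 - w)) / 3) (at w)"
      by (simp only: \<phi>_def)
    from deriv_eq_ball[OF \<phi> this w]
    show ?thesis by (simp add: \<psi>_def algebra_simps power2_eq_square)
  qed
  have num: "deriv (\<lambda>w. w * deriv (\<lambda>v. v * deriv extremal v) w) z = (1 + z)\<^sup>2 / (1 - z) ^ 4"
    if z: "z \<in> ball 0 1" for z
  proof (rule deriv_eq_ball[OF \<psi> _ z])
    note nz = one_minus_nonzero[OF z]
    have d1: "((\<lambda>z. (z + z\<^sup>2) / (1 - z) ^ 3) has_field_derivative
        ((1 + 2 * z) * (1 - z) ^ 3 - (z + z\<^sup>2) * (- (3 * (1 - z)\<^sup>2))) / ((1 - z) ^ 3 * (1 - z) ^ 3)) (at z)"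
      using nz by (auto intro!: derivative_eq_intros)
    have d2: "((\<lambda>z. z / (1 - z)) has_field_derivative 1 / (1 - z)\<^sup>2) (at z)"
      using nz by (auto intro!: derivative_eq_intros simp: power2_eq_square)
    have "2 / 3 * (((1 + 2 * z) * (1 - z) ^ 3 - (z + z\<^sup>2) * (- (3 * (1 - z)\<^sup>2))) / ((1 - z) ^ 3 * (1 - z) ^ 3))
        + 1 / (1 - z)\<^sup>2 / 3 = (1 + z)\<^sup>2 / (1 - z) ^ 4"
      using nz by (simp add: divide_simps) algebra
    with DERIV_add[OF DERIV_cmult[OF d1, of "2 / 3"] DERIV_cdivide[OF d2, of 3]]
    show "(\<psi> has_field_derivative (1 + z)\<^sup>2 / (1 - z) ^ 4) (at z)"
      by (simp only: \<psi>_def)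
  qed
  define g where "g = (\<lambda>z::complex. z / (1 - z))"
  have dg: "deriv g z = 1 / (1 - z)\<^sup>2" if "z \<in> ball 0 1" for z
    using one_minus_nonzero[OF that] unfolding g_def
    by (auto intro!: DERIV_imp_deriv derivative_eq_intros simp: power2_eq_square)
  have den: "deriv (\<lambda>w. w * deriv g w) z = (1 + z) / (1 - z) ^ 3" if z: "z \<in> ball 0 1" for z
  proof (rule deriv_eq_ball[OF _ _ z])
    note nz = one_minus_nonzero[OF z]
    show "w * deriv g w = w / (1 - w)\<^sup>2" if "w \<in> ball 0 1" for w using dg[OF that] by simp
    have "((\<lambda>z. z / (1 - z)\<^sup>2) has_field_derivative
        ((1 - z)\<^sup>2 - z * (- (2 * (1 - z)))) / ((1 - z)\<^sup>2 * (1 - z)\<^sup>2)) (at z)"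
      using nz by (auto intro!: derivative_eq_intros)
    also have "((1 - z)\<^sup>2 - z * (- (2 * (1 - z)))) / ((1 - z)\<^sup>2 * (1 - z)\<^sup>2) = (1 + z) / (1 - z) ^ 3"
      using nz by (simp add: divide_simps) algebra
    finally show "((\<lambda>w. w / (1 - w)\<^sup>2) has_field_derivative (1 + z) / (1 - z) ^ 3) (at z)" .
  qed
  have "Re (deriv (\<lambda>w. w * deriv (\<lambda>v. v * deriv extremal v) w) z / deriv (\<lambda>w. w * deriv g w) z) > 0"
    if z: "z \<in> ball 0 1" for z
  proof -
    have "1 + z \<noteq> 0" using z by (auto simp: add_eq_0_iff)
    then have "(1 + z)\<^sup>2 / (1 - z) ^ 4 / ((1 + z) / (1 - z) ^ 3) = (1 + z) / (1 - z)"
      using one_minus_nonzero[OF z] by (simp add: divide_simps) algebra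
    then show ?thesis using Re_Cayley_pos[OF z] by (simp only: num[OF z] den[OF z])
  qed
  moreover have "convex_function g" unfolding g_def by (rule convex_function_half_plane)
  moreover have "g 0 = 0" "Re (deriv g 0) > 0" using dg[of 0] by (simp_all add: g_def)
  moreover have "extremal 0 = 0" "deriv extremal 0 = 1"
    using d[of 0] by (simp_all add: extremal_def dilog_0 dilog'_0)
  ultimately show ?thesis
    unfolding class_C3_def using holomorphic_extremal by blast
qed

lemma extremal_of_real:
  assumes "\<bar>x\<bar> < 1"
  shows "extremal (of_real x) = of_real (2 / 3 * (x / (1 - x)) + dilog x / 3)"
proof -
  have "complex_of_real (dilog x) = (\<Sum>n. of_real (1 / of_nat n ^ 2 * x ^ n))"
    unfolding dilog_def by (rule suminf_of_real[OF summable_dilog]) (use assms in simp)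
  then have "dilog (complex_of_real x) = of_real (dilog x)" by (simp add: dilog_def)
  then show ?thesis by (simp add: extremal_def)
qed

lemma cnj_extremal:
  assumes "z \<in> ball 0 1"
  shows "extremal (cnj z) = cnj (extremal z)"
proof -
  have "(\<lambda>n. cnj (1 / of_nat n ^ 2 * z ^ n)) sums cnj (dilog z)"
    unfolding sums_cnj dilog_def using assms by (intro summable_sums summable_dilog) auto
  then have "dilog (cnj z) = cnj (dilog z)" by (simp add: dilog_def sums_iff)
  then show ?thesis by (simp add: extremal_def)
qed

text \<open>The limit of the extremal function along the real axis at -1 is a frontier point at the
  required distance. It is not a value: by symmetry under conjugation and univalence its preimage
  would be real, but on the real axis the function is strictly increasing and stays above this
  limit.\<close>

lemma extremal_infdist_le:
  "infdist (extremal 0) (frontier (extremal ` ball 0 1)) \<le> 1 / 36 * (12 + pi ^ 2)"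
proof (rule class_C3_growth[OF extremal_in_class_C3])
  assume inj: "inj_on extremal (ball 0 1)"
  define D where "D = 1 / 36 * (12 + pi ^ 2)"
  define h where "h = (\<lambda>x::real. 2 / 3 * (x / (1 - x)) + dilog x / 3)"
  have h1: "h (-1) = - D" by (simp add: h_def D_def dilog_minus_1 add_divide_distrib)
  have conth: "continuous_on {-1..x} h" if "x < 1" for x
    unfolding h_def using that
    by (intro continuous_intros continuous_on_subset[OF continuous_on_dilog]) auto
  have h_gt: "h x > - D" if x: "- 1 < x" "x < 1" for x
  proof -
    have "h (-1) < h x"
    proof (rule DERIV_pos_imp_increasing_open[OF x(1) _ conth[OF x(2)]])
      fix t assume t: "-1 < t" "t < x"
      have "((\<lambda>x. x / (1 - x)) has_real_derivative 1 / (1 - t)\<^sup>2) (at t)"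
        using t x by (auto intro!: derivative_eq_intros simp: power2_eq_square)
      moreover have "(dilog has_real_derivative dilog' t) (at t)"
        using t x by (intro has_field_derivative_dilog) auto
      ultimately have "(h has_real_derivative 2 / 3 * (1 / (1 - t)\<^sup>2) + dilog' t / 3) (at t)"
        unfolding h_def by (intro DERIV_add DERIV_cmult DERIV_cdivide)
      moreover have "dilog' t > 0"
      proof (cases t "0::real" rule: linorder_cases)
        case less
        then have "t * dilog' t < 0" using times_dilog'_real[of t] t by simp
        then show ?thesis using less by (simp add: mult_less_0_iff)
      next
        case greater
        then have "t * dilog' t > 0" using times_dilog'_real[of t] t x by simp
        then show ?thesis using greater by (simp add: zero_less_mult_iff)
      qed (simp add: dilog'_0)
      then have "2 / 3 * (1 / (1 - t)\<^sup>2) + dilog' t / 3 > 0" by (simp add: add_nonneg_pos)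
      ultimately show "\<exists>y. (h has_real_derivative y) (at t) \<and> 0 < y" by blast
    qed
    then show ?thesis by (simp add: h1)
  qed
  have out: "of_real (- D) \<notin> extremal ` ball 0 1"
  proof
    assume "of_real (- D) \<in> extremal ` ball 0 1"
    then obtain z where z: "z \<in> ball 0 1" "extremal z = of_real (- D)" by auto
    then have "extremal (cnj z) = extremal z" using cnj_extremal[OF z(1)] by simp
    then have "cnj z = z" using inj_onD[OF inj, of "cnj z" z] z by simp
    then obtain x where x: "z = of_real x" using Reals_cnj_iff[of z] by (auto elim: Reals_cases)
    then have "\<bar>x\<bar> < 1" using z by simp
    then have "h x = - D" using extremal_of_real[of x] z x by (simp add: h_def del: of_real_add of_real_mult of_real_divide of_real_minus)
    then show False using h_gt[of x] \<open>\<bar>x\<bar> < 1\<close> by (auto simp: abs_less_iff)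
  qed
  have "of_real (- D) \<in> closure (extremal ` ball 0 1)"
    unfolding closure_approachable
  proof (intro allI impI)
    fix \<epsilon> :: real assume "\<epsilon> > 0"
    have "continuous_on {-1..0} h" by (rule conth) simp
    then obtain \<delta> where \<delta>: "\<delta> > 0" "\<And>x. x \<in> {-1..0} \<Longrightarrow> dist x (-1) < \<delta> \<Longrightarrow> dist (h x) (h (-1)) < \<epsilon>"
      using \<open>\<epsilon> > 0\<close> unfolding continuous_on_iff
      by (metis atLeastAtMost_iff order_refl neg_le_0_iff_le zero_le_one)
    define x where "x = min 0 (-1 + \<delta> / 2)"
    have x: "x \<in> {-1..0}" "dist x (-1) < \<delta>" "\<bar>x\<bar> < 1" using \<delta>(1) by (auto simp: x_def dist_real_def min_def)
    have "dist (extremal (of_real x)) (of_real (- D)) = dist (h x) (h (-1))"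
      unfolding extremal_of_real[OF x(3)] h1 dist_of_real by (simp only: h_def)
    also have "\<dots> < \<epsilon>" by (rule \<delta>(2)[OF x(1,2)])
    finally show "\<exists>y\<in>extremal ` ball 0 1. dist y (of_real (- D)) < \<epsilon>"
      using x(3) by (intro bexI[of _ "extremal (of_real x)"]) auto
  qed
  then have "of_real (- D) \<in> frontier (extremal ` ball 0 1)"
    using out interior_subset unfolding frontier_def by blast
  from infdist_le[OF this, of "extremal 0"]
  have "infdist (extremal 0) (frontier (extremal ` ball 0 1)) \<le> norm (of_real D :: complex)"
    by (simp add: dist_norm extremal_def[of 0] dilog_0)
  also have "\<dots> = D" unfolding norm_of_real by (simp add: D_def)
  finally show ?thesis by (simp only: D_def)
qed

section \<open>Majorising the Bohr sum, and sharpness of the radius\<close>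

lemma class_C3_coeff_le:
  assumes "f \<in> class_C3"
  shows "norm (taylor_coeff f (n + 2)) \<le> coeff_bound (n + 2)"
  using class_C3_coeff_bound[OF assms, of "Suc n"] by (simp add: coeff_bound_def)

lemma bohr_sum_le:
  assumes f: "f \<in> class_C3" and z: "norm z < 1" and p: "p \<ge> 1"
  shows "summable (\<lambda>n. norm (taylor_coeff f (n + 2) * z ^ (n + 2)))"
    and "summable (\<lambda>n. norm (taylor_coeff f (n + 2)) powr p * norm z powr (real (n + 2) * p))"
    and "bohr_sum p f z \<le> radius_fun p (norm z) + 1 / 36 * (12 + pi ^ 2)"
proof -
  let ?c = "\<lambda>n. norm (taylor_coeff f (n + 2))"
  have le: "?c n \<le> coeff_bound (n + 2)" for n by (rule class_C3_coeff_le[OF f])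
  have le1: "?c n \<le> 1" for n using le[of n] coeff_bound_le_1[of n] by linarith
  have s1: "summable (\<lambda>n. ?c n * norm z ^ (n + 2))"
    using le1 z by (intro summable_coeff) auto
  then show "summable (\<lambda>n. norm (taylor_coeff f (n + 2) * z ^ (n + 2)))"
    by (simp add: norm_mult norm_power)
  show s2: "summable (\<lambda>n. ?c n powr p * norm z powr (real (n + 2) * p))"
    by (rule summable_powr_coeff[OF _ le1 _ z p]) auto
  have b1: "summable (\<lambda>n. coeff_bound (n + 2) * norm z ^ (n + 2))"
    by (rule summable_coeff[OF less_imp_le[OF coeff_bound_pos] coeff_bound_le_1 norm_ge_zero z])
  have b2: "summable (\<lambda>n. coeff_bound (n + 2) powr p * norm z powr (real (n + 2) * p))"
    by (rule summable_powr_coeff[OF less_imp_le[OF coeff_bound_pos] coeff_bound_le_1 norm_ge_zero z p])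
  have "(\<Sum>n. ?c n * norm z ^ (n + 2)) \<le> (\<Sum>n. coeff_bound (n + 2) * norm z ^ (n + 2))"
    by (intro suminf_le[OF _ s1 b1] mult_right_mono le) auto
  moreover have "(\<Sum>n. ?c n powr p * norm z powr (real (n + 2) * p))
      \<le> (\<Sum>n. coeff_bound (n + 2) powr p * norm z powr (real (n + 2) * p))"
    using p by (intro suminf_le[OF _ s2 b2] mult_right_mono powr_mono2 le) auto
  ultimately show "bohr_sum p f z \<le> radius_fun p (norm z) + 1 / 36 * (12 + pi ^ 2)"
    using extremal_bohr_sum[OF norm_ge_zero z, of p]
    unfolding bohr_sum_def norm_mult norm_power by linarith
qed

theorem theorem4p4:
  fixes p :: real
  assumes "p \<ge> 1"
  shows "(\<forall>f\<in>class_C3. \<forall>z\<in>ball 0 1.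
            summable (\<lambda>n. norm (taylor_coeff f (n + 2) * z ^ (n + 2))) \<and>
            summable (\<lambda>n. norm (taylor_coeff f (n + 2)) powr p * norm z powr (real (n + 2) * p)))
       \<and> (\<exists>!r. r \<in> {0<..<1/2} \<and> radius_fun p r = 0)
       \<and> (\<forall>R. R \<in> {0<..<1/2} \<and> radius_fun p R = 0 \<longrightarrow>
            (\<forall>f\<in>class_C3. \<forall>z. norm z \<le> R \<longrightarrow>
               bohr_sum p f z \<le> infdist (f 0) (frontier (f ` ball 0 1)))
          \<and> (\<forall>\<rho>>R. \<exists>f\<in>class_C3. \<exists>z. norm z < 1 \<and> norm z \<le> \<rho> \<and>
               \<not> bohr_sum p f z \<le> infdist (f 0) (frontier (f ` ball 0 1))))"
proof (intro conjI allI ballI impI)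
  fix f z assume "f \<in> class_C3" "z \<in> ball (0::complex) 1"
  then show "summable (\<lambda>n. norm (taylor_coeff f (n + 2) * z ^ (n + 2)))"
    "summable (\<lambda>n. norm (taylor_coeff f (n + 2)) powr p * norm z powr (real (n + 2) * p))"
    using bohr_sum_le(1,2)[of f z p] assms by auto
next
  show "\<exists>!r. r \<in> {0<..<1/2} \<and> radius_fun p r = 0" by (rule radius_fun_root[OF assms])
next
  fix R f and z :: complex
  assume R: "R \<in> {0<..<1/2} \<and> radius_fun p R = 0" and f: "f \<in> class_C3" and z: "norm z \<le> R"
  have "bohr_sum p f z \<le> radius_fun p (norm z) + 1 / 36 * (12 + pi ^ 2)"
    using R z by (intro bohr_sum_le(3) f assms) auto
  moreover have "radius_fun p (norm z) \<le> radius_fun p R"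
    using radius_fun_strict_mono[of "norm z" R p] R z assms by (cases "norm z = R") auto
  ultimately show "bohr_sum p f z \<le> infdist (f 0) (frontier (f ` ball 0 1))"
    using class_C3_infdist_ge[OF f] R by linarith
next
  fix R \<rho> assume R: "R \<in> {0<..<1/2} \<and> radius_fun p R = 0" and \<rho>: "R < \<rho>"
  \<comment> \<open>The cap 1/2 keeps the test point in the disc when \<rho> is large and still
    exceeds \<open>R\<close>. At a positive real point the extremal function attains the majorant,
    since all its coefficients from index 2 on are positive.\<close>
  define r where "r = min \<rho> (1 / 2)"
  have r: "0 \<le> r" "R < r" "r < 1" "r \<le> \<rho>" using R \<rho> by (auto simp: r_def)
  have "radius_fun p R < radius_fun p r"
    using R r assms by (intro radius_fun_strict_mono) auto
  then have "1 / 36 * (12 + pi ^ 2) < bohr_sum p extremal (of_real r)"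
    using bohr_sum_extremal[OF r(1,3), of p] R by simp
  then have "\<not> bohr_sum p extremal (of_real r) \<le> infdist (extremal 0) (frontier (extremal ` ball 0 1))"
    using extremal_infdist_le by linarith
  then show "\<exists>f\<in>class_C3. \<exists>z. norm z < 1 \<and> norm z \<le> \<rho> \<and>
      \<not> bohr_sum p f z \<le> infdist (f 0) (frontier (f ` ball 0 1))"
    using r by (intro bexI[OF _ extremal_in_class_C3] exI[of _ "of_real r"]) auto
qed

end
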